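(* Let $x^0\in L^2(I,\mathbb{R}^d)$ and let $a:\mathbb{R}_+\times I\times I\to[0,1]$ be Lebesgue measurable. Assume that there exist $\tau_d>0$ and an increasing sequence $(t_k)_{k\geq 0}\subset\mathbb{R}_+$ with $t_0=0$ and $t_{k+1}-t_k\geq\tau_d$ for every $k\geq 0$, such that $t\in[t_k,t_{k+1})\mapsto a(t)\in L^\infty(I\times I,[0,1])$ is constant for each $k\geq 0$. Suppose that for almost every $t\geq 0$ the kernel $a(t)$ defines a disjoint union of strongly connected components, and denote by $v(t)\in L^\infty(I,(0,+\infty))$ the associated canonical vector. Assume that there exist $\tau>0$, $\mu\in(0,1]$ and $\nu\in(0,1]$ satisfying $$\frac{2}{\mu\nu^2}\log\Big(\frac1\nu\Big)<\tau_d$$ and such that, for all times $t\geq 0$, $$\frac1\tau\int_t^{t+\tau}\lambda_2(\mathbb{L}_v(s))\,\mathrm{d}s\geq\mu\qquad\text{and}\qquad\nu\leq v(t,i)\leq\frac1\nu\ \text{ for almost every } i\in I .$$ Let $x(\cdot)\in\mathrm{Lip}_{\mathrm{loc}}(\mathbb{R}_+,L^2(I,\mathbb{R}^d))$ be the solution of $$\partial_t x(t,i)=\int_I a(t,i,j)(x(t,j)-x(t,i))\,\mathrm{d}j,\qquad x(0)=x^0 .$$ Then there exist an element $x^\infty\in\mathcal{C}(x^0)$ and a constant $\alpha>0$ depending only on $(\tau,\mu,\nu)$ such that $$\|x(t)-x^\infty\|_{L^2(I,\mathbb{R}^d)}\leq\alpha\,\|x(0)-\bar{x}^0\|_{L^2(I,\mathbb{R}^d)}\exp\Big(-\big(\mu\nu^2-\tfrac{2}{\tau_d}\log(\tfrac1\nu)\big)t\Big)\qquad\text{for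 all } t\geq 0 .$$
   Context: $I:=[0,1]$ with the Lebesgue measure $|\cdot|$, $d\geq 1$ is an integer, $\mathbb{R}_+=[0,+\infty)$. The dynamics is understood for almost every $t\geq0$ and almost every $i\in I$. $\bar{x}^0:=\int_I x^0(i)\,\mathrm{d}i$. $\mathcal{C}(x^0)\subset\mathbb{R}^d$ is the closed convex hull of the essential range of $x^0$. Elements of $\mathbb{R}^d$ are identified with constant functions. Strong connectivity. The topology described by a kernel $a\in L^\infty(I\times I,[0,1])$ is strongly connected if: (a) for almost every $i\in I$ and for each Lebesgue point $j\in I\setminus\{i\}$ of $a(i,\cdot)\in L^\infty(I,[0,1])$, there exist an integer $m\geq1$ and a finite sequence $(l_k)_{1\leq k\leq m}\subset I$ with $i=l_1$, $j=l_m$ such that $l_{k+1}\in\mathrm{supp}(a(l_k,\cdot))$ is a Lebesgue point of $a(l_k,\cdot)$ for each $k\in\{1,\dots,m-1\}$; and (b) $\operatorname{ess\,inf}_{i\in I}\int_I a(i,j)\,\mathrm{d}j>0$. Disjoint unions. The topology is a disjoint union of strongly connected components if there is an at most countable family of sets $\{I_n\}_{n\geq1}$ with $I=\bigcup_n I_n$ such that, for all $m\neq n$, $|I_n|>0$, $|I_n\cap I_m|=0$ and $\mathrm{supp}(a(i_n,\cdot))\subset I_n$ for almost every $i_n\in I_n$, and on which the restrictions of $a$ to $I_n\times I_n$ define strongly connected topologies (same definition with $I$ replaced by $I_n$) satisfying, for some $\delta>0$ independent of $n$, $\operatorname{ess\,inf}_{i_n\in I_n}\frac{1}{|I_n|}\int_{I_n}a(i_n,j)\,\mathrm{d}j\geq\delta$.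 Graph-Laplacian and canonical vector. $\mathbb{L}(t)$ is the operator on $L^2(I,\mathbb{R}^d)$ given by $(\mathbb{L}(t)y)(i):=\int_I a(t,i,j)(y(i)-y(j))\,\mathrm{d}j$, and $\mathbb{L}(t)^*$ is its adjoint. For a kernel $a(t)$ defining a disjoint union of strongly connected components $\{I_n\}$, the canonical vector $v(t)\in L^\infty(I,(0,+\infty))$ is the (uniquely determined) element such that $\mathbb{L}(t)^*(v(t),\dots,v(t))=0$ in $L^2(I,\mathbb{R}^d)$, i.e. $\int_I\big(a(t,i,j)v(t,i)-a(t,j,i)v(t,j)\big)\mathrm{d}j=0$ for almost every $i$, and $\int_{I_n}v(t,i)\,\mathrm{d}i=|I_n|$ for every $n$ (so $\int_I v(t,i)\,\mathrm{d}i=1$). Algebraic connectivity. $\mathbb{L}_v(t):=\mathcal{M}_{v(t)}\mathbb{L}(t)$, where $(\mathcal{M}_{v(t)}y)(i)=v(t,i)y(i)$. With $\mathscr{C}\subset L^2(I,\mathbb{R}^d)$ the subspace of constant functions, so that $\mathscr{C}^\perp=\{x:\int_I x(i)\,\mathrm{d}i=0\}$, $$\lambda_2(\mathbb{L}_v(t)):=\inf_{x\in\mathscr{C}^\perp\setminus\{0\}}\frac{\langle\mathbb{L}_v(t)x,x\rangle_{L^2(I,\mathbb{R}^d)}}{\|x\|_{L^2(I,\mathbb{R}^d)}^2} .$$ *)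

theory Defs
  imports "HOL-Analysis.Analysis"
begin

text \<open>
  The dimension \<^term>\<open>d\<close> is a natural number and not a type, because the constant asserted by the
  theorem must not depend on it.  A point of the \<^term>\<open>d\<close>-dimensional space is an element of
  \<^term>\<open>topspace (Euclidean_space d)\<close>, i.e. a real sequence vanishing from index \<^term>\<open>d\<close> on, with
  norm \<^term>\<open>\<lambda>z::nat \<Rightarrow> real. L2_set z {..<d}\<close>.  A vector-valued function on the unit interval has
  type \<^typ>\<open>real \<Rightarrow> nat \<Rightarrow> real\<close> (position, then coordinate) and represents its class modulo
  Lebesgue-almost everywhere equality.
\<close>

type_synonym point = "nat \<Rightarrow> real"

type_synonym kernel = "real \<Rightarrow> real \<Rightarrow> real"

abbreviation unit_I :: "real set" where
  "unit_I \<equiv> {0..1}"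

subsection \<open>The space of square-integrable functions\<close>

definition L2_space :: "nat \<Rightarrow> (real \<Rightarrow> point) set" where
  "L2_space d = {y. (\<forall>i\<in>unit_I. y i \<in> topspace (Euclidean_space d)) \<and>
     (\<forall>k<d. (\<lambda>i. y i k) \<in> borel_measurable (lebesgue_on unit_I) \<and>
            integrable (lebesgue_on unit_I) (\<lambda>i. (y i k)\<^sup>2))}"

definition L2_inner :: "nat \<Rightarrow> (real \<Rightarrow> point) \<Rightarrow> (real \<Rightarrow> point) \<Rightarrow> real" where
  "L2_inner d y z = (LINT i|lebesgue_on unit_I. (\<Sum>k<d. y i k * z i k))"

definition L2_norm :: "nat \<Rightarrow> (real \<Rightarrow> point) \<Rightarrow> real" where
  "L2_norm d y = sqrt (LINT i|lebesgue_on unit_I. (L2_set (y i) {..<d})\<^sup>2)"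

definition mean :: "(real \<Rightarrow> point) \<Rightarrow> point" where
  "mean y = (\<lambda>k. LINT i|lebesgue_on unit_I. y i k)"

subsection \<open>Closed convex hull of the essential range\<close>

definition essential_range :: "nat \<Rightarrow> (real \<Rightarrow> point) \<Rightarrow> point set" where
  "essential_range d y = {z \<in> topspace (Euclidean_space d).
     \<forall>r>0. \<not> (AE i in lebesgue_on unit_I. L2_set (\<lambda>k. y i k - z k) {..<d} \<ge> r)}"

text \<open>The library's convex hull is unavailable here, as \<^typ>\<open>nat \<Rightarrow> real\<close> is not an instance of
  \<^class>\<open>real_vector\<close>.\<close>

definition point_convex_hull :: "point set \<Rightarrow> point set" where
  "point_convex_hull S = {z. \<exists>F u. finite F \<and> F \<subseteq> S \<and> (\<forall>p\<in>F. 0 \<le> u p) \<and> (\<Sum>p\<in>F. u p) = 1 \<and>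
     z = (\<lambda>k. \<Sum>p\<in>F. u p * p k)}"

definition closed_hull_range :: "nat \<Rightarrow> (real \<Rightarrow> point) \<Rightarrow> point set" where
  "closed_hull_range d y = Euclidean_space d closure_of point_convex_hull (essential_range d y)"

subsection \<open>Strongly connected kernels\<close>

definition kernel_on_I :: "kernel \<Rightarrow> bool" where
  "kernel_on_I b \<longleftrightarrow>
     (\<lambda>(i, j). b i j) \<in> borel_measurable (lebesgue_on (unit_I \<times> unit_I)) \<and>
     (\<forall>i\<in>unit_I. \<forall>j\<in>unit_I. 0 \<le> b i j \<and> b i j \<le> 1)"

definition ess_inf :: "'a measure \<Rightarrow> ('a \<Rightarrow> real) \<Rightarrow> ereal" where
  "ess_inf M f = Sup {c. AE x in M. c \<le> ereal (f x)}"

text \<open>Lebesgue points are taken relative to the measure space \<^term>\<open>S::real set\<close>: averages are over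
  \<^term>\<open>S \<inter> ball j r\<close>, which must have positive measure.\<close>

definition lebesgue_point :: "real set \<Rightarrow> (real \<Rightarrow> real) \<Rightarrow> real \<Rightarrow> bool" where
  "lebesgue_point S f j \<longleftrightarrow>
     f \<in> borel_measurable (lebesgue_on S) \<and> j \<in> S \<and>
     (\<forall>r>0. measure lebesgue (S \<inter> ball j r) > 0) \<and>
     ((\<lambda>r. (LINT y|lebesgue_on (S \<inter> ball j r). \<bar>f y - f j\<bar>) / measure lebesgue (S \<inter> ball j r))
        \<longlongrightarrow> 0) (at_right 0)"

text \<open>Complement in \<^term>\<open>S::real set\<close> of the largest relatively open subset on which \<^term>\<open>f\<close>
  vanishes almost everywhere.\<close>

definition essential_support :: "real set \<Rightarrow> (real \<Rightarrow> real) \<Rightarrow> real set" where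
  "essential_support S f =
     {j \<in> S. \<forall>r>0. \<not> (AE y in lebesgue_on (S \<inter> ball j r). f y = 0)}"

definition strongly_connected_on :: "real set \<Rightarrow> kernel \<Rightarrow> bool" where
  "strongly_connected_on S b \<longleftrightarrow>
     (AE i in lebesgue_on S. \<forall>j\<in>S - {i}. lebesgue_point S (b i) j \<longrightarrow>
        (\<exists>m\<ge>1. \<exists>l :: nat \<Rightarrow> real.
           (\<forall>k\<in>{1..m}. l k \<in> S) \<and> l 1 = i \<and> l m = j \<and>
           (\<forall>k\<in>{1..m - 1}. l (k + 1) \<in> essential_support S (b (l k)) \<and>
                             lebesgue_point S (b (l k)) (l (k + 1))))) \<and>
     ess_inf (lebesgue_on S) (\<lambda>i. LINT j|lebesgue_on S. b i j) > 0"

text \<open>The family is \<^term>\<open>C n\<close> for \<^term>\<open>n \<in> N\<close>, where \<^term>\<open>N\<close> is any set of natural numbers,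
  finite or infinite.\<close>

definition strongly_connected_components ::
    "kernel \<Rightarrow> nat set \<Rightarrow> (nat \<Rightarrow> real set) \<Rightarrow> bool" where
  "strongly_connected_components b N C \<longleftrightarrow>
     unit_I = (\<Union>n\<in>N. C n) \<and>
     (\<forall>n\<in>N. C n \<in> sets lebesgue \<and> measure lebesgue (C n) > 0) \<and>
     (\<forall>n\<in>N. \<forall>m\<in>N. m \<noteq> n \<longrightarrow> measure lebesgue (C n \<inter> C m) = 0) \<and>
     (\<forall>n\<in>N. AE i in lebesgue_on (C n). essential_support unit_I (b i) \<subseteq> C n) \<and>
     (\<forall>n\<in>N. strongly_connected_on (C n) b) \<and>
     (\<exists>\<delta>::real. \<delta> > 0 \<and> (\<forall>n\<in>N.
        ess_inf (lebesgue_on (C n))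
          (\<lambda>i. (1 / measure lebesgue (C n)) * (LINT j|lebesgue_on (C n). b i j)) \<ge> ereal \<delta>))"

definition canonical_vector ::
    "kernel \<Rightarrow> nat set \<Rightarrow> (nat \<Rightarrow> real set) \<Rightarrow> (real \<Rightarrow> real) \<Rightarrow> bool" where
  "canonical_vector b N C w \<longleftrightarrow>
     w \<in> borel_measurable (lebesgue_on unit_I) \<and>
     (AE i in lebesgue_on unit_I. w i > 0) \<and>
     (\<exists>K. AE i in lebesgue_on unit_I. w i \<le> K) \<and>
     (AE i in lebesgue_on unit_I.
        (LINT j|lebesgue_on unit_I. b i j * w i - b j i * w j) = 0) \<and>
     (\<forall>n\<in>N. (LINT i|lebesgue_on (C n). w i) = measure lebesgue (C n))"

subsection \<open>Graph-Laplacian and algebraic connectivity\<close>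

definition graph_laplacian :: "kernel \<Rightarrow> (real \<Rightarrow> point) \<Rightarrow> real \<Rightarrow> point" where
  "graph_laplacian b y = (\<lambda>i k. LINT j|lebesgue_on unit_I. b i j * (y i k - y j k))"

definition rescaled_laplacian ::
    "kernel \<Rightarrow> (real \<Rightarrow> real) \<Rightarrow> (real \<Rightarrow> point) \<Rightarrow> real \<Rightarrow> point" where
  "rescaled_laplacian b w y = (\<lambda>i k. w i * graph_laplacian b y i k)"

definition algebraic_connectivity :: "nat \<Rightarrow> kernel \<Rightarrow> (real \<Rightarrow> real) \<Rightarrow> real" where
  "algebraic_connectivity d b w =
     Inf {L2_inner d (rescaled_laplacian b w y) y / (L2_norm d y)\<^sup>2 | y.
            y \<in> L2_space d \<and> (\<forall>k<d. mean y k = 0) \<and> L2_norm d y \<noteq> 0}"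

subsection \<open>Solutions of the consensus dynamics\<close>

text \<open>The time derivative is the derivative of the curve in the Hilbert space of square-integrable
  functions, required at almost every time: this makes sense for classes of functions,
  whereas a pointwise derivative at fixed position would depend on the representatives.\<close>

definition consensus_solution ::
    "nat \<Rightarrow> (real \<Rightarrow> kernel) \<Rightarrow> (real \<Rightarrow> point) \<Rightarrow> (real \<Rightarrow> real \<Rightarrow> point) \<Rightarrow> bool" where
  "consensus_solution d a x0 x \<longleftrightarrow>
     (\<forall>t\<ge>0. x t \<in> L2_space d) \<and>
     (\<forall>R\<ge>0. \<exists>K. \<forall>s\<in>{0..R}. \<forall>t\<in>{0..R}. L2_norm d (\<lambda>i k. x t i k - x s i k) \<le> K * \<bar>t - s\<bar>) \<and>
     (AE t in lebesgue_on {0..}.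
        ((\<lambda>h. L2_norm d (\<lambda>i k. (x (t + h) i k - x t i k) / h
                - (LINT j|lebesgue_on unit_I. a t i j * (x t j k - x t i k)))) \<longlongrightarrow> 0) (at 0)) \<and>
     (AE i in lebesgue_on unit_I. x 0 i = x0 i)"

end

theory Submission
  imports Defs "HOL-Probability.Probability_Measure"
begin

text \<open>
  The equation acts coordinatewise, so everything reduces to scalar functions on a probability space.
  On an interval where the kernel is constant, let \<open>w\<close> be the canonical vector.  The weighted mean
  \<open>\<integral> w u\<close> is conserved, and the \<open>w\<close>-weighted variance of \<open>u\<close> decays at rate \<open>2 \<nu> \<lambda>\<^sub>2\<close>; comparing it with
  the unweighted variance at the two ends of the interval costs a factor \<open>1 / \<nu>\<^sup>2\<close> per switch, i.e. at most
  \<open>exp (2 (t / \<tau>d + 1) ln (1 / \<nu>))\<close> up to time \<open>t\<close>.  Whenever \<open>\<lambda>\<^sub>2 > 0\<close>, the canonical vector is determined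
  by the kernel alone (test the spectral gap with the quotient of two candidates), so on one interval
  \<open>\<lambda>\<^sub>2\<close> never exceeds its value for a single fixed weight, even if the components are chosen anew at
  every time.  The mean moves with speed at most twice the deviation, hence converges.
  Half-spaces are invariant by the maximum principle, so separation of points from the closed convex
  hull places the limit there.
\<close>

subsection \<open>Dini derivatives and the Gronwall inequality\<close>

text \<open>The solution is differentiable only at almost every time and only as a curve in the L2
  space, and the functionals applied to it need not be smooth. Growth estimates therefore go through
  Lipschitz functions of time with a one-sided Dini bound almost everywhere, and functionals enter
  through a quadratic upper bound (\<open>upper_smooth\<close>). Kernels are measurable only for the
  completed measure on the square, so each dwell interval receives one representative that is
  measurable for the product sigma-algebra, where Fubini's theorem applies; canonical vectors are
  likewise truncated to [\<nu>, 1 / \<nu>] at every point. The exponent obtained is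
  \<open>rho\<close>, i.e. \<mu> \<nu> - ln (1 / \<nu>) / \<tau>d. The claimed exponent is no larger
  and may be arbitrarily close to 0, where integrating the speed of the mean would cost an unbounded
  constant; since \<open>rho\<close> is at least \<mu> \<nu> / 2, the cost is at most 4 / (\<mu>
  \<nu>) and \<alpha> is free of \<tau>d. The other factors of \<alpha> are exp (\<nu> \<mu>
  \<tau>), for an incomplete averaging window, and 1 / \<nu>, for the dwell interval in
  progress.\<close>

lemma dini_nonincreasing:
  fixes f :: "real \<Rightarrow> real"
  assumes "a \<le> b" and lip: "K-lipschitz_on {a..b} f"
    and dini: "AE t in lebesgue_on {a..b}. \<forall>e>0. \<forall>\<^sub>F h in at_right 0. f (t + h) - f t \<le> e * h"
  shows "f b \<le> f a"
proof -
  have K: "K \<ge> 0" and lipD: "\<bar>f t - f s\<bar> \<le> K * (t - s)" if "a \<le> s" "s \<le> t" "t \<le> b" for s t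
    using lipschitz_onD[OF lip, of t s] that lipschitz_on_nonneg[OF lip] by (auto simp: dist_real_def)
  have bound: "f b - f a \<le> e * (b - a) + K * e" if e: "e > 0" for e
  proof -
    define P where "P t \<longleftrightarrow> (\<forall>e>0. \<forall>\<^sub>F h in at_right 0. f (t + h) - f t \<le> e * h)" for t
    have "AE t in lebesgue. t \<in> {a..b} \<longrightarrow> P t"
      using dini unfolding P_def[symmetric] by (subst (asm) AE_restrict_space_iff) auto
    then obtain N where "\<And>t. t \<in> space lebesgue - N \<Longrightarrow> t \<in> {a..b} \<longrightarrow> P t" "N \<in> null_sets lebesgue"
      by (rule AE_E3) blast
    then have N: "N \<in> null_sets lebesgue" "{t. \<not> (t \<in> {a..b} \<longrightarrow> P t)} \<subseteq> N"
      by auto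
    \<comment> \<open>The times without a Dini bound are enclosed in an open set of measure at most
      \<open>e\<close>; there only the Lipschitz constant is available.\<close>
    then obtain U where U: "open U" "N \<subseteq> U" "U - N \<in> lmeasurable" "emeasure lebesgue (U - N) < ennreal e"
      using sets_lebesgue_outer_open[OF null_setsD2[OF N(1)] e] by blast
    have Neg: "N \<in> lmeasurable" "measure lebesgue N = 0"
      using N by (auto simp: null_sets_def measure_def fmeasurable_def)
    have UN: "U = (U - N) \<union> N" using U(2) by auto
    have Um: "U \<in> lmeasurable" using fmeasurable.Un[OF U(3) Neg(1)] UN by simp
    have mU: "measure lebesgue U \<le> e"
    proof -
      have "measure lebesgue U \<le> measure lebesgue (U - N) + measure lebesgue N"
        using measure_Un_le[of "U - N" lebesgue N] U(3) Neg UN by (auto dest: fmeasurableD)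
      moreover have "measure lebesgue (U - N) \<le> e"
        using U(3,4) e by (simp add: emeasure_eq_measure2 ennreal_less_iff)
      ultimately show ?thesis using Neg by simp
    qed
    define g where "g t = measure lebesgue (U \<inter> {a..t})" for t
    have gm: "U \<inter> {a..t} \<in> lmeasurable" for t
      using Um by (simp add: fmeasurable_Int_fmeasurable)
    have gstep: "g s \<le> g t \<and> g t - g s \<le> t - s" if "s \<le> t" for s t
    proof -
      have "g s \<le> g t"
        unfolding g_def using that gm fmeasurableD[OF gm] by (intro measure_mono_fmeasurable) auto
      moreover have "g t \<le> measure lebesgue (U \<inter> {a..s} \<union> {s..t})"
        unfolding g_def using gm[of t] gm[of s] that
        by (intro measure_mono_fmeasurable) (auto intro: fmeasurable.Un)
      moreover have "\<dots> \<le> g s + (t - s)"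
        using measure_Un_le[of "U \<inter> {a..s}" lebesgue "{s..t}"] gm[of s] that g_def by (auto dest: fmeasurableD)
      ultimately show ?thesis by linarith
    qed
    \<comment> \<open>\<open>F\<close> cannot exceed its present value just after any time before
      \<open>b\<close>: inside \<open>U\<close> the term \<open>K * g\<close> grows with slope
      \<open>K\<close> and absorbs the Lipschitz bound, and outside \<open>U\<close> the linear term
      absorbs the Dini bound. At \<open>b\<close> both corrections are of order
      \<open>e\<close>.\<close>
    define F where "F t = f t - f a - e * (t - a) - K * g t" for t
    have "continuous_on {a..b} g"
    proof (rule lipschitz_on_continuous_on[of 1], rule lipschitz_on_leI)
      show "dist (g s) (g t) \<le> 1 * dist s t" if "s \<le> t" for s t
        using gstep[OF that] that by (simp add: dist_real_def)
    qed simp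
    then have contF: "continuous_on {a..b} F"
      unfolding F_def by (intro continuous_intros lipschitz_on_continuous_on[OF lip])
    have "compact ({a..b} \<inter> F -` {..0})"
      using continuous_closed_preimage[OF contF closed_atLeastAtMost closed_atMost]
        compact_Int_closed[OF compact_Icc[of a b]] by (metis inf.left_idem)
    moreover have "{a..b} \<inter> F -` {..0} = {t \<in> {a..b}. F t \<le> 0}" by auto
    ultimately have "compact {t \<in> {a..b}. F t \<le> 0}" by simp
    moreover have "F a \<le> 0"
      using K[of a a] \<open>a \<le> b\<close> by (simp add: F_def g_def)
    then have "{t \<in> {a..b}. F t \<le> 0} \<noteq> {}" using \<open>a \<le> b\<close> by auto
    \<comment> \<open>\<open>s\<close> is the last time with \<open>F s \<le> 0\<close>. If it came
      before \<open>b\<close>, some later time would satisfy the inequality too.\<close>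
    ultimately obtain s where s: "a \<le> s" "s \<le> b" "F s \<le> 0"
      and smax: "\<And>t. a \<le> t \<Longrightarrow> t \<le> b \<Longrightarrow> F t \<le> 0 \<Longrightarrow> t \<le> s"
      using compact_attains_sup[of "{t \<in> {a..b}. F t \<le> 0}"] by auto
    have "s = b"
    proof (rule ccontr)
      assume "s \<noteq> b"
      then have sb: "s < b" using s by simp
      have small: "\<forall>\<^sub>F h in at_right 0. h < b - s \<and> h > 0"
        using sb by (auto simp: eventually_at_right_field intro!: exI[of _ "b - s"])
      have "\<forall>\<^sub>F h in at_right 0. F (s + h) \<le> F s"
      proof (cases "s \<in> U")
        case True
        then obtain r where r: "r > 0" "ball s r \<subseteq> U" using U(1) openE by blast
        have "\<forall>\<^sub>F h in at_right 0. h < r"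
          using r by (auto simp: eventually_at_right_field)
        with small show ?thesis
        proof eventually_elim
          case (elim h)
          have "U \<inter> {a..s + h} = (U \<inter> {a..s}) \<union> {s<..s+h}"
            using r(2) elim s by (auto simp: subset_iff dist_real_def)
          then have "g (s + h) = measure lebesgue ((U \<inter> {a..s}) \<union> {s<..s+h})" by (simp add: g_def)
          also have "\<dots> = g s + measure lebesgue {s<..s+h}"
            unfolding g_def
          proof (rule measure_Union)
            show "emeasure lebesgue (U \<inter> {a..s}) \<noteq> \<infinity>" "U \<inter> {a..s} \<in> sets lebesgue"
              using gm[of s] by (auto simp: fmeasurable_def)
          qed (use elim in auto)
          finally have "g (s + h) = g s + h" using elim by simp
          moreover have "f (s + h) - f s \<le> K * h" using lipD[of s "s+h"] elim s by auto
          moreover have "0 \<le> e * h" using elim e by simp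
          ultimately show ?case by (simp add: F_def algebra_simps)
        qed
      next
        case False
        then have "P s" using N U s by auto
        then have "\<forall>\<^sub>F h in at_right 0. f (s + h) - f s \<le> e * h" using e by (auto simp: P_def)
        with small show ?thesis
        proof eventually_elim
          case (elim h)
          have "K * g s \<le> K * g (s + h)" using gstep[of s "s+h"] elim K[of a a] \<open>a \<le> b\<close> by (intro mult_left_mono) auto
          then show ?case using elim by (simp add: F_def algebra_simps)
        qed
      qed
      then obtain h where "h < b - s \<and> h > 0" "F (s + h) \<le> F s"
        using eventually_happens'[OF trivial_limit_at_right_real eventually_conj[OF small]] by blast
      then show False using smax[of "s + h"] s by auto
    qed
    then have "F b \<le> 0" using s by simp
    moreover have "g b \<le> e"
      using mU measure_mono_fmeasurable[of "U \<inter> {a..b}" U lebesgue] Um gm[of b] by (auto simp: g_def dest: fmeasurableD)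
    then have "K * g b \<le> K * e" using K[of a a] \<open>a \<le> b\<close> by (intro mult_left_mono) auto
    ultimately show ?thesis by (simp add: F_def)
  qed
  show ?thesis
  proof (rule field_le_epsilon)
    fix d :: real assume "d > 0"
    have C: "b - a + K + 1 > 0" using K[of a a] \<open>a \<le> b\<close> by auto
    define q where "q = d / (b - a + K + 1)"
    have "q > 0" "q * (b - a + K + 1) = d" using C \<open>d > 0\<close> by (auto simp: q_def)
    then have "q * (b - a + K) \<le> d" by (simp add: algebra_simps)
    moreover have "f b - f a \<le> q * (b - a + K)" using bound[OF \<open>q > 0\<close>] by (simp add: algebra_simps)
    ultimately have "f b - f a \<le> d" by simp
    then show "f b \<le> f a + d" by simp
  qed
qed

text \<open>The integrating factor exp (- c t) reduces the inequality to the nonincreasing case.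
  Neither \<open>c\<close> nor \<open>f\<close> has a fixed sign: decay of the variance uses a
  nonpositive \<open>c\<close>, the maximum principle a positive one.\<close>

lemma dini_gronwall:
  fixes f :: "real \<Rightarrow> real"
  assumes "a \<le> b" and lip: "K-lipschitz_on {a..b} f"
    and dini: "AE t in lebesgue_on {a..b}. \<forall>e>0. \<forall>\<^sub>F h in at_right 0. f (t + h) - f t \<le> (c * f t + e) * h"
  shows "f b \<le> exp (c * (b - a)) * f a"
proof -
  define F where "F t = exp (- c * t) * f t" for t
  obtain B where B: "\<And>t. t \<in> {a..b} \<Longrightarrow> \<bar>f t\<bar> \<le> B"
    using compact_imp_bounded[OF compact_continuous_image[OF lipschitz_on_continuous_on[OF lip] compact_Icc]]
    unfolding bounded_iff by force
  have "convex {a..b}" by simp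
  define E where "E = exp (\<bar>c\<bar> * (\<bar>a\<bar> + \<bar>b\<bar>))"
  have E: "exp (- c * t) \<le> E" if "t \<in> {a..b}" for t
  proof -
    have "- c * t \<le> \<bar>c\<bar> * \<bar>t\<bar>" using abs_ge_self[of "- c * t"] by (simp add: abs_mult)
    also have "\<dots> \<le> \<bar>c\<bar> * (\<bar>a\<bar> + \<bar>b\<bar>)" using that by (intro mult_left_mono) auto
    finally show ?thesis by (simp add: E_def)
  qed
  have lipe: "\<bar>exp (- c * t) - exp (- c * s)\<bar> \<le> (\<bar>c\<bar> * E) * \<bar>t - s\<bar>" if "s \<in> {a..b}" "t \<in> {a..b}" for s t
  proof -
    have "norm (exp (- c * t) - exp (- c * s)) \<le> (\<bar>c\<bar> * E) * norm (t - s)"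
    proof (rule field_differentiable_bound[OF \<open>convex {a..b}\<close>])
      show "((\<lambda>z. exp (- c * z)) has_field_derivative (- c * exp (- c * z))) (at z within {a..b})" for z
        by (auto intro!: derivative_eq_intros)
      show "norm (- c * exp (- c * z)) \<le> \<bar>c\<bar> * E" if "z \<in> {a..b}" for z
        using E[OF that] by (simp add: abs_mult mult_left_mono)
    qed (use that in auto)
    then show ?thesis by simp
  qed
  have K: "K \<ge> 0" using lip lipschitz_on_nonneg by blast
  have B0: "B \<ge> 0" using B[of a] \<open>a \<le> b\<close> by auto
  have "(E * K + B * (\<bar>c\<bar> * E))-lipschitz_on {a..b} F"
  proof (rule lipschitz_onI)
    fix s t assume st: "s \<in> {a..b}" "t \<in> {a..b}"
    have "F s - F t = exp (- c * s) * (f s - f t) + f t * (exp (- c * s) - exp (- c * t))"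
      by (simp add: F_def algebra_simps)
    then have "\<bar>F s - F t\<bar> \<le> exp (- c * s) * \<bar>f s - f t\<bar> + \<bar>f t\<bar> * \<bar>exp (- c * s) - exp (- c * t)\<bar>"
      using abs_triangle_ineq[of "exp (- c * s) * (f s - f t)" "f t * (exp (- c * s) - exp (- c * t))"]
      by (simp add: abs_mult)
    also have "\<dots> \<le> E * (K * \<bar>s - t\<bar>) + B * ((\<bar>c\<bar> * E) * \<bar>s - t\<bar>)"
      using E[OF st(1)] B[OF st(2)] lipe[OF st(2) st(1)] lipschitz_onD[OF lip st] B0
      by (intro add_mono mult_mono) (auto simp: dist_real_def E_def)
    finally show "dist (F s) (F t) \<le> (E * K + B * (\<bar>c\<bar> * E)) * dist s t"
      by (simp add: dist_real_def algebra_simps)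
  qed (use K B0 in \<open>auto simp: E_def\<close>)
  moreover have "AE t in lebesgue_on {a..b}. \<forall>e>0. \<forall>\<^sub>F h in at_right 0. F (t + h) - F t \<le> e * h"
    using dini
  proof eventually_elim
    case (elim t)
    show ?case
    proof (intro allI impI)
      fix e :: real assume e: "e > 0"
      \<comment> \<open>After multiplication by exp (- c t) this is \<open>e / 2\<close>, so the
        limit of the bound on the difference quotient stays strictly below \<open>e\<close>.\<close>
      define d where "d = e * exp (c * t) / 2"
      have d: "d > 0" "exp (- c * t) * d < e" using e by (auto simp: d_def exp_minus field_simps)
      have "((\<lambda>h. (exp (- c * (t + h)) - exp (- c * t)) / h) \<longlongrightarrow> - c * exp (- c * t)) (at 0)"
        by (rule DERIV_D) (auto intro!: derivative_eq_intros)
      then have D: "((\<lambda>h. (exp (- c * (t + h)) - exp (- c * t)) / h) \<longlongrightarrow> - c * exp (- c * t)) (at_right 0)"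
        by (rule tendsto_mono[rotated]) (simp add: at_le)
      have "((\<lambda>h. exp (- c * (t + h)) * (c * f t + d) + f t * ((exp (- c * (t + h)) - exp (- c * t)) / h))
          \<longlongrightarrow> exp (- c * (t + 0)) * (c * f t + d) + f t * (- c * exp (- c * t))) (at_right 0)"
        by (intro tendsto_intros D)
      moreover have "exp (- c * (t + 0)) * (c * f t + d) + f t * (- c * exp (- c * t)) < e"
        using d by (simp add: algebra_simps)
      ultimately have "\<forall>\<^sub>F h in at_right 0. exp (- c * (t + h)) * (c * f t + d)
          + f t * ((exp (- c * (t + h)) - exp (- c * t)) / h) < e"
        by (rule order_tendstoD)
      moreover have "\<forall>\<^sub>F h in at_right 0. f (t + h) - f t \<le> (c * f t + d) * h" using elim d by blast
      moreover have "\<forall>\<^sub>F h::real in at_right 0. h > 0" by (rule eventually_at_right_less)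
      ultimately show "\<forall>\<^sub>F h in at_right 0. F (t + h) - F t \<le> e * h"
      proof eventually_elim
        case (elim h)
        have "F (t + h) - F t = exp (- c * (t + h)) * (f (t + h) - f t) + f t * (exp (- c * (t + h)) - exp (- c * t))"
          by (simp add: F_def algebra_simps)
        also have "\<dots> \<le> exp (- c * (t + h)) * ((c * f t + d) * h) + f t * (exp (- c * (t + h)) - exp (- c * t))"
          using elim by (intro add_right_mono mult_left_mono) auto
        also have "\<dots> = (exp (- c * (t + h)) * (c * f t + d)
          + f t * ((exp (- c * (t + h)) - exp (- c * t)) / h)) * h"
          using elim by (simp add: field_simps)
        also have "\<dots> \<le> e * h" using elim by (intro mult_right_mono) auto
        finally show ?case .
      qed
    qed
  qed
  ultimately have "F b \<le> F a" by (rule dini_nonincreasing[OF \<open>a \<le> b\<close>])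
  then have "exp (c * b) * F b \<le> exp (c * b) * F a" by (intro mult_left_mono) auto
  moreover have "exp (c * b) * F b = f b" by (simp add: F_def exp_minus)
  moreover have "exp (c * b) * F a = exp (c * (b - a)) * f a"
    by (simp add: F_def exp_minus exp_diff right_diff_distrib divide_inverse)
  ultimately show ?thesis by simp
qed

subsection \<open>Square-integrable functions\<close>

definition sq_integrable :: "'a measure \<Rightarrow> ('a \<Rightarrow> real) \<Rightarrow> bool" where
  "sq_integrable M y \<longleftrightarrow> y \<in> borel_measurable M \<and> integrable M (\<lambda>i. (y i)\<^sup>2)"

definition l2norm :: "'a measure \<Rightarrow> ('a \<Rightarrow> real) \<Rightarrow> real" where
  "l2norm M y = sqrt (\<integral>i. (y i)\<^sup>2 \<partial>M)"

lemma sq_integrableD [measurable_dest]: "sq_integrable M y \<Longrightarrow> y \<in> borel_measurable M"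
  by (simp add: sq_integrable_def)

lemma l2norm_nonneg [simp]: "0 \<le> l2norm M y"
  by (simp add: l2norm_def)

lemma l2norm_power2: "(l2norm M y)\<^sup>2 = (\<integral>i. (y i)\<^sup>2 \<partial>M)"
  by (simp add: l2norm_def)

lemma sq_integrable_mult:
  assumes "sq_integrable M f" "sq_integrable M g"
  shows "integrable M (\<lambda>i. f i * g i)"
proof (rule Bochner_Integration.integrable_bound)
  show "integrable M (\<lambda>i. (f i)\<^sup>2 + (g i)\<^sup>2)" using assms by (auto simp: sq_integrable_def)
  show "(\<lambda>i. f i * g i) \<in> borel_measurable M" using assms by (auto simp: sq_integrable_def)
  show "AE i in M. norm (f i * g i) \<le> norm ((f i)\<^sup>2 + (g i)\<^sup>2)"
  proof (rule AE_I2)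
    fix i
    have "0 \<le> (\<bar>f i\<bar> - \<bar>g i\<bar>)\<^sup>2 + \<bar>f i\<bar> * \<bar>g i\<bar>" by simp
    then show "norm (f i * g i) \<le> norm ((f i)\<^sup>2 + (g i)\<^sup>2)"
      by (simp add: power2_eq_square algebra_simps abs_mult)
  qed
qed

lemma sq_integrable_cmult: "sq_integrable M f \<Longrightarrow> sq_integrable M (\<lambda>i. c * f i)"
  by (auto simp: sq_integrable_def power_mult_distrib)

lemma sq_integrable_add:
  assumes "sq_integrable M f" "sq_integrable M g"
  shows "sq_integrable M (\<lambda>i. f i + g i)"
  using assms sq_integrable_mult[OF assms]
  by (auto simp: sq_integrable_def power2_sum mult.assoc)

lemma sq_integrable_diff:
  assumes "sq_integrable M f" "sq_integrable M g"
  shows "sq_integrable M (\<lambda>i. f i - g i)"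
  using sq_integrable_add[OF assms(1) sq_integrable_cmult[OF assms(2), of "-1"]] by simp

lemma sq_integrable_bound:
  assumes "sq_integrable M f" "g \<in> borel_measurable M" "AE i in M. \<bar>g i\<bar> \<le> \<bar>f i\<bar>"
  shows "sq_integrable M g"
  using assms unfolding sq_integrable_def
  by (auto intro!: Bochner_Integration.integrable_bound[of M "\<lambda>i. (f i)\<^sup>2" "\<lambda>i. (g i)\<^sup>2"] simp: abs_le_square_iff)

lemma sq_integrable_bounded_mult:
  assumes "sq_integrable M f" "w \<in> borel_measurable M" "AE i in M. \<bar>w i\<bar> \<le> K"
  shows "sq_integrable M (\<lambda>i. w i * f i)"
proof (rule sq_integrable_bound[OF sq_integrable_cmult[OF assms(1), of K]])
  show "AE i in M. \<bar>w i * f i\<bar> \<le> \<bar>K * f i\<bar>"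
    using assms(3) by eventually_elim (simp add: abs_mult mult_right_mono)
qed (use assms in measurable)

text \<open>The quadratic form of the Gram matrix with entries A, B, C is nonnegative. Evaluated at
  (C, - B) it gives C (A C - B^2) \<ge> 0, which settles C > 0; for C = 0 the form is affine in the
  second argument, which forces B = 0.\<close>

lemma l2_cauchy_schwarz:
  assumes f: "sq_integrable M f" and g: "sq_integrable M g"
  shows "\<bar>\<integral>i. f i * g i \<partial>M\<bar> \<le> l2norm M f * l2norm M g"
proof -
  define A B C where "A = (\<integral>i. (f i)\<^sup>2 \<partial>M)" and "B = (\<integral>i. f i * g i \<partial>M)" and "C = (\<integral>i. (g i)\<^sup>2 \<partial>M)"
  have i: "integrable M (\<lambda>i. (f i)\<^sup>2)" "integrable M (\<lambda>i. (g i)\<^sup>2)" "integrable M (\<lambda>i. f i * g i)"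
    using f g sq_integrable_mult[OF f g] by (auto simp: sq_integrable_def)
  have quad: "0 \<le> r\<^sup>2 * A + 2 * r * s * B + s\<^sup>2 * C" for r s
  proof -
    have "0 \<le> (\<integral>i. (r * f i + s * g i)\<^sup>2 \<partial>M)" by simp
    also have "\<dots> = (\<integral>i. r\<^sup>2 * (f i)\<^sup>2 + (2 * r * s) * (f i * g i) + s\<^sup>2 * (g i)\<^sup>2 \<partial>M)"
      by (rule Bochner_Integration.integral_cong) (auto simp: power2_eq_square algebra_simps)
    also have "\<dots> = r\<^sup>2 * A + 2 * r * s * B + s\<^sup>2 * C"
      using i by (simp add: A_def B_def C_def)
    finally show ?thesis .
  qed
  have "A \<ge> 0" "C \<ge> 0" by (auto simp: A_def C_def)
  have "B\<^sup>2 \<le> A * C"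
  proof (cases "C = 0")
    case True
    have "B = 0"
    proof (rule ccontr)
      assume "B \<noteq> 0"
      then have "2 * (- (A + 1) / (2 * B)) * B = - (A + 1)" by simp
      then show False using quad[of 1 "- (A + 1) / (2 * B)"] True by simp
    qed
    then show ?thesis using True by simp
  next
    case False
    then have "C > 0" using \<open>C \<ge> 0\<close> by simp
    have "0 \<le> C * (A * C - B\<^sup>2)" using quad[of C "- B"] by (simp add: power2_eq_square algebra_simps)
    then show ?thesis using \<open>C > 0\<close> by (simp add: zero_le_mult_iff)
  qed
  then have "\<bar>B\<bar> \<le> sqrt (A * C)" by (rule real_le_rsqrt[OF order_trans[OF eq_refl], rotated]) simp
  then show ?thesis by (simp add: A_def B_def C_def l2norm_def real_sqrt_mult)
qed

lemma l2norm_triangle: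
  assumes f: "sq_integrable M f" and g: "sq_integrable M g"
  shows "l2norm M (\<lambda>i. f i + g i) \<le> l2norm M f + l2norm M g"
proof (rule power2_le_imp_le)
  have i: "integrable M (\<lambda>i. (f i)\<^sup>2)" "integrable M (\<lambda>i. (g i)\<^sup>2)" "integrable M (\<lambda>i. f i * g i)"
    using f g sq_integrable_mult[OF f g] by (auto simp: sq_integrable_def)
  have "(l2norm M (\<lambda>i. f i + g i))\<^sup>2 = (\<integral>i. (f i)\<^sup>2 + (g i)\<^sup>2 + 2 * (f i * g i) \<partial>M)"
    by (simp add: l2norm_power2 power2_sum mult.assoc)
  also have "\<dots> = (l2norm M f)\<^sup>2 + (l2norm M g)\<^sup>2 + 2 * (\<integral>i. f i * g i \<partial>M)"
    using i by (simp add: l2norm_power2)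
  also have "\<dots> \<le> (l2norm M f + l2norm M g)\<^sup>2"
    using l2_cauchy_schwarz[OF f g] by (simp add: power2_sum)
  finally show "(l2norm M (\<lambda>i. f i + g i))\<^sup>2 \<le> (l2norm M f + l2norm M g)\<^sup>2" .
qed simp

lemma l2norm_cmult: "l2norm M (\<lambda>i. c * f i) = \<bar>c\<bar> * l2norm M f"
  by (simp add: l2norm_def power_mult_distrib real_sqrt_mult)

lemma l2norm_mono:
  assumes "sq_integrable M f" "g \<in> borel_measurable M" "AE i in M. \<bar>g i\<bar> \<le> \<bar>f i\<bar>"
  shows "l2norm M g \<le> l2norm M f"
  unfolding l2norm_def using assms sq_integrable_bound[OF assms]
  by (auto intro!: real_sqrt_le_mono integral_mono_AE simp: sq_integrable_def abs_le_square_iff)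

lemma l2norm_cong_AE:
  "f \<in> borel_measurable M \<Longrightarrow> g \<in> borel_measurable M \<Longrightarrow> (AE i in M. f i = g i) \<Longrightarrow> l2norm M f = l2norm M g"
  unfolding l2norm_def by (auto intro!: arg_cong[of _ _ sqrt] integral_cong_AE)

lemma l2norm_eq_0_imp_AE:
  assumes "sq_integrable M f" "l2norm M f = 0"
  shows "AE i in M. f i = 0"
proof -
  have "(\<integral>i. (f i)\<^sup>2 \<partial>M) = 0" using assms(2) by (simp add: l2norm_def)
  then have "AE i in M. (f i)\<^sup>2 = 0"
    using assms(1) by (subst (asm) integral_nonneg_eq_0_iff_AE) (auto simp: sq_integrable_def)
  then show ?thesis by simp
qed

context prob_space
begin

lemma sq_integrable_const: "sq_integrable M (\<lambda>i. c)"
  by (simp add: sq_integrable_def)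

lemma sq_integrable_integrable: "sq_integrable M f \<Longrightarrow> integrable M f"
  using sq_integrable_mult[OF _ sq_integrable_const, of f 1] by simp

lemma l2norm_const: "l2norm M (\<lambda>i. c) = \<bar>c\<bar>"
  by (simp add: l2norm_def prob_space)

lemma abs_integral_le_l2norm: "sq_integrable M f \<Longrightarrow> \<bar>\<integral>i. f i \<partial>M\<bar> \<le> l2norm M f"
  using l2_cauchy_schwarz[OF _ sq_integrable_const, of f 1] by (simp add: l2norm_const)

lemma integral_abs_le_l2norm:
  assumes "sq_integrable M f" shows "(\<integral>i. \<bar>f i\<bar> \<partial>M) \<le> l2norm M f"
proof -
  have "sq_integrable M (\<lambda>i. \<bar>f i\<bar>)" using assms by (auto simp: sq_integrable_def)
  from abs_integral_le_l2norm[OF this] show ?thesis by (simp add: l2norm_def)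
qed

end

subsection \<open>Consensus operators on a probability space\<close>

text \<open>Product measurability is what Fubini's theorem asks for, and bounds at every pair spare
  side conditions on sections. Kernels given up to null sets reach this form through
  \<open>represents\<close>.\<close>

definition unit_kernel :: "'a measure \<Rightarrow> ('a \<times> 'a \<Rightarrow> real) \<Rightarrow> bool" where
  "unit_kernel M \<beta> \<longleftrightarrow> \<beta> \<in> borel_measurable (M \<Otimes>\<^sub>M M) \<and> (\<forall>p. 0 \<le> \<beta> p \<and> \<beta> p \<le> 1)"

definition consensus_field :: "'a measure \<Rightarrow> ('a \<times> 'a \<Rightarrow> real) \<Rightarrow> ('a \<Rightarrow> real) \<Rightarrow> 'a \<Rightarrow> real" where
  "consensus_field M \<beta> y i = (\<integral>j. \<beta> (i, j) * (y j - y i) \<partial>M)"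

text \<open>The adjoint of the scalar Laplacian annihilates \<open>w\<close>: weighted outflow
  equals weighted inflow at almost every point, so \<open>w\<close> is a stationary density for the
  kernel.\<close>

definition balanced :: "'a measure \<Rightarrow> ('a \<times> 'a \<Rightarrow> real) \<Rightarrow> ('a \<Rightarrow> real) \<Rightarrow> bool" where
  "balanced M \<beta> w \<longleftrightarrow> w \<in> borel_measurable M \<and>
     (AE i in M. w i * (\<integral>j. \<beta> (i, j) \<partial>M) = (\<integral>j. \<beta> (j, i) * w j \<partial>M))"

lemma unit_kernelD:
  assumes "unit_kernel M \<beta>"
  shows "\<beta> \<in> borel_measurable (M \<Otimes>\<^sub>M M)" "0 \<le> \<beta> p" "\<beta> p \<le> 1"
  using assms by (auto simp: unit_kernel_def simp del: split_paired_All)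

context prob_space
begin

interpretation P: pair_prob_space M M ..

text \<open>The bound K |f i| |g j| is a product of integrable functions of separate variables.
  Plain integrability of the two factors is the right assumption for the energy, where one factor is
  y^2 and the other is 1.\<close>

lemma integrable_kernel_mult:
  assumes \<beta>: "unit_kernel M \<beta>" and w: "w \<in> borel_measurable M" "\<And>i. \<bar>w i\<bar> \<le> K"
    and f: "integrable M f" and g: "integrable M g"
  shows "integrable (M \<Otimes>\<^sub>M M) (\<lambda>(i, j). w i * \<beta> (i, j) * (f i * g j))"
proof (rule Bochner_Integration.integrable_bound)
  have fg[measurable]: "f \<in> borel_measurable M" "g \<in> borel_measurable M" using f g by auto
  note unit_kernelD(1)[OF \<beta>, measurable] w(1)[measurable]
  have "integrable (M \<Otimes>\<^sub>M M) (\<lambda>p. \<bar>f (fst p)\<bar> * \<bar>g (snd p)\<bar>)"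
  proof (rule P.Fubini_integrable)
    show "integrable M (\<lambda>x. \<integral>y. norm (\<bar>f (fst (x, y))\<bar> * \<bar>g (snd (x, y))\<bar>) \<partial>M)"
      using f g by (simp add: abs_mult)
    show "AE x in M. integrable M (\<lambda>y. \<bar>f (fst (x, y))\<bar> * \<bar>g (snd (x, y))\<bar>)"
      using g by simp
  qed measurable
  then show "integrable (M \<Otimes>\<^sub>M M) (\<lambda>p. K * (\<bar>f (fst p)\<bar> * \<bar>g (snd p)\<bar>))" by simp
  show "(\<lambda>(i, j). w i * \<beta> (i, j) * (f i * g j)) \<in> borel_measurable (M \<Otimes>\<^sub>M M)"
    by measurable
  show "AE p in M \<Otimes>\<^sub>M M. norm (case p of (i, j) \<Rightarrow> w i * \<beta> (i, j) * (f i * g j))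
      \<le> norm (K * (\<bar>f (fst p)\<bar> * \<bar>g (snd p)\<bar>))"
  proof (rule AE_I2, clarify)
    fix i j
    have "\<bar>w i\<bar> * \<bar>\<beta> (i, j)\<bar> \<le> K * 1"
      using w(2)[of i] unit_kernelD(2,3)[OF \<beta>, of "(i, j)"] by (intro mult_mono) auto
    then have "\<bar>w i\<bar> * \<bar>\<beta> (i, j)\<bar> * (\<bar>f i\<bar> * \<bar>g j\<bar>) \<le> K * (\<bar>f i\<bar> * \<bar>g j\<bar>)"
      by (intro mult_right_mono) auto
    then have "norm (w i * \<beta> (i, j) * (f i * g j)) \<le> K * (\<bar>f i\<bar> * \<bar>g j\<bar>)"
      by (simp only: real_norm_def abs_mult)
    then show "norm (w i * \<beta> (i, j) * (f i * g j)) \<le> norm (K * (\<bar>f (fst (i, j))\<bar> * \<bar>g (snd (i, j))\<bar>))"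
      unfolding fst_conv snd_conv real_norm_def[of "K * _"] by (rule order_trans[OF _ abs_ge_self])
  qed
qed

lemma integrable_kernel_section:
  assumes \<beta>: "unit_kernel M \<beta>" and g: "integrable M g" and "i \<in> space M"
  shows "integrable M (\<lambda>j. \<beta> (i, j) * g j)"
proof (rule Bochner_Integration.integrable_bound[OF g])
  show "(\<lambda>j. \<beta> (i, j) * g j) \<in> borel_measurable M"
    using measurable_Pair2[OF unit_kernelD(1)[OF \<beta>] assms(3)] g by auto
  show "AE j in M. norm (\<beta> (i, j) * g j) \<le> norm (g j)"
    using unit_kernelD(2,3)[OF \<beta>] by (auto simp: abs_mult intro!: AE_I2 mult_left_le_one_le)
qed

lemma integrable_kernel_section_const:
  assumes "unit_kernel M \<beta>" "i \<in> space M" shows "integrable M (\<lambda>j. \<beta> (i, j))"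
  using integrable_kernel_section[OF assms(1) _ assms(2), of "\<lambda>_. 1"] by simp

lemma consensus_field_eq:
  assumes \<beta>: "unit_kernel M \<beta>" and y: "integrable M y" and i: "i \<in> space M"
  shows "consensus_field M \<beta> y i = (\<integral>j. \<beta> (i, j) * y j \<partial>M) - y i * (\<integral>j. \<beta> (i, j) \<partial>M)"
proof -
  have "consensus_field M \<beta> y i = (\<integral>j. \<beta> (i, j) * y j - y i * \<beta> (i, j) \<partial>M)"
    unfolding consensus_field_def by (rule Bochner_Integration.integral_cong) (auto simp: algebra_simps)
  also have "\<dots> = (\<integral>j. \<beta> (i, j) * y j \<partial>M) - (\<integral>j. y i * \<beta> (i, j) \<partial>M)"
    by (rule Bochner_Integration.integral_diff)
      (use integrable_kernel_section[OF \<beta> y i] integrable_kernel_section_const[OF \<beta> i] in auto)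
  finally show ?thesis by simp
qed

lemma consensus_field_diff_const: "consensus_field M \<beta> (\<lambda>i. y i - c) = consensus_field M \<beta> y"
  by (simp add: consensus_field_def fun_eq_iff)

lemma consensus_field_measurable:
  assumes "unit_kernel M \<beta>" "y \<in> borel_measurable M"
  shows "consensus_field M \<beta> y \<in> borel_measurable M"
proof -
  note unit_kernelD(1)[OF assms(1), measurable] assms(2)[measurable]
  show ?thesis unfolding consensus_field_def by measurable
qed

lemma abs_consensus_field_le:
  assumes \<beta>: "unit_kernel M \<beta>" and y: "sq_integrable M y" and i: "i \<in> space M"
  shows "\<bar>consensus_field M \<beta> y i\<bar> \<le> \<bar>y i\<bar> + l2norm M y"
proof -
  have iy: "integrable M y" by (rule sq_integrable_integrable[OF y])
  have "\<bar>consensus_field M \<beta> y i\<bar> \<le> (\<integral>j. \<bar>y j\<bar> + \<bar>y i\<bar> \<partial>M)"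
    unfolding consensus_field_def
  proof (rule order_trans[OF integral_abs_bound integral_mono])
    show "integrable M (\<lambda>j. \<bar>\<beta> (i, j) * (y j - y i)\<bar>)"
      using integrable_kernel_section[OF \<beta> _ i, of "\<lambda>j. y j - y i"] iy by simp
    show "\<bar>\<beta> (i, j) * (y j - y i)\<bar> \<le> \<bar>y j\<bar> + \<bar>y i\<bar>" for j
    proof -
      have "\<bar>\<beta> (i, j) * (y j - y i)\<bar> \<le> \<bar>y j - y i\<bar>"
        using unit_kernelD(2,3)[OF \<beta>] by (auto simp: abs_mult intro!: mult_left_le_one_le)
      then show ?thesis by linarith
    qed
  qed (use iy in auto)
  also have "\<dots> = (\<integral>j. \<bar>y j\<bar> \<partial>M) + \<bar>y i\<bar>" using iy by (simp add: prob_space)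
  finally show ?thesis using integral_abs_le_l2norm[OF y] by linarith
qed

text \<open>The field is bounded pointwise by |y i| plus the L2 norm of \<open>y\<close>, whence the
  factor 2. Since it ignores constants, the bound applied to the centred function limits the speed
  of the mean by twice the deviation.\<close>

lemma
  assumes \<beta>: "unit_kernel M \<beta>" and y: "sq_integrable M y"
  shows sq_integrable_consensus_field: "sq_integrable M (consensus_field M \<beta> y)"
    and l2norm_consensus_field: "l2norm M (consensus_field M \<beta> y) \<le> 2 * l2norm M y"
proof -
  have y': "sq_integrable M (\<lambda>i. \<bar>y i\<bar>)" "l2norm M (\<lambda>i. \<bar>y i\<bar>) = l2norm M y"
    using y by (auto simp: sq_integrable_def l2norm_def)
  note s = sq_integrable_add[OF y'(1) sq_integrable_const[of "l2norm M y"]]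
  have m: "consensus_field M \<beta> y \<in> borel_measurable M"
    using consensus_field_measurable[OF \<beta>] y by (auto simp: sq_integrable_def)
  have b: "AE i in M. \<bar>consensus_field M \<beta> y i\<bar> \<le> \<bar>\<bar>y i\<bar> + l2norm M y\<bar>"
    using abs_consensus_field_le[OF \<beta> y] by (intro AE_I2) fastforce
  show "sq_integrable M (consensus_field M \<beta> y)" by (rule sq_integrable_bound[OF s m b])
  have "l2norm M (consensus_field M \<beta> y) \<le> l2norm M (\<lambda>i. \<bar>y i\<bar> + l2norm M y)"
    by (rule l2norm_mono[OF s m b])
  also have "\<dots> \<le> 2 * l2norm M y"
    using l2norm_triangle[OF y'(1) sq_integrable_const[of "l2norm M y"]] y'(2) by (simp add: l2norm_const)
  finally show "l2norm M (consensus_field M \<beta> y) \<le> 2 * l2norm M y" .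
qed

lemma kernel_integral_cmult:
  assumes \<beta>: "unit_kernel M \<beta>" and w: "w \<in> borel_measurable M" "\<And>i. \<bar>w i\<bar> \<le> K"
    and f: "integrable M f" and g: "integrable M g"
  shows "integrable M (\<lambda>i. w i * f i * (\<integral>j. \<beta> (i, j) * g j \<partial>M))"
    and "(\<integral>i. w i * f i * (\<integral>j. \<beta> (i, j) * g j \<partial>M) \<partial>M)
      = (\<integral>p. (case p of (i, j) \<Rightarrow> w i * \<beta> (i, j) * (f i * g j)) \<partial>(M \<Otimes>\<^sub>M M))"
proof -
  note I = integrable_kernel_mult[OF assms]
  have eq: "(\<integral>j. (case (i, j) of (i, j) \<Rightarrow> w i * \<beta> (i, j) * (f i * g j)) \<partial>M)
      = w i * f i * (\<integral>j. \<beta> (i, j) * g j \<partial>M)" for i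
    unfolding prod.case integral_mult_right_zero[symmetric]
    by (rule Bochner_Integration.integral_cong) (auto simp: algebra_simps)
  show "integrable M (\<lambda>i. w i * f i * (\<integral>j. \<beta> (i, j) * g j \<partial>M))"
    using P.integrable_fst'[OF I] unfolding eq .
  show "(\<integral>i. w i * f i * (\<integral>j. \<beta> (i, j) * g j \<partial>M) \<partial>M)
      = (\<integral>p. (case p of (i, j) \<Rightarrow> w i * \<beta> (i, j) * (f i * g j)) \<partial>(M \<Otimes>\<^sub>M M))"
    using P.integral_fst'[OF I] unfolding eq .
qed

text \<open>Fubini's theorem performs the integral over the first variable of the kernel first,
  where it is the weighted inflow; balance turns this into \<open>w\<close> times the
  outflow.\<close>

lemma balanced_integral_swap:
  assumes \<beta>: "unit_kernel M \<beta>" and bal: "balanced M \<beta> w" and w: "\<And>i. \<bar>w i\<bar> \<le> K"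
    and g: "integrable M g"
  shows "(\<integral>i. w i * (\<integral>j. \<beta> (i, j) * g j \<partial>M) \<partial>M) = (\<integral>i. w i * g i * (\<integral>j. \<beta> (i, j) \<partial>M) \<partial>M)"
proof -
  have wm: "w \<in> borel_measurable M" using bal by (simp add: balanced_def)
  note I = integrable_kernel_mult[OF \<beta> wm w _ g, of "\<lambda>_. 1", simplified]
  note unit_kernelD(1)[OF \<beta>, measurable] wm[measurable] borel_measurable_integrable[OF g, measurable]
  have "(\<integral>i. w i * (\<integral>j. \<beta> (i, j) * g j \<partial>M) \<partial>M) = (\<integral>i. (\<integral>j. w i * \<beta> (i, j) * g j \<partial>M) \<partial>M)"
    by (simp add: mult.assoc)
  also have "\<dots> = (\<integral>j. (\<integral>i. w i * \<beta> (i, j) * g j \<partial>M) \<partial>M)"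
    using P.Fubini_integral[OF I] by simp
  also have "\<dots> = (\<integral>j. g j * (\<integral>i. \<beta> (i, j) * w i \<partial>M) \<partial>M)"
    unfolding integral_mult_right_zero[symmetric]
    by (intro Bochner_Integration.integral_cong) (auto simp: algebra_simps)
  also have "\<dots> = (\<integral>j. w j * g j * (\<integral>i. \<beta> (j, i) \<partial>M) \<partial>M)"
  proof (rule integral_cong_AE)
    show "AE j in M. g j * (\<integral>i. \<beta> (i, j) * w i \<partial>M) = w j * g j * (\<integral>i. \<beta> (j, i) \<partial>M)"
    proof -
      have "AE j in M. w j * (\<integral>i. \<beta> (j, i) \<partial>M) = (\<integral>i. \<beta> (i, j) * w i \<partial>M)"
        using bal by (simp add: balanced_def)
      then show ?thesis by eventually_elim (simp add: algebra_simps)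
    qed
  qed measurable
  finally show ?thesis .
qed

text \<open>This is the conservation law: the derivative of the weighted mean along the dynamics
  vanishes.\<close>

lemma integral_balanced_field:
  assumes \<beta>: "unit_kernel M \<beta>" and bal: "balanced M \<beta> w" and w: "\<And>i. \<bar>w i\<bar> \<le> K"
    and y: "integrable M y"
  shows "(\<integral>i. w i * consensus_field M \<beta> y i \<partial>M) = 0"
proof -
  have wm: "w \<in> borel_measurable M" using bal by (simp add: balanced_def)
  have "(\<integral>i. w i * consensus_field M \<beta> y i \<partial>M)
      = (\<integral>i. w i * (\<integral>j. \<beta> (i, j) * y j \<partial>M) - w i * y i * (\<integral>j. \<beta> (i, j) \<partial>M) \<partial>M)"
    by (intro Bochner_Integration.integral_cong) (auto simp: consensus_field_eq[OF \<beta> y] algebra_simps)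
  also have "\<dots> = 0"
    using kernel_integral_cmult(1)[OF \<beta> wm w _ y, of "\<lambda>_. 1"]
      kernel_integral_cmult(1)[OF \<beta> wm w y, of "\<lambda>_. 1"]
      balanced_integral_swap[OF \<beta> bal w y] by simp
  finally show ?thesis .
qed

lemma integrable_weighted_mult:
  assumes "sq_integrable M f" "sq_integrable M g" "w \<in> borel_measurable M" "\<And>i. \<bar>w i\<bar> \<le> K"
  shows "integrable M (\<lambda>i. w i * (f i * g i))"
  using sq_integrable_mult[OF sq_integrable_bounded_mult[OF assms(1,3), of K] assms(2)] assms(4)
  by (simp add: mult.assoc)

text \<open>After y i y j \<le> ((y i)^2 + (y j)^2) / 2 there are two quadratic terms, one in each
  variable. Balance makes their integrals equal, so the weighted Laplacian is positive semidefinite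
  although the kernel need not be symmetric.\<close>

lemma balanced_energy_nonpos:
  assumes \<beta>: "unit_kernel M \<beta>" and bal: "balanced M \<beta> w" and w: "\<And>i. 0 \<le> w i" "\<And>i. w i \<le> K"
    and y: "sq_integrable M y"
  shows "(\<integral>i. w i * (consensus_field M \<beta> y i * y i) \<partial>M) \<le> 0"
proof -
  have wm: "w \<in> borel_measurable M" using bal by (simp add: balanced_def)
  have w': "\<bar>w i\<bar> \<le> K" for i using w[of i] by simp
  have iy: "integrable M y" "integrable M (\<lambda>i. (y i)\<^sup>2)"
    using sq_integrable_integrable[OF y] y by (simp_all add: sq_integrable_def)
  define F where "F f g p = (case p of (i, j) \<Rightarrow> w i * \<beta> (i, j) * (f i * g j))" for f g :: "'a \<Rightarrow> real" and p
  have IF: "integrable (M \<Otimes>\<^sub>M M) (F f g)" if "integrable M f" "integrable M g" for f g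
    unfolding F_def[abs_def] by (rule integrable_kernel_mult[OF \<beta> wm w' that])
  note K = kernel_integral_cmult[OF \<beta> wm w']
  let ?q = "\<lambda>i. (y i)\<^sup>2"
  have "(\<integral>i. w i * (consensus_field M \<beta> y i * y i) \<partial>M)
      = (\<integral>i. w i * y i * (\<integral>j. \<beta> (i, j) * y j \<partial>M) - w i * ?q i * (\<integral>j. \<beta> (i, j) * 1 \<partial>M) \<partial>M)"
    by (intro Bochner_Integration.integral_cong)
      (auto simp: consensus_field_eq[OF \<beta> iy(1)] algebra_simps power2_eq_square)
  also have "\<dots> = (\<integral>i. w i * y i * (\<integral>j. \<beta> (i, j) * y j \<partial>M) \<partial>M) - (\<integral>i. w i * ?q i * (\<integral>j. \<beta> (i, j) * 1 \<partial>M) \<partial>M)"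
    by (intro Bochner_Integration.integral_diff K iy) simp_all
  finally have A: "(\<integral>i. w i * (consensus_field M \<beta> y i * y i) \<partial>M)
      = (\<integral>i. w i * y i * (\<integral>j. \<beta> (i, j) * y j \<partial>M) \<partial>M) - (\<integral>i. w i * ?q i * (\<integral>j. \<beta> (i, j) * 1 \<partial>M) \<partial>M)" .
  have "(\<integral>i. w i * y i * (\<integral>j. \<beta> (i, j) * y j \<partial>M) \<partial>M) = (\<integral>p. F y y p \<partial>(M \<Otimes>\<^sub>M M))"
    unfolding F_def by (rule kernel_integral_cmult(2)[OF \<beta> wm w' iy(1) iy(1)])
  also have "\<dots> \<le> (\<integral>p. (1/2) * F ?q (\<lambda>_. 1) p + (1/2) * F (\<lambda>_. 1) ?q p \<partial>(M \<Otimes>\<^sub>M M))"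
  proof (rule integral_mono)
    show "F y y p \<le> (1/2) * F ?q (\<lambda>_. 1) p + (1/2) * F (\<lambda>_. 1) ?q p" for p
    proof -
      obtain i j where p: "p = (i, j)" by (cases p)
      have "y i * y j \<le> ((y i)\<^sup>2 + (y j)\<^sup>2) / 2"
        using sum_squares_bound[of "y i" "y j"] by simp
      moreover have "0 \<le> w i * \<beta> (i, j)" using w unit_kernelD(2)[OF \<beta>] by simp
      ultimately have "w i * \<beta> (i, j) * (y i * y j) \<le> w i * \<beta> (i, j) * (((y i)\<^sup>2 + (y j)\<^sup>2) / 2)"
        by (rule mult_left_mono)
      then show ?thesis by (simp add: F_def p algebra_simps add_divide_distrib)
    qed
  qed (use IF iy in auto)
  also have "\<dots> = (1/2) * (\<integral>p. F ?q (\<lambda>_. 1) p \<partial>(M \<Otimes>\<^sub>M M)) + (1/2) * (\<integral>p. F (\<lambda>_. 1) ?q p \<partial>(M \<Otimes>\<^sub>M M))"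
    using IF[of ?q "\<lambda>_. 1"] IF[of "\<lambda>_. 1" ?q] iy by simp
  also have "(\<integral>p. F ?q (\<lambda>_. 1) p \<partial>(M \<Otimes>\<^sub>M M)) = (\<integral>i. w i * ?q i * (\<integral>j. \<beta> (i, j) * 1 \<partial>M) \<partial>M)"
    unfolding F_def using kernel_integral_cmult(2)[OF \<beta> wm w' iy(2), of "\<lambda>_. 1"] by simp
  also have "(\<integral>p. F (\<lambda>_. 1) ?q p \<partial>(M \<Otimes>\<^sub>M M)) = (\<integral>i. w i * ?q i * (\<integral>j. \<beta> (i, j) * 1 \<partial>M) \<partial>M)"
    unfolding F_def using kernel_integral_cmult(2)[OF \<beta> wm w' _ iy(2), of "\<lambda>_. 1"]
      balanced_integral_swap[OF \<beta> bal w' iy(2)] by simp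
  finally show ?thesis using A by simp
qed

text \<open>Uniqueness is drawn from a positive spectral gap and the total mass, not from
  connectedness, so it compares two candidates that were normalised on different families of
  components.\<close>

lemma balanced_unique:
  assumes \<beta>: "unit_kernel M \<beta>" and v: "balanced M \<beta> v" and w: "balanced M \<beta> w"
    and vb: "\<And>i. \<nu> \<le> v i" "\<And>i. v i \<le> K" and "\<nu> > 0" and wb: "\<And>i. \<bar>w i\<bar> \<le> K'"
    and v1: "(\<integral>i. v i \<partial>M) = 1" and w1: "(\<integral>i. w i \<partial>M) = 1"
    and gap: "\<And>y. sq_integrable M y \<Longrightarrow> (\<integral>i. y i \<partial>M) = 0 \<Longrightarrow>
        l * (l2norm M y)\<^sup>2 \<le> - (\<integral>i. v i * (consensus_field M \<beta> y i * y i) \<partial>M)"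
    and "l > 0"
  shows "AE i in M. w i = v i"
proof -
  have vm[measurable]: "v \<in> borel_measurable M" and wm[measurable]: "w \<in> borel_measurable M"
    using v w by (auto simp: balanced_def)
  have vpos: "v i > 0" for i using vb(1)[of i] \<open>\<nu> > 0\<close> by linarith
  define u where "u i = w i / v i" for i
  have vu: "v i * u i = w i" for i using vpos[of i] by (simp add: u_def)
  have um[measurable]: "u \<in> borel_measurable M" unfolding u_def[abs_def] by measurable
  have vb': "\<bar>v i\<bar> \<le> K" for i using vb(2)[of i] vpos[of i] by linarith
  have ub: "\<bar>u i\<bar> \<le> K' / \<nu>" for i
    using wb[of i] vb(1)[of i] \<open>\<nu> > 0\<close> by (auto simp: u_def abs_div intro!: frac_le)
  have u: "sq_integrable M u"
    by (rule sq_integrable_bound[OF sq_integrable_const[of "K' / \<nu>"] um]) (intro AE_I2 order_trans[OF ub abs_ge_self])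
  have iu: "integrable M u" by (rule sq_integrable_integrable[OF u])
  define m where "m = (\<integral>i. u i \<partial>M)"
  have u': "sq_integrable M (\<lambda>i. u i - m)" by (rule sq_integrable_diff[OF u sq_integrable_const])
  \<comment> \<open>Because v u = w, the energy of the centred quotient is a combination of the
    integrals of the field against \<open>w\<close> and against \<open>v\<close>, and balance makes
    both vanish.\<close>
  have "(\<integral>i. v i * (consensus_field M \<beta> (\<lambda>i. u i - m) i * (u i - m)) \<partial>M)
      = (\<integral>i. w i * consensus_field M \<beta> u i - m * (v i * consensus_field M \<beta> u i) \<partial>M)"
    unfolding consensus_field_diff_const
    by (rule Bochner_Integration.integral_cong) (auto simp: vu[symmetric] algebra_simps)
  also have "\<dots> = (\<integral>i. w i * consensus_field M \<beta> u i \<partial>M) - m * (\<integral>i. v i * consensus_field M \<beta> u i \<partial>M)"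
    using integrable_weighted_mult[OF sq_integrable_consensus_field[OF \<beta> u] sq_integrable_const[of 1] vm vb']
      integrable_weighted_mult[OF sq_integrable_consensus_field[OF \<beta> u] sq_integrable_const[of 1] wm wb]
    by simp
  also have "\<dots> = 0"
    using integral_balanced_field[OF \<beta> v vb' iu] integral_balanced_field[OF \<beta> w wb iu] by simp
  finally have E: "(\<integral>i. v i * (consensus_field M \<beta> (\<lambda>i. u i - m) i * (u i - m)) \<partial>M) = 0" .
  have "l * (l2norm M (\<lambda>i. u i - m))\<^sup>2 \<le> 0"
    using gap[OF u'] iu E by (simp add: m_def prob_space)
  then have "l2norm M (\<lambda>i. u i - m) = 0" using \<open>l > 0\<close> by (simp add: mult_le_0_iff)
  from l2norm_eq_0_imp_AE[OF u' this] have AEm: "AE i in M. w i = m * v i"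
    by eventually_elim (simp add: vu[symmetric])
  then have "(\<integral>i. w i \<partial>M) = (\<integral>i. m * v i \<partial>M)" by (intro integral_cong_AE) auto
  then have "m = 1" using v1 w1 by simp
  with AEm show ?thesis by simp
qed

end

subsection \<open>Functionals along solutions\<close>

text \<open>What the estimates use of the equation, for a scalar functional of the solution. The
  difference quotient is taken to the right, since the Dini arguments look forward in time and the
  curve is controlled at nonnegative times.\<close>

definition l2_solution :: "'a measure \<Rightarrow> (real \<Rightarrow> 'a \<times> 'a \<Rightarrow> real) \<Rightarrow> (real \<Rightarrow> 'a \<Rightarrow> real) \<Rightarrow> bool" where
  "l2_solution M \<beta> u \<longleftrightarrow>
     (\<forall>t\<ge>0. sq_integrable M (u t) \<and> unit_kernel M (\<beta> t)) \<and>
     (\<forall>R\<ge>0. \<exists>K. \<forall>s\<in>{0..R}. \<forall>t\<in>{0..R}. l2norm M (\<lambda>i. u t i - u s i) \<le> K * \<bar>t - s\<bar>) \<and>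
     (AE t in lebesgue_on {0..}.
        ((\<lambda>h. l2norm M (\<lambda>i. (u (t + h) i - u t i) / h - consensus_field M (\<beta> t) (u t) i)) \<longlongrightarrow> 0) (at_right 0))"

text \<open>\<open>\<psi> y\<close> acts as a gradient of \<open>F\<close> at \<open>y\<close> with
  at most linear growth. The one-sided quadratic bound also covers the squared positive part, and it
  yields upper Dini bounds along solutions.\<close>

definition upper_smooth :: "'a measure \<Rightarrow> real \<Rightarrow> (('a \<Rightarrow> real) \<Rightarrow> real) \<Rightarrow> (('a \<Rightarrow> real) \<Rightarrow> 'a \<Rightarrow> real) \<Rightarrow> bool" where
  "upper_smooth M C F \<psi> \<longleftrightarrow> C \<ge> 0 \<and>
     (\<forall>y. sq_integrable M y \<longrightarrow> sq_integrable M (\<psi> y) \<and> l2norm M (\<psi> y) \<le> C * (l2norm M y + 1)) \<and>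
     (\<forall>y z. sq_integrable M y \<longrightarrow> sq_integrable M z \<longrightarrow>
        F (\<lambda>i. y i + z i) \<le> F y + (\<integral>i. \<psi> y i * z i \<partial>M) + C * (l2norm M z)\<^sup>2)"

lemma AE_lebesgue_on_subset:
  assumes "AE t in lebesgue_on A. P t" "B \<subseteq> A" "A \<in> sets lebesgue" "B \<in> sets lebesgue"
  shows "AE t in lebesgue_on B. P t"
  using assms by (subst AE_restrict_space_iff) (auto simp: AE_restrict_space_iff elim!: AE_mp)

context prob_space
begin

lemma l2_solution_norm_bound:
  assumes u: "l2_solution M \<beta> u"
  shows "\<exists>K B. 0 \<le> K \<and> 0 \<le> B \<and> (\<forall>s\<in>{0..R}. l2norm M (u s) \<le> B) \<and>
     (\<forall>s\<in>{0..R}. \<forall>t\<in>{0..R}. l2norm M (\<lambda>i. u t i - u s i) \<le> K * \<bar>t - s\<bar>)"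
proof (cases "R \<ge> 0")
  case True
  obtain K0 where K0: "\<And>s t. s \<in> {0..R} \<Longrightarrow> t \<in> {0..R} \<Longrightarrow> l2norm M (\<lambda>i. u t i - u s i) \<le> K0 * \<bar>t - s\<bar>"
    using u True unfolding l2_solution_def by meson
  define K where "K = max 0 K0"
  have K: "l2norm M (\<lambda>i. u t i - u s i) \<le> K * \<bar>t - s\<bar>" if "s \<in> {0..R}" "t \<in> {0..R}" for s t
    using K0[OF that] mult_right_mono[of K0 K "\<bar>t - s\<bar>"] by (simp add: K_def)
  have K_nn: "K \<ge> 0" by (simp add: K_def)
  have sq: "sq_integrable M (u t)" if "t \<ge> 0" for t using u that by (simp add: l2_solution_def)
  have "l2norm M (u s) \<le> l2norm M (u 0) + K * R" if s: "s \<in> {0..R}" for s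
  proof -
    have "l2norm M (\<lambda>i. u 0 i + (u s i - u 0 i)) \<le> l2norm M (u 0) + l2norm M (\<lambda>i. u s i - u 0 i)"
      by (rule l2norm_triangle) (use s in \<open>auto intro!: sq sq_integrable_diff\<close>)
    moreover have "K * \<bar>s - 0\<bar> \<le> K * R" using s K_nn by (intro mult_left_mono) auto
    ultimately show ?thesis using K[of 0 s] s by simp
  qed
  then show ?thesis using K K_nn True
    by (intro exI[of _ K] exI[of _ "l2norm M (u 0) + K * R"]) auto
qed (auto intro!: exI[of _ 0])

text \<open>Taking either of the two times as base point turns the one-sided bound into a two-sided
  one. In \<open>L\<close> the first summand comes from the gradient and the second from the
  quadratic remainder, one factor |t - s| of the square being bounded by \<open>b\<close>.\<close>

lemma upper_smooth_lipschitz: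
  assumes u: "l2_solution M \<beta> u" and F: "upper_smooth M C F \<psi>" and "0 \<le> a" "a \<le> b"
  shows "\<exists>K. K-lipschitz_on {a..b} (\<lambda>t. F (u t))"
proof -
  obtain K B where K: "0 \<le> K" "0 \<le> B" "\<And>s. s \<in> {0..b} \<Longrightarrow> l2norm M (u s) \<le> B"
    "\<And>s t. s \<in> {0..b} \<Longrightarrow> t \<in> {0..b} \<Longrightarrow> l2norm M (\<lambda>i. u t i - u s i) \<le> K * \<bar>t - s\<bar>"
    using l2_solution_norm_bound[OF u, of b] by blast
  have sq: "sq_integrable M (u t)" if "t \<ge> 0" for t using u that by (simp add: l2_solution_def)
  have C: "C \<ge> 0" using F by (simp add: upper_smooth_def)
  define L where "L = C * (B + 1) * K + C * K\<^sup>2 * b"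
  have incr: "F (u t) - F (u s) \<le> L * \<bar>t - s\<bar>" if st: "s \<in> {a..b}" "t \<in> {a..b}" for s t
  proof -
    have s0: "s \<in> {0..b}" "t \<in> {0..b}" using st \<open>0 \<le> a\<close> by auto
    let ?z = "\<lambda>i. u t i - u s i"
    have z: "sq_integrable M ?z" using s0 sq by (auto intro!: sq_integrable_diff)
    have us: "sq_integrable M (u s)" using s0 sq by auto
    have \<psi>: "sq_integrable M (\<psi> (u s))" "l2norm M (\<psi> (u s)) \<le> C * (l2norm M (u s) + 1)"
      using F us by (auto simp: upper_smooth_def)
    have "F (\<lambda>i. u s i + ?z i) \<le> F (u s) + (\<integral>i. \<psi> (u s) i * ?z i \<partial>M) + C * (l2norm M ?z)\<^sup>2"
      using F us z unfolding upper_smooth_def by blast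
    then have "F (u t) - F (u s) \<le> (\<integral>i. \<psi> (u s) i * ?z i \<partial>M) + C * (l2norm M ?z)\<^sup>2" by simp
    also have "(\<integral>i. \<psi> (u s) i * ?z i \<partial>M) \<le> l2norm M (\<psi> (u s)) * l2norm M ?z"
      using l2_cauchy_schwarz[OF \<psi>(1) z] by linarith
    also have "l2norm M (\<psi> (u s)) * l2norm M ?z \<le> (C * (B + 1)) * (K * \<bar>t - s\<bar>)"
    proof (rule mult_mono)
      show "l2norm M (\<psi> (u s)) \<le> C * (B + 1)"
        using \<psi>(2) mult_left_mono[OF add_right_mono[OF K(3)[OF s0(1)]] C, of 1] by linarith
    qed (use K s0 C in auto)
    also have "(l2norm M ?z)\<^sup>2 \<le> (K * \<bar>t - s\<bar>)\<^sup>2"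
      using K(4)[OF s0] by (intro power_mono) auto
    also have "(K * \<bar>t - s\<bar>)\<^sup>2 \<le> K\<^sup>2 * b * \<bar>t - s\<bar>"
    proof -
      have "\<bar>t - s\<bar> * \<bar>t - s\<bar> \<le> b * \<bar>t - s\<bar>" using s0 by (intro mult_right_mono) auto
      then have "K\<^sup>2 * (\<bar>t - s\<bar> * \<bar>t - s\<bar>) \<le> K\<^sup>2 * (b * \<bar>t - s\<bar>)" by (intro mult_left_mono) auto
      then show ?thesis by (simp add: power_mult_distrib power2_eq_square[of "t - s"] mult.assoc)
    qed
    finally show ?thesis by (simp add: L_def algebra_simps mult_right_mono[OF _ C])
  qed
  have "L-lipschitz_on {a..b} (\<lambda>t. F (u t))"
  proof (rule lipschitz_onI)
    show "dist (F (u t)) (F (u s)) \<le> L * dist t s" if "t \<in> {a..b}" "s \<in> {a..b}" for s t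
      using incr[OF that] incr[OF that(2) that(1)] by (simp add: dist_real_def abs_le_iff abs_minus_commute)
    show "0 \<le> L" using C K \<open>0 \<le> a\<close> \<open>a \<le> b\<close> by (simp add: L_def)
  qed
  then show ?thesis by blast
qed

text \<open>The difference quotient is the field plus a remainder \<open>r\<close> whose norm
  \<open>\<rho> h\<close> tends to 0. The upper bound of \<open>F\<close> then has slope
  \<open>S\<close> up to an error that vanishes with \<open>h\<close>.\<close>

lemma upper_smooth_dini:
  assumes u: "l2_solution M \<beta> u" and F: "upper_smooth M C F \<psi>" and "0 \<le> a"
  shows "AE t in lebesgue_on {a..b}. \<forall>e>0. \<forall>\<^sub>F h in at_right 0.
     F (u (t + h)) - F (u t) \<le> ((\<integral>i. \<psi> (u t) i * consensus_field M (\<beta> t) (u t) i \<partial>M) + e) * h"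
proof -
  have "AE t in lebesgue_on {a..b}.
      ((\<lambda>h. l2norm M (\<lambda>i. (u (t + h) i - u t i) / h - consensus_field M (\<beta> t) (u t) i)) \<longlongrightarrow> 0) (at_right 0)"
    by (rule AE_lebesgue_on_subset[where A = "{0..}"]) (use u \<open>0 \<le> a\<close> in \<open>auto simp: l2_solution_def\<close>)
  moreover have "AE t in lebesgue_on {a..b}. t \<in> {a..b}"
    by (rule AE_I2) simp
  ultimately show ?thesis
  proof eventually_elim
    case (elim t)
    have t: "t \<ge> 0" using elim \<open>0 \<le> a\<close> by simp
    have sq: "sq_integrable M (u t)" if "t \<ge> 0" for t using u that by (simp add: l2_solution_def)
    have C: "C \<ge> 0" using F by (simp add: upper_smooth_def)
    define g where "g = consensus_field M (\<beta> t) (u t)"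
    have g: "sq_integrable M g"
      using u t by (auto simp: g_def l2_solution_def intro!: sq_integrable_consensus_field)
    define \<rho> where "\<rho> h = l2norm M (\<lambda>i. (u (t + h) i - u t i) / h - g i)" for h
    have \<rho>: "(\<rho> \<longlongrightarrow> 0) (at_right 0)" using elim by (simp add: \<rho>_def[abs_def] g_def)
    have \<psi>: "sq_integrable M (\<psi> (u t))" using F sq[OF t] by (auto simp: upper_smooth_def)
    define S where "S = (\<integral>i. \<psi> (u t) i * g i \<partial>M)"
    have step: "F (u (t + h)) - F (u t) \<le> (S + (l2norm M (\<psi> (u t)) * \<rho> h + C * h * (l2norm M g + \<rho> h)\<^sup>2)) * h"
      if h: "h > 0" for h
    proof -
      define r where "r i = (u (t + h) i - u t i) / h - g i" for i
      have r: "sq_integrable M r"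
      proof -
        have "sq_integrable M (\<lambda>i. (1 / h) * (u (t + h) i - u t i) - g i)"
          using h t by (intro sq_integrable_diff sq_integrable_cmult sq g) auto
        then show ?thesis by (simp add: r_def[abs_def])
      qed
      have \<rho>r: "\<rho> h = l2norm M r" by (simp add: \<rho>_def r_def[abs_def])
      define z where "z i = h * (g i + r i)" for i
      have gr: "sq_integrable M (\<lambda>i. g i + r i)" by (rule sq_integrable_add[OF g r])
      have z: "sq_integrable M z" unfolding z_def[abs_def] by (rule sq_integrable_cmult[OF gr])
      have uz: "(\<lambda>i. u t i + z i) = u (t + h)" using h by (auto simp: z_def r_def field_simps)
      have "F (\<lambda>i. u t i + z i) \<le> F (u t) + (\<integral>i. \<psi> (u t) i * z i \<partial>M) + C * (l2norm M z)\<^sup>2"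
        using F sq[OF t] z unfolding upper_smooth_def by blast
      then have "F (u (t + h)) - F (u t) \<le> (\<integral>i. \<psi> (u t) i * z i \<partial>M) + C * (l2norm M z)\<^sup>2"
        unfolding uz by simp
      also have "(\<integral>i. \<psi> (u t) i * z i \<partial>M) = (\<integral>i. h * (\<psi> (u t) i * g i + \<psi> (u t) i * r i) \<partial>M)"
        by (rule Bochner_Integration.integral_cong) (auto simp: z_def algebra_simps)
      also have "\<dots> = h * (S + (\<integral>i. \<psi> (u t) i * r i \<partial>M))"
        using sq_integrable_mult[OF \<psi> g] sq_integrable_mult[OF \<psi> r] by (simp add: S_def)
      also have "\<dots> \<le> h * (S + l2norm M (\<psi> (u t)) * \<rho> h)"
        using l2_cauchy_schwarz[OF \<psi> r] h unfolding \<rho>r by (intro mult_left_mono) auto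
      also have "(l2norm M z)\<^sup>2 \<le> (h * (l2norm M g + \<rho> h))\<^sup>2"
      proof (rule power_mono)
        have "l2norm M z = h * l2norm M (\<lambda>i. g i + r i)" using h by (simp add: z_def[abs_def] l2norm_cmult)
        also have "\<dots> \<le> h * (l2norm M g + \<rho> h)"
          unfolding \<rho>r using h by (intro mult_left_mono l2norm_triangle[OF g r]) auto
        finally show "l2norm M z \<le> h * (l2norm M g + \<rho> h)" .
      qed simp
      finally show ?thesis
        by (simp add: power_mult_distrib power2_eq_square algebra_simps mult_right_mono[OF _ C])
    qed
    have lim: "((\<lambda>h. l2norm M (\<psi> (u t)) * \<rho> h + C * h * (l2norm M g + \<rho> h)\<^sup>2)
        \<longlongrightarrow> l2norm M (\<psi> (u t)) * 0 + C * 0 * (l2norm M g + 0)\<^sup>2) (at_right 0)"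
      by (intro tendsto_intros \<rho>)
    show ?case
    proof (intro allI impI)
      fix e :: real assume "e > 0"
      have "\<forall>\<^sub>F h in at_right 0. l2norm M (\<psi> (u t)) * \<rho> h + C * h * (l2norm M g + \<rho> h)\<^sup>2 < e"
        by (rule order_tendstoD(2)[OF lim]) (use \<open>e > 0\<close> in simp)
      moreover have "\<forall>\<^sub>F h::real in at_right 0. h > 0" by (rule eventually_at_right_less)
      ultimately show "\<forall>\<^sub>F h in at_right 0. F (u (t + h)) - F (u t)
          \<le> ((\<integral>i. \<psi> (u t) i * consensus_field M (\<beta> t) (u t) i \<partial>M) + e) * h"
      proof eventually_elim
        case (elim h)
        have "F (u (t + h)) - F (u t) \<le> (S + (l2norm M (\<psi> (u t)) * \<rho> h + C * h * (l2norm M g + \<rho> h)\<^sup>2)) * h"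
          by (rule step[OF elim(2)])
        also have "\<dots> \<le> (S + e) * h" using elim by (intro mult_right_mono) auto
        finally show ?case by (simp add: S_def g_def)
      qed
    qed
  qed
qed

lemma upper_smooth_gronwall:
  assumes u: "l2_solution M \<beta> u" and F: "upper_smooth M C F \<psi>" and ab: "0 \<le> a" "a \<le> b"
    and le: "AE t in lebesgue_on {a..b}.
      (\<integral>i. \<psi> (u t) i * consensus_field M (\<beta> t) (u t) i \<partial>M) \<le> c * F (u t)"
  shows "F (u b) \<le> exp (c * (b - a)) * F (u a)"
proof -
  obtain K where K: "K-lipschitz_on {a..b} (\<lambda>t. F (u t))" using upper_smooth_lipschitz[OF u F ab] by blast
  show ?thesis
  proof (rule dini_gronwall[OF ab(2) K])
    show "AE t in lebesgue_on {a..b}. \<forall>e>0. \<forall>\<^sub>F h in at_right 0. F (u (t + h)) - F (u t) \<le> (c * F (u t) + e) * h"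
      using upper_smooth_dini[OF u F ab(1), of b] le
    proof eventually_elim
      case (elim t)
      show ?case
      proof (intro allI impI)
        fix e :: real assume "e > 0"
        with elim have "\<forall>\<^sub>F h in at_right 0.
          F (u (t + h)) - F (u t) \<le> ((\<integral>i. \<psi> (u t) i * consensus_field M (\<beta> t) (u t) i \<partial>M) + e) * h" by blast
        moreover have "\<forall>\<^sub>F h::real in at_right 0. h > 0" by (rule eventually_at_right_less)
        ultimately show "\<forall>\<^sub>F h in at_right 0. F (u (t + h)) - F (u t) \<le> (c * F (u t) + e) * h"
        proof eventually_elim
          case h: (elim h)
          have "((\<integral>i. \<psi> (u t) i * consensus_field M (\<beta> t) (u t) i \<partial>M) + e) * h \<le> (c * F (u t) + e) * h"
            using elim(2) h(2) by (intro mult_right_mono) auto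
          then show ?case using h(1) by linarith
        qed
      qed
    qed
  qed
qed

end

subsection \<open>Weighted variance, maximum principle and convergence of the mean\<close>

definition weighted_variance :: "'a measure \<Rightarrow> ('a \<Rightarrow> real) \<Rightarrow> ('a \<Rightarrow> real) \<Rightarrow> real" where
  "weighted_variance M w y = (\<integral>i. w i * (y i * y i) \<partial>M) - (\<integral>i. w i * y i \<partial>M)\<^sup>2"

text \<open>The sign comes from \<open>consensus_field\<close> being minus the Laplacian. Test
  functions are scalar because the operator acts on each coordinate separately, and they are centred
  by the plain mean, not by the weighted one.\<close>

definition spectral_gap :: "'a measure \<Rightarrow> ('a \<times> 'a \<Rightarrow> real) \<Rightarrow> ('a \<Rightarrow> real) \<Rightarrow> real \<Rightarrow> bool" where
  "spectral_gap M \<beta> w l \<longleftrightarrow> (\<forall>y. sq_integrable M y \<longrightarrow> (\<integral>i. y i \<partial>M) = 0 \<longrightarrow>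
     l * (l2norm M y)\<^sup>2 \<le> - (\<integral>i. w i * (consensus_field M \<beta> y i * y i) \<partial>M))"

context prob_space
begin

abbreviation deviation :: "('a \<Rightarrow> real) \<Rightarrow> real" where
  "deviation y \<equiv> l2norm M (\<lambda>i. y i - (\<integral>j. y j \<partial>M))"

text \<open>Pythagoras for the centred function and a constant; in particular the mean is the best
  constant approximation.\<close>

lemma l2norm_diff_const_power2:
  assumes y: "sq_integrable M y"
  shows "(l2norm M (\<lambda>i. y i - c))\<^sup>2 = (deviation y)\<^sup>2 + ((\<integral>i. y i \<partial>M) - c)\<^sup>2"
proof -
  have i: "integrable M y" "integrable M (\<lambda>i. (y i)\<^sup>2)"
    using sq_integrable_integrable[OF y] y by (simp_all add: sq_integrable_def)
  have expand: "(l2norm M (\<lambda>i. y i - c))\<^sup>2 = (\<integral>i. (y i)\<^sup>2 \<partial>M) - 2 * c * (\<integral>i. y i \<partial>M) + c\<^sup>2" for c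
  proof -
    have "(l2norm M (\<lambda>i. y i - c))\<^sup>2 = (\<integral>i. (y i)\<^sup>2 - (2 * c) * y i + c\<^sup>2 \<partial>M)"
      unfolding l2norm_power2
      by (rule Bochner_Integration.integral_cong) (auto simp: power2_eq_square algebra_simps)
    then show ?thesis using i by (simp add: prob_space)
  qed
  show ?thesis
    unfolding expand by (simp add: power2_eq_square algebra_simps)
qed

lemma deviation_le: "sq_integrable M y \<Longrightarrow> deviation y \<le> l2norm M (\<lambda>i. y i - c)"
  by (rule power2_le_imp_le) (simp_all add: l2norm_diff_const_power2[of y c])

lemma l2norm_weighted_le:
  assumes y: "sq_integrable M y" and w: "w \<in> borel_measurable M" "\<And>i. \<bar>w i\<bar> \<le> K"
  shows "l2norm M (\<lambda>i. w i * y i) \<le> K * l2norm M y"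
proof -
  have "K \<ge> 0" using w(2) abs_ge_zero order_trans by blast
  have "l2norm M (\<lambda>i. w i * y i) \<le> l2norm M (\<lambda>i. K * y i)"
  proof (rule l2norm_mono[OF sq_integrable_cmult[OF y]])
    show "AE i in M. \<bar>w i * y i\<bar> \<le> \<bar>K * y i\<bar>"
      using w(2) \<open>K \<ge> 0\<close> by (intro AE_I2) (simp add: abs_mult mult_right_mono)
  qed (use w y in measurable)
  then show ?thesis using \<open>K \<ge> 0\<close> by (simp add: l2norm_cmult)
qed

lemma upper_smooth_integral:
  assumes "\<bar>\<sigma>\<bar> \<le> 1"
  shows "upper_smooth M 1 (\<lambda>y. \<sigma> * (\<integral>i. y i \<partial>M)) (\<lambda>_ _. \<sigma>)"
  unfolding upper_smooth_def
proof (intro conjI allI impI)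
  fix y z assume yz: "sq_integrable M y" "sq_integrable M z"
  show "\<sigma> * (\<integral>i. y i + z i \<partial>M) \<le> \<sigma> * (\<integral>i. y i \<partial>M) + (\<integral>i. \<sigma> * z i \<partial>M) + 1 * (l2norm M z)\<^sup>2"
    using sq_integrable_integrable[OF yz(1)] sq_integrable_integrable[OF yz(2)] by (simp add: distrib_left)
next
  fix y
  have "\<bar>\<sigma>\<bar> \<le> 1 + l2norm M y" using assms l2norm_nonneg[of M y] by linarith
  then show "l2norm M (\<lambda>_. \<sigma>) \<le> 1 * (l2norm M y + 1)"
    by (simp add: l2norm_const)
qed (auto intro: sq_integrable_const)

lemma upper_smooth_variance:
  assumes w: "w \<in> borel_measurable M" "\<And>i. 0 \<le> w i" "\<And>i. w i \<le> K"
  shows "\<exists>C. upper_smooth M C (weighted_variance M w) (\<lambda>y i. 2 * (w i * (y i - (\<integral>j. w j * y j \<partial>M))))"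
proof -
  have w': "\<bar>w i\<bar> \<le> K" for i using w(2,3)[of i] by simp
  have K: "K \<ge> 0" using w'[of undefined] by linarith
  \<comment> \<open>Large enough for both requirements: 2 K (1 + K) bounds the gradient and K the
    quadratic remainder. The squared weighted mean of the increment has a favourable sign and is
    dropped.\<close>
  define C where "C = 2 * (K * (1 + K)) + K"
  have C: "C \<ge> 0" "K \<le> C" "2 * (K * (1 + K)) \<le> C" using K by (auto simp: C_def)
  show ?thesis
    unfolding upper_smooth_def
  proof (intro exI[of _ C] conjI allI impI)
    show "C \<ge> 0" by fact
  next
    fix y assume y: "sq_integrable M y"
    define m where "m = (\<integral>j. w j * y j \<partial>M)"
    have ym: "sq_integrable M (\<lambda>i. y i - m)" by (rule sq_integrable_diff[OF y sq_integrable_const])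
    show "sq_integrable M (\<lambda>i. 2 * (w i * (y i - (\<integral>j. w j * y j \<partial>M))))"
      unfolding m_def[symmetric]
      by (intro sq_integrable_cmult sq_integrable_bounded_mult[OF ym w(1), of K] AE_I2 w')
    have wy: "sq_integrable M (\<lambda>i. w i * y i)"
      by (rule sq_integrable_bounded_mult[OF y w(1), of K]) (intro AE_I2 w')
    have "\<bar>m\<bar> \<le> K * l2norm M y"
      using abs_integral_le_l2norm[OF wy] l2norm_weighted_le[OF y w(1) w'] by (simp add: m_def)
    moreover have "l2norm M (\<lambda>i. y i - m) \<le> l2norm M y + \<bar>m\<bar>"
      using l2norm_triangle[OF y sq_integrable_const[of "- m"]] by (simp add: l2norm_const)
    ultimately have "l2norm M (\<lambda>i. y i - m) \<le> (1 + K) * l2norm M y" by (simp add: algebra_simps)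
    then have "l2norm M (\<lambda>i. w i * (y i - m)) \<le> K * ((1 + K) * l2norm M y)"
      using l2norm_weighted_le[OF ym w(1) w'] mult_left_mono[OF _ K] by fastforce
    then have "l2norm M (\<lambda>i. 2 * (w i * (y i - m))) \<le> 2 * (K * (1 + K)) * l2norm M y"
      by (simp add: l2norm_cmult)
    also have "\<dots> \<le> C * (l2norm M y + 1)" using C by (intro mult_mono) auto
    finally show "l2norm M (\<lambda>i. 2 * (w i * (y i - (\<integral>j. w j * y j \<partial>M)))) \<le> C * (l2norm M y + 1)"
      unfolding m_def .
    fix z assume z: "sq_integrable M z"
    note I = integrable_weighted_mult[OF _ _ w(1) w']
    note I1 = I[OF _ sq_integrable_const[of 1], simplified]
    have A: "(\<integral>i. w i * ((y i + z i) * (y i + z i)) \<partial>M)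
        = (\<integral>i. w i * (y i * y i) \<partial>M) + 2 * (\<integral>i. w i * (y i * z i) \<partial>M) + (\<integral>i. w i * (z i * z i) \<partial>M)"
    proof -
      have "(\<integral>i. w i * ((y i + z i) * (y i + z i)) \<partial>M)
        = (\<integral>i. w i * (y i * y i) + 2 * (w i * (y i * z i)) + w i * (z i * z i) \<partial>M)"
        by (rule Bochner_Integration.integral_cong) (auto simp: algebra_simps)
      then show ?thesis using I[OF y y] I[OF y z] I[OF z z] by simp
    qed
    have B: "(\<integral>i. w i * (y i + z i) \<partial>M) = m + (\<integral>i. w i * z i \<partial>M)"
      using I1[OF y] I1[OF z] by (simp add: m_def distrib_left)
    have D: "(\<integral>i. 2 * (w i * (y i - m)) * z i \<partial>M) = 2 * (\<integral>i. w i * (y i * z i) \<partial>M) - 2 * m * (\<integral>i. w i * z i \<partial>M)"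
    proof -
      have "(\<integral>i. 2 * (w i * (y i - m)) * z i \<partial>M) = (\<integral>i. 2 * (w i * (y i * z i)) - (2 * m) * (w i * z i) \<partial>M)"
        by (rule Bochner_Integration.integral_cong) (auto simp: algebra_simps)
      then show ?thesis using I[OF y z] I1[OF z] by simp
    qed
    have E: "(\<integral>i. w i * (z i * z i) \<partial>M) \<le> C * (l2norm M z)\<^sup>2"
    proof -
      have "(\<integral>i. w i * (z i * z i) \<partial>M) \<le> (\<integral>i. K * (z i)\<^sup>2 \<partial>M)"
        using I[OF z z] z w by (intro integral_mono) (auto simp: sq_integrable_def power2_eq_square mult_right_mono)
      also have "\<dots> = K * (l2norm M z)\<^sup>2" by (simp add: l2norm_power2)
      also have "\<dots> \<le> C * (l2norm M z)\<^sup>2" using C by (intro mult_right_mono) auto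
      finally show ?thesis .
    qed
    show "weighted_variance M w (\<lambda>i. y i + z i) \<le> weighted_variance M w y
        + (\<integral>i. 2 * (w i * (y i - (\<integral>j. w j * y j \<partial>M))) * z i \<partial>M) + C * (l2norm M z)\<^sup>2"
      using E zero_le_power2[of "\<integral>i. w i * z i \<partial>M"]
      unfolding weighted_variance_def m_def[symmetric] A B D power2_sum by linarith
  qed
qed

text \<open>Huygens' formula for the probability density \<open>w\<close>; the subtracted square
  vanishes when \<open>c\<close> is the weighted mean.\<close>

lemma weighted_variance_eq:
  assumes y: "sq_integrable M y" and w: "w \<in> borel_measurable M" "\<And>i. 0 \<le> w i" "\<And>i. w i \<le> K"
    and w1: "(\<integral>i. w i \<partial>M) = 1"
  shows "weighted_variance M w y = (\<integral>i. w i * (y i - c)\<^sup>2 \<partial>M) - ((\<integral>i. w i * y i \<partial>M) - c)\<^sup>2"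
proof -
  have w': "\<bar>w i\<bar> \<le> K" for i using w(2,3)[of i] by simp
  note I = integrable_weighted_mult[OF _ _ w(1) w']
  note I1 = I[OF _ sq_integrable_const[of 1], simplified]
  have "(\<integral>i. w i * (y i - c)\<^sup>2 \<partial>M) = (\<integral>i. w i * (y i * y i) - 2 * c * (w i * y i) + c\<^sup>2 * w i \<partial>M)"
    by (rule Bochner_Integration.integral_cong) (auto simp: algebra_simps power2_eq_square)
  also have "\<dots> = (\<integral>i. w i * (y i * y i) \<partial>M) - 2 * c * (\<integral>i. w i * y i \<partial>M) + c\<^sup>2"
    using I[OF y y] I1[OF y] I1[OF sq_integrable_const[of 1]] w1 by simp
  finally show ?thesis by (simp add: weighted_variance_def power2_eq_square algebra_simps)
qed

text \<open>The weighted variance is the minimum over \<open>c\<close> of the integral of w (y -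
  c)^2, attained at the weighted mean, and the squared deviation is the analogous unweighted
  minimum. The lower bound evaluates at the weighted mean; the upper one is later used with the
  plain mean as \<open>c\<close>.\<close>

lemma weighted_variance_bounds:
  assumes y: "sq_integrable M y" and w: "w \<in> borel_measurable M" "\<And>i. \<nu> \<le> w i" "\<And>i. w i \<le> K"
    and "\<nu> \<ge> 0" and w1: "(\<integral>i. w i \<partial>M) = 1"
  shows "\<nu> * (deviation y)\<^sup>2 \<le> weighted_variance M w y"
    and "weighted_variance M w y \<le> K * (l2norm M (\<lambda>i. y i - c))\<^sup>2"
proof -
  have w0: "0 \<le> w i" for i using w(2)[of i] \<open>\<nu> \<ge> 0\<close> by linarith
  then have w': "\<bar>w i\<bar> \<le> K" for i using w(3)[of i] by simp
  note eq = weighted_variance_eq[OF y w(1) w0 w(3) w1]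
  have yc: "sq_integrable M (\<lambda>i. y i - c)" for c by (rule sq_integrable_diff[OF y sq_integrable_const])
  have I: "integrable M (\<lambda>i. w i * (y i - c)\<^sup>2)" for c
    using integrable_weighted_mult[OF yc yc w(1) w'] by (simp add: power2_eq_square)
  have Y: "integrable M (\<lambda>i. k * (y i - c)\<^sup>2)" for c k
    using yc[of c] by (simp add: sq_integrable_def)
  define m where "m = (\<integral>i. w i * y i \<partial>M)"
  have "\<nu> * (deviation y)\<^sup>2 \<le> \<nu> * (l2norm M (\<lambda>i. y i - m))\<^sup>2"
    using deviation_le[OF y] \<open>\<nu> \<ge> 0\<close> by (intro mult_left_mono power_mono) auto
  also have "\<dots> = (\<integral>i. \<nu> * (y i - m)\<^sup>2 \<partial>M)" by (simp add: l2norm_power2)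
  also have "\<dots> \<le> (\<integral>i. w i * (y i - m)\<^sup>2 \<partial>M)"
    using w(2) by (intro integral_mono I Y mult_right_mono) auto
  also have "\<dots> = weighted_variance M w y" using eq[of m] by (simp add: m_def)
  finally show "\<nu> * (deviation y)\<^sup>2 \<le> weighted_variance M w y" .
  have "weighted_variance M w y \<le> (\<integral>i. w i * (y i - c)\<^sup>2 \<partial>M)" using eq[of c] by simp
  also have "\<dots> \<le> (\<integral>i. K * (y i - c)\<^sup>2 \<partial>M)"
    using w(3) by (intro integral_mono I Y mult_right_mono) auto
  also have "\<dots> = K * (l2norm M (\<lambda>i. y i - c))\<^sup>2" by (simp add: l2norm_power2)
  finally show "weighted_variance M w y \<le> K * (l2norm M (\<lambda>i. y i - c))\<^sup>2" .
qed

text \<open>The extra term is \<open>c\<close> times an integral that vanishes by the conservation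
  law. This reconciles the gradient of the weighted variance, centred at the weighted mean, with the
  spectral gap, centred at the plain mean.\<close>

lemma balanced_energy_shift:
  assumes \<beta>: "unit_kernel M \<beta>" and bal: "balanced M \<beta> w" and w: "\<And>i. \<bar>w i\<bar> \<le> K"
    and y: "sq_integrable M y"
  shows "(\<integral>i. w i * (consensus_field M \<beta> y i * (y i - c)) \<partial>M) = (\<integral>i. w i * (consensus_field M \<beta> y i * y i) \<partial>M)"
proof -
  have wm: "w \<in> borel_measurable M" using bal by (simp add: balanced_def)
  note f = sq_integrable_consensus_field[OF \<beta> y]
  have "(\<integral>i. w i * (consensus_field M \<beta> y i * (y i - c)) \<partial>M)
    = (\<integral>i. w i * (consensus_field M \<beta> y i * y i) - c * (w i * consensus_field M \<beta> y i) \<partial>M)"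
    by (rule Bochner_Integration.integral_cong) (auto simp: algebra_simps)
  also have "\<dots> = (\<integral>i. w i * (consensus_field M \<beta> y i * y i) \<partial>M) - c * (\<integral>i. w i * consensus_field M \<beta> y i \<partial>M)"
    using integrable_weighted_mult[OF f y wm w] integrable_weighted_mult[OF f sq_integrable_const[of 1] wm w]
    by simp
  also have "\<dots> = (\<integral>i. w i * (consensus_field M \<beta> y i * y i) \<partial>M)"
    using integral_balanced_field[OF \<beta> bal w sq_integrable_integrable[OF y]] by simp
  finally show ?thesis .
qed

text \<open>The gap bounds the dissipation below by \<open>l\<close> times the squared deviation,
  which is at least \<nu> times the weighted variance; hence the rate 2 \<nu> l. Passing from
  deviation to variance at \<open>a\<close> and back at \<open>b\<close> costs 1 / \<nu> each
  time.\<close>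

lemma deviation_decay:
  assumes u: "l2_solution M \<beta> u" and ab: "0 \<le> a" "a \<le> b"
    and w: "w \<in> borel_measurable M" "\<And>i. \<nu> \<le> w i" "\<And>i. w i \<le> 1 / \<nu>" and "\<nu> > 0"
    and w1: "(\<integral>i. w i \<partial>M) = 1" and "l \<ge> 0"
    and gap: "AE t in lebesgue_on {a..b}. balanced M (\<beta> t) w \<and> spectral_gap M (\<beta> t) w l"
  shows "(deviation (u b))\<^sup>2 \<le> (1 / \<nu>\<^sup>2) * exp (- 2 * \<nu> * l * (b - a)) * (deviation (u a))\<^sup>2"
proof -
  have w0: "0 \<le> w i" for i using w(2)[of i] \<open>\<nu> > 0\<close> by linarith
  then have w': "\<bar>w i\<bar> \<le> 1 / \<nu>" for i using w(3)[of i] by simp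
  have sq: "sq_integrable M (u t)" "unit_kernel M (\<beta> t)" if "t \<ge> 0" for t
    using u that by (auto simp: l2_solution_def)
  note bnds = weighted_variance_bounds[OF sq(1) w less_imp_le[OF \<open>\<nu> > 0\<close>] w1]
  obtain C where C: "upper_smooth M C (weighted_variance M w) (\<lambda>y i. 2 * (w i * (y i - (\<integral>j. w j * y j \<partial>M))))"
    using upper_smooth_variance[OF w(1) w0 w(3)] by blast
  have "AE t in lebesgue_on {a..b}. t \<in> {a..b}" by (rule AE_I2) simp
  with gap have "AE t in lebesgue_on {a..b}.
     (\<integral>i. 2 * (w i * (u t i - (\<integral>j. w j * u t j \<partial>M))) * consensus_field M (\<beta> t) (u t) i \<partial>M)
       \<le> (- 2 * \<nu> * l) * weighted_variance M w (u t)"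
  proof eventually_elim
    case (elim t)
    then have t: "t \<ge> 0" using ab by auto
    note \<beta> = sq(2)[OF t] and ut = sq(1)[OF t]
    \<comment> \<open>Here \<open>m\<close> is the weighted mean and \<open>\<mu>\<close> the plain
      mean; the connectivity bound of the theorem is not meant.\<close>
    define m \<mu> where "m = (\<integral>j. w j * u t j \<partial>M)" and "\<mu> = (\<integral>j. u t j \<partial>M)"
    let ?f = "consensus_field M (\<beta> t) (u t)"
    have bal: "balanced M (\<beta> t) w" using elim by simp
    note sh = balanced_energy_shift[OF \<beta> bal w' ut]
    have dev: "sq_integrable M (\<lambda>i. u t i - \<mu>)" by (rule sq_integrable_diff[OF ut sq_integrable_const])
    have "(\<integral>i. u t i - \<mu> \<partial>M) = 0"
      using sq_integrable_integrable[OF ut] by (simp add: \<mu>_def prob_space)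
    then have g: "l * (l2norm M (\<lambda>i. u t i - \<mu>))\<^sup>2 \<le> - (\<integral>i. w i * (?f i * (u t i - \<mu>)) \<partial>M)"
      using elim(1)[THEN conjunct2, unfolded spectral_gap_def, rule_format, OF dev]
      unfolding consensus_field_diff_const by blast
    have "(\<integral>i. 2 * (w i * (u t i - m)) * ?f i \<partial>M) = (\<integral>i. 2 * (w i * (?f i * (u t i - m))) \<partial>M)"
      by (rule Bochner_Integration.integral_cong) auto
    also have "\<dots> = 2 * (\<integral>i. w i * (?f i * (u t i - \<mu>)) \<partial>M)" using sh[of m] sh[of \<mu>] by simp
    also have "\<dots> \<le> - 2 * (l * (l2norm M (\<lambda>i. u t i - \<mu>))\<^sup>2)" using g by simp
    also have "\<dots> \<le> (- 2 * \<nu> * l) * weighted_variance M w (u t)"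
    proof -
      have "\<nu> * weighted_variance M w (u t) \<le> (l2norm M (\<lambda>i. u t i - \<mu>))\<^sup>2"
        using bnds(2)[OF t, of \<mu>] \<open>\<nu> > 0\<close> by (simp add: field_simps)
      then have "l * (\<nu> * weighted_variance M w (u t)) \<le> l * (l2norm M (\<lambda>i. u t i - \<mu>))\<^sup>2"
        using \<open>l \<ge> 0\<close> by (intro mult_left_mono) auto
      then show ?thesis by (simp add: algebra_simps)
    qed
    finally show ?case by (simp add: m_def)
  qed
  from upper_smooth_gronwall[OF u C ab this]
  have V: "weighted_variance M w (u b) \<le> exp (- 2 * \<nu> * l * (b - a)) * weighted_variance M w (u a)" .
  have "\<nu> * (deviation (u b))\<^sup>2 \<le> weighted_variance M w (u b)" using bnds(1)[of b] ab by simp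
  also note V
  also have "exp (- 2 * \<nu> * l * (b - a)) * weighted_variance M w (u a)
      \<le> exp (- 2 * \<nu> * l * (b - a)) * (1 / \<nu> * (deviation (u a))\<^sup>2)"
    using bnds(2)[OF ab(1)] by (intro mult_left_mono) auto
  finally show ?thesis using \<open>\<nu> > 0\<close> by (simp add: field_simps power2_eq_square)
qed

section \<open>Maximum principle through the squared excess over a level\<close>

lemma upper_smooth_excess:
  "upper_smooth M (2 * (1 + \<bar>c\<bar>)) (\<lambda>y. \<integral>i. (max 0 (y i - c))\<^sup>2 \<partial>M) (\<lambda>y i. 2 * max 0 (y i - c))"
proof -
  have p: "sq_integrable M (\<lambda>i. max 0 (y i - c))" "l2norm M (\<lambda>i. max 0 (y i - c)) \<le> l2norm M y + \<bar>c\<bar>"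
    if y: "sq_integrable M y" for y
  proof -
    have yc: "sq_integrable M (\<lambda>i. y i - c)" by (rule sq_integrable_diff[OF y sq_integrable_const])
    have m: "(\<lambda>i. max 0 (y i - c)) \<in> borel_measurable M" using y by measurable
    have b: "AE i in M. \<bar>max 0 (y i - c)\<bar> \<le> \<bar>y i - c\<bar>" by (rule AE_I2) auto
    show "sq_integrable M (\<lambda>i. max 0 (y i - c))" by (rule sq_integrable_bound[OF yc m b])
    show "l2norm M (\<lambda>i. max 0 (y i - c)) \<le> l2norm M y + \<bar>c\<bar>"
      using l2norm_mono[OF yc m b] l2norm_triangle[OF y sq_integrable_const[of "- c"]] by (simp add: l2norm_const)
  qed
  show ?thesis
    unfolding upper_smooth_def
  proof (intro conjI allI impI)
    fix y assume y: "sq_integrable M y"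
    show "sq_integrable M (\<lambda>i. 2 * max 0 (y i - c))" by (rule sq_integrable_cmult[OF p(1)[OF y]])
    have "l2norm M (\<lambda>i. 2 * max 0 (y i - c)) = 2 * l2norm M (\<lambda>i. max 0 (y i - c))"
      by (simp add: l2norm_cmult)
    also have "\<dots> \<le> 2 * (1 * (l2norm M y + 1) + \<bar>c\<bar> * 1)" using p(2)[OF y] by simp
    also have "\<dots> \<le> 2 * (1 * (l2norm M y + 1) + \<bar>c\<bar> * (l2norm M y + 1))"
      by (intro mult_left_mono add_left_mono) auto
    also have "\<dots> = 2 * (1 + \<bar>c\<bar>) * (l2norm M y + 1)" by (simp add: algebra_simps)
    finally show "l2norm M (\<lambda>i. 2 * max 0 (y i - c)) \<le> 2 * (1 + \<bar>c\<bar>) * (l2norm M y + 1)" .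
    fix z assume z: "sq_integrable M z"
    have yz: "sq_integrable M (\<lambda>i. y i + z i)" by (rule sq_integrable_add[OF y z])
    have I: "integrable M (\<lambda>i. (max 0 (y i - c))\<^sup>2)" "integrable M (\<lambda>i. 2 * max 0 (y i - c) * z i)"
      "integrable M (\<lambda>i. (z i)\<^sup>2)" "integrable M (\<lambda>i. (max 0 (y i + z i - c))\<^sup>2)"
      using p(1)[OF y] z p(1)[OF yz] sq_integrable_mult[OF sq_integrable_cmult[OF p(1)[OF y], of 2] z]
      by (simp_all add: sq_integrable_def)
    have "(\<integral>i. (max 0 (y i + z i - c))\<^sup>2 \<partial>M)
        \<le> (\<integral>i. (max 0 (y i - c))\<^sup>2 + 2 * max 0 (y i - c) * z i + (z i)\<^sup>2 \<partial>M)"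
    proof (rule integral_mono)
      \<comment> \<open>For y i \<ge> c the left side is at most the full square, which expands to
        the right side. Otherwise the excess of the sum is at most |z i|.\<close>
      show "(max 0 (y i + z i - c))\<^sup>2 \<le> (max 0 (y i - c))\<^sup>2 + 2 * max 0 (y i - c) * z i + (z i)\<^sup>2" for i
      proof (cases "y i - c \<ge> 0")
        case True
        have "(max 0 (y i + z i - c))\<^sup>2 \<le> (y i + z i - c)\<^sup>2" by (auto simp: max_def)
        also have "\<dots> = (y i - c)\<^sup>2 + 2 * (y i - c) * z i + (z i)\<^sup>2" by (simp add: power2_eq_square algebra_simps)
        finally show ?thesis using True by (simp add: max_def)
      next
        case False
        then have "(max 0 (y i + z i - c))\<^sup>2 \<le> (z i)\<^sup>2"
          by (intro abs_le_square_iff[THEN iffD1]) (auto simp: max_def)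
        then show ?thesis using False by (simp add: max_def)
      qed
    qed (use I in auto)
    also have "\<dots> = (\<integral>i. (max 0 (y i - c))\<^sup>2 \<partial>M) + (\<integral>i. 2 * max 0 (y i - c) * z i \<partial>M) + (l2norm M z)\<^sup>2"
      using I by (simp add: l2norm_power2)
    also have "(l2norm M z)\<^sup>2 \<le> 2 * (1 + \<bar>c\<bar>) * (l2norm M z)\<^sup>2"
      using mult_right_mono[of 1 "2 * (1 + \<bar>c\<bar>)" "(l2norm M z)\<^sup>2"] by simp
    finally show "(\<integral>i. (max 0 (y i + z i - c))\<^sup>2 \<partial>M) \<le> (\<integral>i. (max 0 (y i - c))\<^sup>2 \<partial>M)
        + (\<integral>i. 2 * max 0 (y i - c) * z i \<partial>M) + 2 * (1 + \<bar>c\<bar>) * (l2norm M z)\<^sup>2" by simp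
  qed simp
qed

text \<open>The squared excess over \<open>c\<close> starts at 0, so a Gronwall bound with any
  finite rate keeps it there; the rate 2 is crude.\<close>

lemma maximum_principle:
  assumes u: "l2_solution M \<beta> u" and init: "AE i in M. u 0 i \<le> c" and "t \<ge> 0"
  shows "AE i in M. u t i \<le> c"
proof -
  define p where "p s i = max 0 (u s i - c)" for s i
  have sq: "sq_integrable M (u t)" "unit_kernel M (\<beta> t)" if "t \<ge> 0" for t
    using u that by (auto simp: l2_solution_def)
  have psq: "sq_integrable M (p s)" if "s \<ge> 0" for s
  proof (rule sq_integrable_bound[OF sq_integrable_diff[OF sq(1)[OF that] sq_integrable_const[of c]]])
    show "p s \<in> borel_measurable M" unfolding p_def[abs_def] using sq(1)[OF that] by measurable
  qed (auto simp: p_def intro!: AE_I2)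
  have "(\<integral>i. (p t i)\<^sup>2 \<partial>M) \<le> exp (2 * (t - 0)) * (\<integral>i. (p 0 i)\<^sup>2 \<partial>M)"
    unfolding p_def
  proof (rule upper_smooth_gronwall[OF u upper_smooth_excess])
    have "AE s in lebesgue_on {0..t}. s \<in> {0..t}" by (rule AE_I2) simp
    then show "AE s in lebesgue_on {0..t}. (\<integral>i. 2 * max 0 (u s i - c) * consensus_field M (\<beta> s) (u s) i \<partial>M)
        \<le> 2 * (\<integral>i. (max 0 (u s i - c))\<^sup>2 \<partial>M)"
    proof eventually_elim
      case (elim s)
      then have s: "s \<ge> 0" by simp
      let ?f = "consensus_field M (\<beta> s) (u s)"
      have ip: "integrable M (p s)" by (rule sq_integrable_integrable[OF psq[OF s]])
      \<comment> \<open>Above the level \<open>c\<close> each term of the field is at most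
        \<open>p s j\<close>: values below \<open>u s i\<close> only pull downwards, and for larger
        ones the kernel is at most 1 and \<open>u s i\<close> exceeds \<open>c\<close>.\<close>
      have le: "p s i * ?f i \<le> p s i * (\<integral>j. p s j \<partial>M)" if i: "i \<in> space M" for i
      proof (cases "u s i \<le> c")
        case False
        have "?f i \<le> (\<integral>j. p s j \<partial>M)"
          unfolding consensus_field_def
        proof (rule integral_mono)
          show "integrable M (\<lambda>j. \<beta> s (i, j) * (u s j - u s i))"
            by (rule integrable_kernel_section[OF sq(2)[OF s] _ i])
              (use sq_integrable_integrable[OF sq(1)[OF s]] in simp)
          show "\<beta> s (i, j) * (u s j - u s i) \<le> p s j" for j
          proof (cases "u s j \<le> u s i")
            case True
            then have "\<beta> s (i, j) * (u s j - u s i) \<le> 0"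
              using unit_kernelD(2)[OF sq(2)[OF s]] by (simp add: mult_le_0_iff)
            then show ?thesis by (simp add: p_def)
          next
            case j: False
            then have "\<beta> s (i, j) * (u s j - u s i) \<le> u s j - u s i"
              using unit_kernelD(2,3)[OF sq(2)[OF s]] by (intro mult_left_le_one_le) auto
            then show ?thesis using False by (simp add: p_def max_def)
          qed
        qed (rule ip)
        then show ?thesis by (intro mult_left_mono) (auto simp: p_def)
      qed (simp add: p_def)
      have "(\<integral>i. p s i * ?f i \<partial>M) \<le> (\<integral>i. p s i * (\<integral>j. p s j \<partial>M) \<partial>M)"
        using sq_integrable_mult[OF psq[OF s] sq_integrable_consensus_field[OF sq(2,1)[OF s]]] ip le
        by (intro integral_mono_AE AE_I2) auto
      also have "\<dots> = (\<integral>j. p s j \<partial>M)\<^sup>2" by (simp add: power2_eq_square)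
      also have "\<dots> \<le> (l2norm M (p s))\<^sup>2"
        using abs_integral_le_l2norm[OF psq[OF s]] by (simp add: power2_le_iff_abs_le)
      finally show ?case by (simp add: p_def[abs_def] l2norm_power2 mult.assoc)
    qed
  qed (use \<open>t \<ge> 0\<close> in auto)
  also have "(\<integral>i. (p 0 i)\<^sup>2 \<partial>M) = 0"
    using init psq[of 0] by (subst integral_nonneg_eq_0_iff_AE) (auto simp: p_def sq_integrable_def max_def elim!: AE_mp)
  finally have "(\<integral>i. (p t i)\<^sup>2 \<partial>M) \<le> 0" by simp
  then have "(\<integral>i. (p t i)\<^sup>2 \<partial>M) = 0" by (rule antisym) simp
  then have "l2norm M (p t) = 0" by (simp add: l2norm_def)
  from l2norm_eq_0_imp_AE[OF psq[OF \<open>t \<ge> 0\<close>] this] show ?thesis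
    by eventually_elim (simp add: p_def max_def split: if_splits)
qed

section \<open>Convergence of the mean\<close>

lemma mean_step:
  assumes u: "l2_solution M \<beta> u" and dev: "\<And>t. t \<ge> 0 \<Longrightarrow> deviation (u t) \<le> B * exp (- \<rho> * t)" and "\<rho> > 0"
    and \<sigma>: "\<bar>\<sigma>\<bar> \<le> 1" and ab: "0 \<le> a" "a \<le> b"
  shows "\<sigma> * (\<integral>i. u b i \<partial>M) + 2 * B / \<rho> * exp (- \<rho> * b) \<le> \<sigma> * (\<integral>i. u a i \<partial>M) + 2 * B / \<rho> * exp (- \<rho> * a)"
proof -
  obtain K where K: "K-lipschitz_on {a..b} (\<lambda>t. \<sigma> * (\<integral>i. u t i \<partial>M))"
    using upper_smooth_lipschitz[OF u upper_smooth_integral[OF \<sigma>] ab] by blast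
  have sq: "sq_integrable M (u t)" "unit_kernel M (\<beta> t)" if "t \<ge> 0" for t
    using u that by (auto simp: l2_solution_def)
  have B: "B \<ge> 0" using order_trans[OF l2norm_nonneg dev[of 0]] by simp
  have "\<rho>-lipschitz_on {a..b} (\<lambda>t. exp (- \<rho> * t))"
  proof (rule lipschitz_onI)
    fix s t assume st: "s \<in> {a..b}" "t \<in> {a..b}"
    have "norm (exp (- \<rho> * s) - exp (- \<rho> * t)) \<le> \<rho> * norm (s - t)"
    proof (rule field_differentiable_bound[of "{a..b}"])
      show "((\<lambda>z. exp (- \<rho> * z)) has_field_derivative (- \<rho> * exp (- \<rho> * z))) (at z within {a..b})" for z
        by (auto intro!: derivative_eq_intros)
      show "norm (- \<rho> * exp (- \<rho> * z)) \<le> \<rho>" if "z \<in> {a..b}" for z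
        using that ab \<open>\<rho> > 0\<close> by (simp add: abs_mult)
    qed (use st in auto)
    then show "dist (exp (- \<rho> * s)) (exp (- \<rho> * t)) \<le> \<rho> * dist s t" by (simp add: dist_real_def)
  qed (use \<open>\<rho> > 0\<close> in simp)
  from lipschitz_on_add[OF K lipschitz_on_cmult_real[OF this, of "2 * B / \<rho>"]]
  obtain L where L: "L-lipschitz_on {a..b} (\<lambda>t. \<sigma> * (\<integral>i. u t i \<partial>M) + 2 * B / \<rho> * exp (- \<rho> * t))" by blast
  show ?thesis
  proof (rule dini_nonincreasing[OF ab(2) L])
    have "AE t in lebesgue_on {a..b}. t \<in> {a..b}" by (rule AE_I2) simp
    with upper_smooth_dini[OF u upper_smooth_integral[OF \<sigma>] ab(1), of b]
    show "AE t in lebesgue_on {a..b}. \<forall>e>0. \<forall>\<^sub>F h in at_right 0.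
       \<sigma> * (\<integral>i. u (t + h) i \<partial>M) + 2 * B / \<rho> * exp (- \<rho> * (t + h))
         - (\<sigma> * (\<integral>i. u t i \<partial>M) + 2 * B / \<rho> * exp (- \<rho> * t)) \<le> e * h"
    proof eventually_elim
      case (elim t)
      then have t: "t \<ge> 0" using ab by auto
      let ?f = "consensus_field M (\<beta> t) (u t)"
      have dv: "sq_integrable M (\<lambda>i. u t i - (\<integral>j. u t j \<partial>M))"
        by (rule sq_integrable_diff[OF sq(1)[OF t] sq_integrable_const])
      have "\<bar>\<integral>i. ?f i \<partial>M\<bar> \<le> l2norm M ?f"
        by (rule abs_integral_le_l2norm[OF sq_integrable_consensus_field[OF sq(2,1)[OF t]]])
      also have "\<dots> \<le> 2 * deviation (u t)"
        using l2norm_consensus_field[OF sq(2)[OF t] dv] by (simp add: consensus_field_diff_const)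
      also have "\<dots> \<le> 2 * (B * exp (- \<rho> * t))" using dev[OF t] by simp
      finally have "\<bar>\<sigma>\<bar> * \<bar>\<integral>i. ?f i \<partial>M\<bar> \<le> 1 * (2 * (B * exp (- \<rho> * t)))"
        using \<sigma> by (intro mult_mono) auto
      \<comment> \<open>The mean moves with speed at most 2 B exp (- \<rho> t), which is exactly the
        rate at which the exponential correction decreases; hence their sum is nonincreasing. The
        signs 1 and - 1 of \<open>\<sigma>\<close> give an upper and a lower envelope of the
        mean.\<close>
      then have fle: "(\<integral>i. \<sigma> * ?f i \<partial>M) \<le> 2 * B * exp (- \<rho> * t)"
        using abs_ge_self[of "\<sigma> * (\<integral>i. ?f i \<partial>M)"] by (simp add: abs_mult)
      show ?case
      proof (intro allI impI)
        fix e :: real assume e: "e > 0"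
        have "((\<lambda>h. (2 * B / \<rho> * exp (- \<rho> * (t + h)) - 2 * B / \<rho> * exp (- \<rho> * t)) / h) \<longlongrightarrow> - 2 * B * exp (- \<rho> * t)) (at 0)"
          by (rule DERIV_D) (use \<open>\<rho> > 0\<close> in \<open>auto intro!: derivative_eq_intros\<close>)
        then have "((\<lambda>h. (2 * B / \<rho> * exp (- \<rho> * (t + h)) - 2 * B / \<rho> * exp (- \<rho> * t)) / h) \<longlongrightarrow> - 2 * B * exp (- \<rho> * t)) (at_right 0)"
          by (rule tendsto_mono[rotated]) (simp add: at_le)
        then have "\<forall>\<^sub>F h in at_right 0. (2 * B / \<rho> * exp (- \<rho> * (t + h)) - 2 * B / \<rho> * exp (- \<rho> * t)) / h < - 2 * B * exp (- \<rho> * t) + e / 2"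
          by (rule order_tendstoD) (use e in simp)
        moreover have "\<forall>\<^sub>F h in at_right 0. \<sigma> * (\<integral>i. u (t + h) i \<partial>M) - \<sigma> * (\<integral>i. u t i \<partial>M)
            \<le> ((\<integral>i. \<sigma> * ?f i \<partial>M) + e / 2) * h"
          using elim(1) e half_gt_zero by blast
        moreover have "\<forall>\<^sub>F h::real in at_right 0. h > 0" by (rule eventually_at_right_less)
        ultimately show "\<forall>\<^sub>F h in at_right 0. \<sigma> * (\<integral>i. u (t + h) i \<partial>M) + 2 * B / \<rho> * exp (- \<rho> * (t + h))
         - (\<sigma> * (\<integral>i. u t i \<partial>M) + 2 * B / \<rho> * exp (- \<rho> * t)) \<le> e * h"
        proof eventually_elim
          case h: (elim h)
          have 1: "2 * B / \<rho> * exp (- \<rho> * (t + h)) - 2 * B / \<rho> * exp (- \<rho> * t) \<le> (- 2 * B * exp (- \<rho> * t) + e / 2) * h"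
            using h(1,3) by (simp add: pos_divide_less_eq)
          have "((\<integral>i. \<sigma> * ?f i \<partial>M) + e / 2) * h \<le> (2 * B * exp (- \<rho> * t) + e / 2) * h"
            using fle h(3) by (intro mult_right_mono) auto
          moreover have "(- 2 * B * exp (- \<rho> * t) + e / 2) * h + (2 * B * exp (- \<rho> * t) + e / 2) * h = e * h"
            by (simp add: algebra_simps)
          ultimately show ?case using 1 h(2) by linarith
        qed
      qed
    qed
  qed
qed

lemma mean_converges:
  assumes u: "l2_solution M \<beta> u" and dev: "\<And>t. t \<ge> 0 \<Longrightarrow> deviation (u t) \<le> B * exp (- \<rho> * t)" and "\<rho> > 0"
  shows "\<exists>m. \<forall>t\<ge>0. \<bar>(\<integral>i. u t i \<partial>M) - m\<bar> \<le> 2 * B / \<rho> * exp (- \<rho> * t)"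
proof -
  define E where "E t = 2 * B / \<rho> * exp (- \<rho> * t)" for t
  define f where "f t = (\<integral>i. u t i \<partial>M)" for t
  have B: "B \<ge> 0" using order_trans[OF l2norm_nonneg dev[of 0]] by simp
  have E: "E t \<ge> 0" for t using B \<open>\<rho> > 0\<close> by (simp add: E_def)
  have up: "f b + E b \<le> f a + E a" and lo: "f a - E a \<le> f b - E b" if "0 \<le> a" "a \<le> b" for a b
    using mean_step[OF u dev \<open>\<rho> > 0\<close> _ that, of 1] mean_step[OF u dev \<open>\<rho> > 0\<close> _ that, of "-1"]
    by (simp_all add: E_def f_def)
  have cross: "f t - E t \<le> f s + E s" if "s \<ge> 0" "t \<ge> 0" for s t
    using up[of s t] lo[of t s] E[of s] E[of t] that by (cases "s \<le> t") auto
  \<comment> \<open>The upper envelope decreases, the lower one increases, and \<open>cross\<close>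
    orders them, so the infimum of the upper one lies between both at every time.\<close>
  define m where "m = (INF s\<in>{0..}. f s + E s)"
  have bdd: "bdd_below ((\<lambda>s. f s + E s) ` {0..})"
    by (rule bdd_belowI2[of _ "f 0 - E 0"]) (use cross[of _ 0] in simp)
  have "\<bar>f t - m\<bar> \<le> E t" if "t \<ge> 0" for t
  proof -
    have "m \<le> f t + E t" unfolding m_def by (rule cINF_lower[OF bdd]) (use that in simp)
    moreover have "f t - E t \<le> m" unfolding m_def by (rule cINF_greatest) (use that cross in auto)
    ultimately show ?thesis by (simp add: abs_le_iff)
  qed
  then show ?thesis unfolding f_def E_def by blast
qed

end

subsection \<open>Lebesgue measurable kernels on the unit interval\<close>

abbreviation leb_I :: "real measure" where
  "leb_I \<equiv> lebesgue_on unit_I"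

interpretation unit: prob_space leb_I
  by (rule prob_spaceI) (simp add: emeasure_restrict_space)

lemma AE_leb_I_iff: "(AE i in leb_I. P i) \<longleftrightarrow> (AE i in lborel. i \<in> unit_I \<longrightarrow> P i)"
  by (subst AE_restrict_space_iff) (auto simp: AE_completion_iff)

text \<open>Lebesgue measure is complete. This supplies the measurability of functions known only up
  to null sets, such as sections of the original kernel.\<close>

lemma borel_measurable_leb_I_cong_AE:
  fixes f g :: "real \<Rightarrow> real"
  assumes "f \<in> borel_measurable leb_I" "AE i in leb_I. f i = g i"
  shows "g \<in> borel_measurable leb_I"
proof -
  have "(\<lambda>x. if x \<in> unit_I then f x else 0) \<in> borel_measurable lebesgue"
    using borel_measurable_if_I[OF assms(1)] by simp
  moreover have "AE x in lebesgue. (if x \<in> unit_I then f x else 0) = (if x \<in> unit_I then g x else 0)"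
    using assms(2) by (subst (asm) AE_restrict_space_iff) (auto elim!: AE_mp)
  ultimately have "(\<lambda>x. if x \<in> unit_I then g x else 0) \<in> borel_measurable lebesgue"
    by (rule borel_measurable_AE)
  then show ?thesis by (subst (asm) borel_measurable_if) auto
qed

lemma integral_leb_I_cong_AE:
  fixes f g :: "real \<Rightarrow> real"
  assumes "f \<in> borel_measurable leb_I" "AE i in leb_I. f i = g i"
  shows "(\<integral>i. f i \<partial>leb_I) = (\<integral>i. g i \<partial>leb_I)"
  using assms borel_measurable_leb_I_cong_AE[OF assms] by (intro integral_cong_AE)

text \<open>Both orders of sections are recorded: the Laplacian integrates over the second variable
  of the kernel, the balance condition over the first one as well.\<close>

definition represents :: "(real \<times> real \<Rightarrow> real) \<Rightarrow> kernel \<Rightarrow> bool" where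
  "represents \<beta> b \<longleftrightarrow> unit_kernel leb_I \<beta> \<and>
     (AE i in leb_I. AE j in leb_I. \<beta> (i, j) = b i j) \<and> (AE i in leb_I. AE j in leb_I. \<beta> (j, i) = b j i)"

text \<open>The exceptional pairs lie in a measurable null set \<open>N\<close> of the product
  measure, almost all of whose sections are null in either direction. Measurability of
  \<open>N\<close> is what permits exchanging the two quantifiers.\<close>

lemma AE_lborel_square:
  assumes "AE p in (lborel :: (real \<times> real) measure). p \<in> unit_I \<times> unit_I \<longrightarrow> Q p"
  shows "AE i in leb_I. AE j in leb_I. Q (i, j)" and "AE i in leb_I. AE j in leb_I. Q (j, i)"
proof -
  have Q: "AE p in (lborel :: real measure) \<Otimes>\<^sub>M lborel. p \<in> unit_I \<times> unit_I \<longrightarrow> Q p"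
    using assms by (subst lborel_prod)
  then obtain N where "\<And>p. p \<in> space (lborel \<Otimes>\<^sub>M lborel) - N \<Longrightarrow> p \<in> unit_I \<times> unit_I \<longrightarrow> Q p"
    and N: "N \<in> null_sets ((lborel :: real measure) \<Otimes>\<^sub>M lborel)" by (rule AE_E3) blast
  then have NQ: "Q p" if "p \<notin> N" "p \<in> unit_I \<times> unit_I" for p
    using that by (auto simp: space_pair_measure)
  have "AE p in (lborel :: real measure) \<Otimes>\<^sub>M lborel. p \<notin> N" using N by (rule AE_not_in)
  then have 1: "AE x in lborel. AE y in lborel. (x, y) \<notin> N" by (rule lborel_pair.AE_pair)
  have "{p \<in> space ((lborel :: real measure) \<Otimes>\<^sub>M lborel). (fst p, snd p) \<notin> N} = space (lborel \<Otimes>\<^sub>M lborel) - N"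
    by auto
  then have "{p \<in> space ((lborel :: real measure) \<Otimes>\<^sub>M lborel). (fst p, snd p) \<notin> N} \<in> sets (lborel \<Otimes>\<^sub>M lborel)"
    using null_setsD2[OF N] by (simp only: sets.compl_sets)
  from lborel_pair.AE_commute[OF this] 1 have 2: "AE y in lborel. AE x in lborel. (x, y) \<notin> N" by simp
  show "AE i in leb_I. AE j in leb_I. Q (i, j)"
    unfolding AE_leb_I_iff using 1
  proof eventually_elim
    case (elim x)
    show ?case
    proof (cases "x \<in> unit_I")
      case True
      from elim show ?thesis using NQ True by (auto elim!: AE_mp)
    qed auto
  qed
  show "AE i in leb_I. AE j in leb_I. Q (j, i)"
    unfolding AE_leb_I_iff using 2
  proof eventually_elim
    case (elim x)
    show ?case
    proof (cases "x \<in> unit_I")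
      case True
      from elim show ?thesis using NQ True by (auto elim!: AE_mp)
    qed auto
  qed
qed

text \<open>A Lebesgue measurable kernel agrees almost everywhere with a Borel one, which is clamped
  to [0, 1] so that the bounds hold everywhere. The order of quantifiers matters: one representative
  serves all kernels almost everywhere equal to \<open>b\<close>, hence a whole dwell
  interval.\<close>

lemma kernel_on_I_represented:
  assumes "kernel_on_I b"
  shows "\<exists>\<beta>. \<forall>b'. (AE (i, j) in lebesgue_on (unit_I \<times> unit_I). b i j = b' i j) \<longrightarrow> represents \<beta> b'"
proof -
  have S: "unit_I \<times> unit_I \<in> sets (lebesgue :: (real \<times> real) measure)"
    by (intro borel_closed closed_Times sets_completionI_sets) (auto simp: borel_closed closed_Times)
  define f where "f p = (if p \<in> unit_I \<times> unit_I then b (fst p) (snd p) else 0)" for p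
  have "f \<in> borel_measurable lebesgue"
    unfolding f_def[abs_def]
    by (rule borel_measurable_if_I[OF _ S]) (use assms in \<open>simp add: kernel_on_I_def case_prod_beta'\<close>)
  then obtain g where g: "g \<in> borel_measurable lborel" "AE p in lborel. f p = g p"
    using completion_ex_borel_measurable_real by blast
  define \<beta> where "\<beta> p = max 0 (min 1 (g p))" for p
  have [measurable]: "g \<in> borel_measurable borel" using g(1) by simp
  have "(\<lambda>p. p) \<in> measurable (leb_I \<Otimes>\<^sub>M leb_I) (borel \<Otimes>\<^sub>M borel)"
  proof (rule measurable_pair)
    have id: "(\<lambda>x. x) \<in> measurable leb_I borel"
      by (rule measurable_restrict_space1) (rule measurable_completion, simp)
    show "fst \<circ> (\<lambda>p. p) \<in> measurable (leb_I \<Otimes>\<^sub>M leb_I) borel"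
      using measurable_compose[OF measurable_fst id] by (simp add: comp_def)
    show "snd \<circ> (\<lambda>p. p) \<in> measurable (leb_I \<Otimes>\<^sub>M leb_I) borel"
      using measurable_compose[OF measurable_snd id] by (simp add: comp_def)
  qed
  then have "(\<lambda>p. p) \<in> measurable (leb_I \<Otimes>\<^sub>M leb_I) borel" by (simp add: borel_prod)
  from measurable_compose[OF this, of \<beta> borel] have "\<beta> \<in> borel_measurable (leb_I \<Otimes>\<^sub>M leb_I)"
    unfolding \<beta>_def[abs_def] by simp
  then have \<beta>: "unit_kernel leb_I \<beta>" by (auto simp: unit_kernel_def \<beta>_def)
  have f\<beta>: "AE p in lborel. f p = \<beta> p"
    using g(2)
  proof eventually_elim
    case (elim p)
    have "0 \<le> f p" "f p \<le> 1" using assms by (auto simp: f_def kernel_on_I_def)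
    then show ?case using elim by (simp add: \<beta>_def)
  qed
  have "represents \<beta> b'" if "AE (i, j) in lebesgue_on (unit_I \<times> unit_I). b i j = b' i j" for b'
  proof -
    have "AE p in lborel. p \<in> unit_I \<times> unit_I \<longrightarrow> b (fst p) (snd p) = b' (fst p) (snd p)"
      using that by (subst (asm) AE_restrict_space_iff) (auto simp: AE_completion_iff S case_prod_beta')
    with f\<beta> have "AE p in lborel. p \<in> unit_I \<times> unit_I \<longrightarrow> \<beta> p = b' (fst p) (snd p)"
      by eventually_elim (auto simp: f_def)
    from AE_lborel_square[OF this] \<beta> show ?thesis by (simp add: represents_def)
  qed
  then show ?thesis by blast
qed

section \<open>Algebraic connectivity in terms of scalar coordinates\<close>

lemma sq_integrable_coordinate: "y \<in> L2_space d \<Longrightarrow> k < d \<Longrightarrow> sq_integrable leb_I (\<lambda>i. y i k)"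
  by (simp add: L2_space_def sq_integrable_def)

lemma L2_norm_power2:
  assumes "\<And>k. k < d \<Longrightarrow> sq_integrable leb_I (\<lambda>i. y i k)"
  shows "(L2_norm d y)\<^sup>2 = (\<Sum>k<d. (l2norm leb_I (\<lambda>i. y i k))\<^sup>2)"
proof -
  have "(L2_norm d y)\<^sup>2 = (\<integral>i. (\<Sum>k<d. (y i k)\<^sup>2) \<partial>leb_I)"
    by (simp add: L2_norm_def L2_set_def sum_nonneg)
  also have "\<dots> = (\<Sum>k<d. (\<integral>i. (y i k)\<^sup>2 \<partial>leb_I))"
    using assms by (intro Bochner_Integration.integral_sum) (auto simp: sq_integrable_def)
  finally show ?thesis by (simp add: l2norm_power2)
qed

lemma represents_graph_laplacian:
  assumes r: "represents \<beta> b" and y: "(\<lambda>i. y i k) \<in> borel_measurable leb_I"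
  shows "AE i in leb_I. consensus_field leb_I \<beta> (\<lambda>i. y i k) i = - graph_laplacian b y i k"
proof -
  have "AE i in leb_I. AE j in leb_I. \<beta> (i, j) = b i j" "unit_kernel leb_I \<beta>"
    using r by (auto simp: represents_def)
  moreover have "AE i in leb_I. i \<in> space leb_I" by (rule AE_space)
  ultimately show ?thesis
  proof (elim AE_mp, intro AE_I2 impI)
    fix i assume i: "i \<in> space leb_I" and eq: "AE j in leb_I. \<beta> (i, j) = b i j"
    note [measurable] = measurable_Pair2[OF unit_kernelD(1)[OF \<open>unit_kernel leb_I \<beta>\<close>] i] y
    have "(\<integral>j. \<beta> (i, j) * (y i k - y j k) \<partial>leb_I) = (\<integral>j. b i j * (y i k - y j k) \<partial>leb_I)"
      by (rule integral_leb_I_cong_AE) (use eq in \<open>auto elim!: AE_mp\<close>)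
    moreover have "(\<integral>j. \<beta> (i, j) * (y i k - y j k) \<partial>leb_I) = (\<integral>j. - (\<beta> (i, j) * (y j k - y i k)) \<partial>leb_I)"
      by (rule Bochner_Integration.integral_cong) (auto simp: algebra_simps)
    ultimately show "consensus_field leb_I \<beta> (\<lambda>i. y i k) i = - graph_laplacian b y i k"
      by (simp add: consensus_field_def graph_laplacian_def)
  qed
qed

text \<open>The algebraic connectivity expressed by a product-measurable kernel and a weight. At the
  times of one dwell interval the kernel is the same, so the values agree as soon as the weights do
  almost everywhere.\<close>

definition rayleigh_inf :: "nat \<Rightarrow> (real \<times> real \<Rightarrow> real) \<Rightarrow> (real \<Rightarrow> real) \<Rightarrow> real" where
  "rayleigh_inf d \<beta> w =
     Inf {- (\<Sum>k<d. \<integral>i. w i * (consensus_field leb_I \<beta> (\<lambda>i. y i k) i * y i k) \<partial>leb_I) / (L2_norm d y)\<^sup>2 | y.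
            y \<in> L2_space d \<and> (\<forall>k<d. mean y k = 0) \<and> L2_norm d y \<noteq> 0}"

lemma algebraic_connectivity_eq:
  assumes r: "represents \<beta> b" and w: "w \<in> borel_measurable leb_I" "\<And>i. \<bar>w i\<bar> \<le> K"
    and eq: "AE i in leb_I. w i = w0 i"
  shows "algebraic_connectivity d b w0 = rayleigh_inf d \<beta> w"
proof -
  have \<beta>: "unit_kernel leb_I \<beta>" using r by (simp add: represents_def)
  have "L2_inner d (rescaled_laplacian b w0 y) y
      = - (\<Sum>k<d. \<integral>i. w i * (consensus_field leb_I \<beta> (\<lambda>i. y i k) i * y i k) \<partial>leb_I)"
    if y: "y \<in> L2_space d" for y
  proof -
    have I: "integrable leb_I (\<lambda>i. w i * (consensus_field leb_I \<beta> (\<lambda>i. y i k) i * y i k))" if "k < d" for k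
      using sq_integrable_coordinate[OF y that]
      by (intro unit.integrable_weighted_mult[OF _ _ w] unit.sq_integrable_consensus_field[OF \<beta>])
    have "AE i in leb_I. \<forall>k\<in>{..<d}. consensus_field leb_I \<beta> (\<lambda>i. y i k) i = - graph_laplacian b y i k"
      by (intro AE_finite_allI represents_graph_laplacian[OF r])
        (use sq_integrable_coordinate[OF y] in \<open>auto simp: sq_integrable_def\<close>)
    with eq have "AE i in leb_I. - (\<Sum>k<d. w i * (consensus_field leb_I \<beta> (\<lambda>i. y i k) i * y i k))
        = (\<Sum>k<d. rescaled_laplacian b w0 y i k * y i k)"
      by eventually_elim (simp add: rescaled_laplacian_def sum_negf[symmetric] mult.assoc)
    then have "(\<integral>i. - (\<Sum>k<d. w i * (consensus_field leb_I \<beta> (\<lambda>i. y i k) i * y i k)) \<partial>leb_I)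
        = (\<integral>i. (\<Sum>k<d. rescaled_laplacian b w0 y i k * y i k) \<partial>leb_I)"
      using I by (intro integral_leb_I_cong_AE borel_measurable_uminus borel_measurable_sum) auto
    then show ?thesis
      unfolding L2_inner_def using I by simp
  qed
  then show ?thesis
    unfolding algebraic_connectivity_def rayleigh_inf_def
    by (intro arg_cong[of _ _ Inf] Collect_cong) (metis (no_types, lifting))
qed

lemma rayleigh_inf_cong:
  assumes "w \<in> borel_measurable leb_I" "w' \<in> borel_measurable leb_I" "AE i in leb_I. w i = w' i"
    "unit_kernel leb_I \<beta>"
  shows "rayleigh_inf d \<beta> w = rayleigh_inf d \<beta> w'"
proof -
  have "(\<Sum>k<d. \<integral>i. w i * (consensus_field leb_I \<beta> (\<lambda>i. y i k) i * y i k) \<partial>leb_I)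
     = (\<Sum>k<d. \<integral>i. w' i * (consensus_field leb_I \<beta> (\<lambda>i. y i k) i * y i k) \<partial>leb_I)"
    if y: "y \<in> L2_space d" for y
  proof (rule sum.cong[OF refl])
    fix k assume "k \<in> {..<d}"
    then have "(\<lambda>i. y i k) \<in> borel_measurable leb_I" using y by (simp add: L2_space_def)
    then show "(\<integral>i. w i * (consensus_field leb_I \<beta> (\<lambda>i. y i k) i * y i k) \<partial>leb_I)
      = (\<integral>i. w' i * (consensus_field leb_I \<beta> (\<lambda>i. y i k) i * y i k) \<partial>leb_I)"
      using assms unit.consensus_field_measurable[OF assms(4)]
      by (intro integral_leb_I_cong_AE borel_measurable_times) (auto elim!: AE_mp)
  qed
  then show ?thesis
    unfolding rayleigh_inf_def
    by (intro arg_cong[of _ _ Inf] Collect_cong) (metis (no_types, lifting))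
qed

text \<open>A scalar test function is put into coordinate 0, which exists since
  \<open>d \<ge> 1\<close>, without changing its norm or energy. Nonnegativity is inherited from
  each single quotient.\<close>

lemma rayleigh_inf_spectral_gap:
  assumes \<beta>: "unit_kernel leb_I \<beta>" and bal: "balanced leb_I \<beta> w" and w: "\<And>i. 0 \<le> w i" "\<And>i. w i \<le> K"
    and "d \<ge> 1"
  shows "spectral_gap leb_I \<beta> w (rayleigh_inf d \<beta> w)" and "0 \<le> rayleigh_inf d \<beta> w"
proof -
  define R where "R y = - (\<Sum>k<d. \<integral>i. w i * (consensus_field leb_I \<beta> (\<lambda>i. y i k) i * y i k) \<partial>leb_I) / (L2_norm d y)\<^sup>2"
    for y
  define A where "A = {y. y \<in> L2_space d \<and> (\<forall>k<d. mean y k = 0) \<and> L2_norm d y \<noteq> 0}"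
  have eq: "rayleigh_inf d \<beta> w = (INF y\<in>A. R y)"
    unfolding rayleigh_inf_def R_def A_def by (rule arg_cong[of _ _ Inf]) auto
  have nn: "R y \<ge> 0" if "y \<in> A" for y
  proof -
    have "(\<integral>i. w i * (consensus_field leb_I \<beta> (\<lambda>i. y i k) i * y i k) \<partial>leb_I) \<le> 0" if "k < d" for k
      using unit.balanced_energy_nonpos[OF \<beta> bal w] sq_integrable_coordinate[OF _ that] \<open>y \<in> A\<close>
      by (auto simp: A_def)
    then show ?thesis unfolding R_def by (intro divide_nonneg_nonneg) (auto intro!: sum_nonpos)
  qed
  have bdd: "bdd_below (R ` A)" by (rule bdd_belowI2[of _ 0]) (rule nn)
  define e where "e y i k = (if k = 0 \<and> i \<in> unit_I then y i else 0)" for y :: "real \<Rightarrow> real" and i and k :: nat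
  have esq: "sq_integrable leb_I (\<lambda>i. e y i k)" "l2norm leb_I (\<lambda>i. e y i k) = (if k = 0 then l2norm leb_I y else 0)"
    if y: "sq_integrable leb_I y" for y k
  proof -
    have 0: "AE i in leb_I. y i = e y i 0" by (auto simp: e_def intro!: AE_I2)
    have m: "(\<lambda>i. e y i 0) \<in> borel_measurable leb_I"
      by (rule borel_measurable_leb_I_cong_AE[OF _ 0]) (use y in \<open>simp add: sq_integrable_def\<close>)
    have s: "sq_integrable leb_I (\<lambda>i. e y i 0)"
      by (rule sq_integrable_bound[OF y m]) (auto simp: e_def intro!: AE_I2)
    have n: "l2norm leb_I (\<lambda>i. e y i 0) = l2norm leb_I y"
      using l2norm_cong_AE[OF sq_integrableD[OF y] m 0] by simp
    have z: "(\<lambda>i. e y i k) = (\<lambda>i. 0)" if "k \<noteq> 0" using that by (simp add: e_def)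
    show "sq_integrable leb_I (\<lambda>i. e y i k)"
      using s z unit.sq_integrable_const[of 0] by (cases "k = 0") auto
    show "l2norm leb_I (\<lambda>i. e y i k) = (if k = 0 then l2norm leb_I y else 0)"
      using n z unit.l2norm_const[of 0] by (cases "k = 0") auto
  qed
  have eN: "(L2_norm d (e y))\<^sup>2 = (l2norm leb_I y)\<^sup>2" if y: "sq_integrable leb_I y" for y
  proof -
    have "(L2_norm d (e y))\<^sup>2 = (\<Sum>k<d. (l2norm leb_I (\<lambda>i. e y i k))\<^sup>2)"
      by (rule L2_norm_power2) (rule esq(1)[OF y])
    also have "\<dots> = (\<Sum>k<d. if k = 0 then (l2norm leb_I y)\<^sup>2 else 0)"
      by (intro sum.cong) (auto simp: esq(2)[OF y])
    also have "\<dots> = (l2norm leb_I y)\<^sup>2" using \<open>d \<ge> 1\<close> by simp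
    finally show ?thesis .
  qed
  have eint: "(\<integral>i. e y i 0 \<partial>leb_I) = (\<integral>i. y i \<partial>leb_I)" for y
    by (rule Bochner_Integration.integral_cong) (auto simp: e_def)
  have eA: "e y \<in> A" if y: "sq_integrable leb_I y" "(\<integral>i. y i \<partial>leb_I) = 0" "l2norm leb_I y \<noteq> 0" for y
    unfolding A_def
  proof (intro CollectI conjI allI impI)
    show "e y \<in> L2_space d"
      using esq(1)[OF y(1)] \<open>d \<ge> 1\<close>
      by (auto simp: L2_space_def topspace_Euclidean_space e_def sq_integrable_def)
    show "mean (e y) k = 0" for k
    proof (cases "k = 0")
      case False
      then have "(\<lambda>i. e y i k) = (\<lambda>i. 0)" by (simp add: e_def)
      then show ?thesis by (simp add: mean_def)
    qed (simp add: mean_def eint y(2))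
    show "L2_norm d (e y) \<noteq> 0" using eN[OF y(1)] y(3) by auto
  qed
  show "spectral_gap leb_I \<beta> w (rayleigh_inf d \<beta> w)"
    unfolding spectral_gap_def
  proof (intro allI impI)
    fix y assume y: "sq_integrable leb_I y" and y0: "(\<integral>i. y i \<partial>leb_I) = 0"
    let ?E = "\<integral>i. w i * (consensus_field leb_I \<beta> y i * y i) \<partial>leb_I"
    show "rayleigh_inf d \<beta> w * (l2norm leb_I y)\<^sup>2 \<le> - ?E"
    proof (cases "l2norm leb_I y = 0")
      case True
      then show ?thesis using unit.balanced_energy_nonpos[OF \<beta> bal w y] by simp
    next
      case False
      have "R (e y) = - ?E / (l2norm leb_I y)\<^sup>2"
      proof -
        have c: "consensus_field leb_I \<beta> (\<lambda>i. e y i 0) i = consensus_field leb_I \<beta> y i" if "i \<in> space leb_I" for i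
          unfolding consensus_field_def
          by (rule Bochner_Integration.integral_cong) (use that in \<open>auto simp: e_def\<close>)
        have "(\<Sum>k<d. \<integral>i. w i * (consensus_field leb_I \<beta> (\<lambda>i. e y i k) i * e y i k) \<partial>leb_I)
            = (\<Sum>k<d. if k = 0 then ?E else 0)"
        proof (rule sum.cong[OF refl])
          fix k
          show "(\<integral>i. w i * (consensus_field leb_I \<beta> (\<lambda>i. e y i k) i * e y i k) \<partial>leb_I) = (if k = 0 then ?E else 0)"
          proof (cases "k = 0")
            case True
            then show ?thesis
              using c by (auto intro!: Bochner_Integration.integral_cong simp: e_def)
          qed (simp add: e_def)
        qed
        also have "\<dots> = ?E" using \<open>d \<ge> 1\<close> by simp
        finally show ?thesis by (simp add: R_def eN[OF y])
      qed
      moreover have "rayleigh_inf d \<beta> w \<le> R (e y)"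
        unfolding eq by (rule cINF_lower[OF bdd eA[OF y y0 False]])
      moreover have "(l2norm leb_I y)\<^sup>2 > 0" using False by simp
      ultimately show ?thesis using pos_le_divide_eq by metis
    qed
  qed
  \<comment> \<open>A centred function of norm 1/2. It shows that the infimum ranges over a nonempty
    set; the infimum of the empty set of reals would carry no sign.\<close>
  define s where "s i = indicator {0..1/2} i - (1/2 :: real)" for i :: real
  have "{0..1/2} \<in> sets leb_I" by (auto simp: sets_restrict_space image_iff intro!: bexI[of _ "{0..1/2}"])
  then have [measurable]: "(indicator {0..1/2} :: real \<Rightarrow> real) \<in> borel_measurable leb_I" by simp
  have sm: "s \<in> borel_measurable leb_I" unfolding s_def[abs_def] by simp
  have "(\<lambda>i. (s i)\<^sup>2) = (\<lambda>i. 1/4)" by (auto simp: s_def power2_eq_square indicator_def)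
  then have s: "sq_integrable leb_I s" "l2norm leb_I s = 1/2"
    using sm by (auto simp: sq_integrable_def l2norm_def unit.prob_space[simplified] real_sqrt_divide)
  have "(\<integral>i. s i \<partial>leb_I) = measure leb_I {0..1/2} - 1/2"
    using \<open>{0..1/2} \<in> sets leb_I\<close> by (simp add: s_def unit.prob_space[simplified] unit.emeasure_eq_measure)
  also have "measure leb_I {0..1/2} = 1/2" by (simp add: measure_restrict_space)
  finally have "(\<integral>i. s i \<partial>leb_I) = 0" by simp
  then have "A \<noteq> {}" using eA[OF s(1)] s(2) by auto
  then show "0 \<le> rayleigh_inf d \<beta> w" unfolding eq by (intro cINF_greatest nn)
qed

text \<open>Boundedness of \<open>w\<close> and of the kernel makes both parts of the defining
  integral integrable, so that the integral of the difference splits into outflow minus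
  inflow.\<close>

lemma canonical_vector_balanced:
  assumes r: "represents \<beta> b" and can: "canonical_vector b N C w0"
    and w: "w \<in> borel_measurable leb_I" and eq: "AE i in leb_I. w i = w0 i" and "\<And>i. \<bar>w i\<bar> \<le> K"
  shows "balanced leb_I \<beta> w"
proof -
  have \<beta>: "unit_kernel leb_I \<beta>" using r by (simp add: represents_def)
  have AE: "AE i in leb_I. (\<integral>j. b i j * w0 i - b j i * w0 j \<partial>leb_I) = 0"
    "AE i in leb_I. AE j in leb_I. \<beta> (i, j) = b i j" "AE i in leb_I. AE j in leb_I. \<beta> (j, i) = b j i"
    using can r by (auto simp: canonical_vector_def represents_def)
  have "AE i in leb_I. i \<in> space leb_I" by (rule AE_space)
  with AE eq have "AE i in leb_I. w i * (\<integral>j. \<beta> (i, j) \<partial>leb_I) = (\<integral>j. \<beta> (j, i) * w j \<partial>leb_I)"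
  proof eventually_elim
    case (elim i)
    have 1: "(\<lambda>j. \<beta> (i, j)) \<in> borel_measurable leb_I" and 2: "(\<lambda>j. \<beta> (j, i)) \<in> borel_measurable leb_I"
      using measurable_Pair2[OF unit_kernelD(1)[OF \<beta>]] measurable_Pair1[OF unit_kernelD(1)[OF \<beta>]] elim(5) by auto
    have I1: "integrable leb_I (\<lambda>j. \<beta> (i, j) * w i)"
      using unit.integrable_kernel_section_const[OF \<beta> elim(5)] by simp
    have I2: "integrable leb_I (\<lambda>j. \<beta> (j, i) * w j)"
    proof (rule unit.integrable_const_bound[of _ K])
      show "AE j in leb_I. norm (\<beta> (j, i) * w j) \<le> K"
      proof (rule AE_I2)
        fix j
        have "\<bar>\<beta> (j, i)\<bar> * \<bar>w j\<bar> \<le> 1 * K"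
          using unit_kernelD(2,3)[OF \<beta>] assms(5) by (intro mult_mono) auto
        then show "norm (\<beta> (j, i) * w j) \<le> K" by (simp add: abs_mult)
      qed
    qed (use 2 w in measurable)
    have "AE j in leb_I. \<beta> (i, j) * w i - \<beta> (j, i) * w j = b i j * w0 i - b j i * w0 j"
      using elim(2,3) eq by eventually_elim (simp add: elim(4))
    then have "(\<integral>j. \<beta> (i, j) * w i - \<beta> (j, i) * w j \<partial>leb_I) = (\<integral>j. b i j * w0 i - b j i * w0 j \<partial>leb_I)"
      using I1 I2 by (intro integral_leb_I_cong_AE) auto
    also have "\<dots> = 0" by (rule elim(1))
    finally have "w i * (\<integral>j. \<beta> (i, j) \<partial>leb_I) - (\<integral>j. \<beta> (j, i) * w j \<partial>leb_I) = 0"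
      using Bochner_Integration.integral_diff[OF I1 I2] by (simp add: mult.commute[of "w i"])
    then show ?case by simp
  qed
  then show ?thesis using w by (simp add: balanced_def)
qed

subsection \<open>Normalisation of the canonical vector\<close>

text \<open>Nonnegative integrals add over countably many pieces without any integrability check.
  Indices outside \<open>N\<close> carry the empty set, and overlaps are null, so almost every point
  of the unit interval lies in exactly one piece.\<close>

lemma nn_integral_leb_I_partition:
  fixes f :: "real \<Rightarrow> ennreal"
  assumes sc: "strongly_connected_components b N C" and f: "f \<in> borel_measurable leb_I"
  shows "(\<integral>\<^sup>+i. f i \<partial>leb_I) = (\<Sum>n. if n \<in> N then \<integral>\<^sup>+i. f i \<partial>lebesgue_on (C n) else 0)"
proof -
  define D where "D n = (if n \<in> N then C n else {})" for n
  have cover: "unit_I = (\<Union>n. D n)" and Ds: "D n \<in> sets lebesgue"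
    and ov: "m \<noteq> n \<Longrightarrow> measure lebesgue (D n \<inter> D m) = 0" for n m
    using sc by (auto simp: strongly_connected_components_def D_def split: if_splits)
  have DI: "D n \<subseteq> unit_I" for n using cover by auto
  have fm: "(\<lambda>i. f i * indicator (D n) i) \<in> borel_measurable lebesgue" for n
  proof -
    have "f \<in> borel_measurable (lebesgue_on (D n))"
      by (rule measurable_restrict_mono[OF f DI])
    then show ?thesis using Ds by (subst (asm) borel_measurable_restrict_space_iff_ennreal) auto
  qed
  have null: "D n \<inter> D m \<in> null_sets lebesgue" if "m \<noteq> n" for n m
  proof -
    have "D n \<inter> D m \<in> lmeasurable"
      by (rule bounded_set_imp_lmeasurable) (use DI Ds in \<open>auto intro: bounded_subset[OF bounded_closed_interval[of 0 1]]\<close>)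
    then show ?thesis using ov[OF that]
      by (simp add: null_sets_def fmeasurableD emeasure_eq_measure2)
  qed
  have "AE i in lebesgue. m \<noteq> n \<longrightarrow> i \<notin> D n \<inter> D m" for n m
    by (rule AE_impI) (rule AE_not_in[OF null])
  then have "AE i in lebesgue. \<forall>n m. m \<noteq> n \<longrightarrow> i \<notin> D n \<inter> D m"
    unfolding AE_all_countable by blast
  then have AE: "AE i in lebesgue. f i * indicator unit_I i = (\<Sum>n. f i * indicator (D n) i)"
  proof eventually_elim
    case (elim i)
    show ?case
    proof (cases "i \<in> unit_I")
      case True
      then obtain n where n: "i \<in> D n" using cover by blast
      then have "i \<notin> D m" if "m \<noteq> n" for m using elim that by blast
      then have "(\<Sum>n. f i * indicator (D n) i) = (\<Sum>n\<in>{n}. f i * indicator (D n) i)"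
        by (intro suminf_finite) auto
      then show ?thesis using True n by simp
    next
      case False
      then have "i \<notin> D n" for n using DI by blast
      then have "indicator (D n) i = (0 :: ennreal)" for n by simp
      then show ?thesis using False by simp
    qed
  qed
  have "(\<integral>\<^sup>+i. f i \<partial>leb_I) = (\<integral>\<^sup>+i. f i * indicator unit_I i \<partial>lebesgue)"
    by (subst nn_integral_restrict_space) auto
  also have "\<dots> = (\<integral>\<^sup>+i. (\<Sum>n. f i * indicator (D n) i) \<partial>lebesgue)" by (rule nn_integral_cong_AE[OF AE])
  also have "\<dots> = (\<Sum>n. \<integral>\<^sup>+i. f i * indicator (D n) i \<partial>lebesgue)"
    by (rule nn_integral_suminf[OF fm])
  also have "\<dots> = (\<Sum>n. \<integral>\<^sup>+i. f i \<partial>lebesgue_on (D n))"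
    using Ds by (subst nn_integral_restrict_space) auto
  also have "\<dots> = (\<Sum>n. if n \<in> N then \<integral>\<^sup>+i. f i \<partial>lebesgue_on (C n) else 0)"
    by (rule arg_cong[of _ _ suminf]) (auto simp: D_def fun_eq_iff nn_integral_restrict_space)
  finally show ?thesis .
qed

text \<open>On each component the integrals of \<open>w\<close> and of 1 agree. Summing both over
  the same partition leaves the measure of the unit interval.\<close>

lemma canonical_vector_integral:
  assumes sc: "strongly_connected_components b N C" and can: "canonical_vector b N C w0"
    and w: "w \<in> borel_measurable leb_I" "\<And>i. 0 \<le> w i" "\<And>i. w i \<le> K" and eq: "AE i in leb_I. w i = w0 i"
  shows "(\<integral>i. w i \<partial>leb_I) = 1"
proof -
  have part: "(\<integral>\<^sup>+i. ennreal (w i) \<partial>lebesgue_on (C n)) = (\<integral>\<^sup>+i. 1 \<partial>lebesgue_on (C n))" if n: "n \<in> N" for n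
  proof -
    have CI: "C n \<subseteq> unit_I" and Cs: "C n \<in> sets lebesgue"
      using sc n by (auto simp: strongly_connected_components_def)
    have Cl: "C n \<in> lmeasurable"
      by (rule bounded_set_imp_lmeasurable[OF bounded_subset[OF bounded_closed_interval CI] Cs])
    have fin: "finite_measure (lebesgue_on (C n))"
      using Cl Cs by (intro finite_measureI) (auto simp: emeasure_restrict_space fmeasurable_def)
    have wm: "w \<in> borel_measurable (lebesgue_on (C n))" "w0 \<in> borel_measurable (lebesgue_on (C n))"
      using w(1) can by (auto simp: canonical_vector_def intro: measurable_restrict_mono[OF _ CI])
    have wi: "integrable (lebesgue_on (C n)) w"
      by (rule finite_measure.integrable_const_bound[OF fin, of _ K]) (use w wm in \<open>auto intro!: AE_I2\<close>)
    have "AE i in lebesgue_on (C n). w i = w0 i"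
      by (rule AE_lebesgue_on_subset[OF eq CI]) (use Cs in auto)
    then have "(\<integral>i. w i \<partial>lebesgue_on (C n)) = (\<integral>i. w0 i \<partial>lebesgue_on (C n))"
      using wm by (intro integral_cong_AE)
    also have "\<dots> = measure lebesgue (C n)" using can n by (simp add: canonical_vector_def)
    finally have I: "(\<integral>i. w i \<partial>lebesgue_on (C n)) = measure lebesgue (C n)" .
    have "(\<integral>\<^sup>+i. ennreal (w i) \<partial>lebesgue_on (C n)) = ennreal (\<integral>i. w i \<partial>lebesgue_on (C n))"
      by (rule nn_integral_eq_integral[OF wi]) (use w(2) in simp)
    also have "\<dots> = emeasure lebesgue (C n)" unfolding I using Cl by (simp add: emeasure_eq_measure2)
    also have "\<dots> = (\<integral>\<^sup>+i. 1 \<partial>lebesgue_on (C n))"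
      using Cs by (simp add: emeasure_restrict_space)
    finally show ?thesis .
  qed
  have "(\<integral>\<^sup>+i. ennreal (w i) \<partial>leb_I) = (\<Sum>n. if n \<in> N then \<integral>\<^sup>+i. ennreal (w i) \<partial>lebesgue_on (C n) else 0)"
    by (rule nn_integral_leb_I_partition[OF sc]) (use w in simp)
  also have "\<dots> = (\<Sum>n. if n \<in> N then \<integral>\<^sup>+i. 1 \<partial>lebesgue_on (C n) else 0)"
    by (rule arg_cong[of _ _ suminf]) (use part in \<open>auto simp: fun_eq_iff\<close>)
  also have "\<dots> = (\<integral>\<^sup>+i. 1 \<partial>leb_I)"
    by (rule nn_integral_leb_I_partition[OF sc, symmetric]) simp
  also have "\<dots> = 1" using unit.emeasure_space_1 by simp
  finally have *: "(\<integral>\<^sup>+i. ennreal (w i) \<partial>leb_I) = 1" .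
  show ?thesis using w * by (subst integral_eq_nn_integral) auto
qed

section \<open>Integrals under almost everywhere bounds, and linear combinations of
  coordinates\<close>

lemma integral_AE_le:
  fixes f :: "real \<Rightarrow> real"
  assumes f: "f integrable_on {a..b}" and le: "AE s in lebesgue_on {a..b}. f s \<le> c" and "a \<le> b"
  shows "integral {a..b} f \<le> c * (b - a)"
proof -
  have "AE s in lebesgue. s \<in> {a..b} \<longrightarrow> f s \<le> c"
    using le by (subst (asm) AE_restrict_space_iff) auto
  then obtain N where N: "\<And>s. s \<in> space lebesgue - N \<Longrightarrow> s \<in> {a..b} \<longrightarrow> f s \<le> c" "N \<in> null_sets lebesgue"
    by (rule AE_E3) blast
  have neg: "negligible N" using N(2) by (simp add: negligible_iff_null_sets)
  \<comment> \<open>The gauge integral ignores negligible sets, so the exceptional values may be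
    replaced by \<open>c\<close>.\<close>
  define g where "g s = (if s \<in> N then c else f s)" for s
  have gi: "g integrable_on {a..b}" by (rule integrable_spike[OF f neg]) (simp add: g_def)
  have "integral {a..b} f = integral {a..b} g" by (rule integral_spike[OF neg]) (simp add: g_def)
  also have "\<dots> \<le> integral {a..b} (\<lambda>_. c)"
    by (rule integral_le[OF gi]) (use N(1) in \<open>auto simp: g_def\<close>)
  also have "\<dots> = c * (b - a)" using \<open>a \<le> b\<close> by simp
  finally show ?thesis .
qed

lemma integral_AE_nonneg:
  fixes f :: "real \<Rightarrow> real"
  assumes f: "f integrable_on {a..b}" and "AE s in lebesgue_on {a..b}. 0 \<le> f s" and "a \<le> b"
  shows "0 \<le> integral {a..b} f"
  using integral_AE_le[of "\<lambda>s. - f s" a b 0] assms by (simp add: integrable_neg_iff)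

lemma l2norm_linear_combination_le:
  assumes "finite S" "\<And>k. k \<in> S \<Longrightarrow> sq_integrable M (f k)"
  shows "sq_integrable M (\<lambda>i. \<Sum>k\<in>S. c k * f k i) \<and>
    l2norm M (\<lambda>i. \<Sum>k\<in>S. c k * f k i) \<le> (\<Sum>k\<in>S. \<bar>c k\<bar> * l2norm M (f k))"
  using assms
proof (induction S rule: finite_induct)
  case empty
  then show ?case by (simp add: sq_integrable_def l2norm_def)
next
  case (insert k S)
  then have IH: "sq_integrable M (\<lambda>i. \<Sum>k\<in>S. c k * f k i)"
    "l2norm M (\<lambda>i. \<Sum>k\<in>S. c k * f k i) \<le> (\<Sum>k\<in>S. \<bar>c k\<bar> * l2norm M (f k))" by auto
  have k: "sq_integrable M (\<lambda>i. c k * f k i)" using insert by (intro sq_integrable_cmult) auto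
  show ?case
    using sq_integrable_add[OF k IH(1)] l2norm_triangle[OF k IH(1)] IH(2) insert(1,2)
    by (simp add: l2norm_cmult)
qed

lemma l2norm_coordinate_le:
  assumes "\<And>k. k < d \<Longrightarrow> sq_integrable leb_I (\<lambda>i. y i k)" "k < d"
  shows "l2norm leb_I (\<lambda>i. y i k) \<le> L2_norm d y"
proof (rule power2_le_imp_le)
  show "(l2norm leb_I (\<lambda>i. y i k))\<^sup>2 \<le> (L2_norm d y)\<^sup>2"
    using L2_norm_power2[of d y, OF assms(1)]
      member_le_sum[of k "{..<d}" "\<lambda>k. (l2norm leb_I (\<lambda>i. y i k))\<^sup>2"] assms(2) by simp
qed (simp add: L2_norm_def)

lemma consensus_field_linear_combination:
  assumes \<beta>: "unit_kernel leb_I \<beta>" and y: "\<And>k. k < d \<Longrightarrow> sq_integrable leb_I (\<lambda>i. y i k)" and i: "i \<in> space leb_I"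
  shows "consensus_field leb_I \<beta> (\<lambda>i. \<Sum>k<d. c k * y i k) i = (\<Sum>k<d. c k * consensus_field leb_I \<beta> (\<lambda>i. y i k) i)"
proof -
  have I: "integrable leb_I (\<lambda>j. \<beta> (i, j) * (y j k - y i k))" if "k < d" for k
    by (rule unit.integrable_kernel_section[OF \<beta> _ i])
      (use unit.sq_integrable_integrable[OF y[OF that]] in simp)
  have "consensus_field leb_I \<beta> (\<lambda>i. \<Sum>k<d. c k * y i k) i
      = (\<integral>j. (\<Sum>k<d. c k * (\<beta> (i, j) * (y j k - y i k))) \<partial>leb_I)"
    unfolding consensus_field_def
    by (rule Bochner_Integration.integral_cong)
      (auto simp: sum_subtractf[symmetric] sum_distrib_left algebra_simps)
  also have "\<dots> = (\<Sum>k<d. c k * (\<integral>j. \<beta> (i, j) * (y j k - y i k) \<partial>leb_I))"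
    using I by (subst Bochner_Integration.integral_sum) auto
  finally show ?thesis by (simp add: consensus_field_def)
qed

subsection \<open>Exponential decay of the deviation\<close>

text \<open>The data of the theorem for fixed constants. The vector \<open>v t\<close> may be tied
  to a different family of components at every time, even within one dwell interval; only the kernel
  is known to stay the same there up to null sets.\<close>

locale switched_consensus =
  fixes \<tau> \<mu> \<nu> \<tau>d :: real and d :: nat and x0 :: "real \<Rightarrow> point" and a :: "real \<Rightarrow> kernel"
    and T :: "nat \<Rightarrow> real" and v :: "real \<Rightarrow> real \<Rightarrow> real" and x :: "real \<Rightarrow> real \<Rightarrow> point"
  assumes tau: "\<tau> > 0" and mu: "\<mu> \<in> {0<..1}" and nu: "\<nu> \<in> {0<..1}" and d: "d \<ge> 1" and taud: "\<tau>d > 0"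
    and T0: "T 0 = 0" and dwell: "\<And>k. T (Suc k) - T k \<ge> \<tau>d"
    and kernel: "\<And>k t. t \<in> {T k..<T (Suc k)} \<Longrightarrow> kernel_on_I (a t)"
    and const: "\<And>k s t. s \<in> {T k..<T (Suc k)} \<Longrightarrow> t \<in> {T k..<T (Suc k)} \<Longrightarrow>
      AE (i, j) in lebesgue_on (unit_I \<times> unit_I). a s i j = a t i j"
    and canon: "AE t in lebesgue_on {0..}. \<exists>N C.
      strongly_connected_components (a t) N C \<and> canonical_vector (a t) N C (v t)"
    and rate: "2 / (\<mu> * \<nu>\<^sup>2) * ln (1 / \<nu>) < \<tau>d"
    and conn: "\<And>t. t \<ge> 0 \<Longrightarrow> (1 / \<tau>) * (LINT s|lebesgue_on {t..t + \<tau>}. algebraic_connectivity d (a s) (v s)) \<ge> \<mu>"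
    and vb: "\<And>t. t \<ge> 0 \<Longrightarrow> AE i in leb_I. \<nu> \<le> v t i \<and> v t i \<le> 1 / \<nu>"
    and sol: "consensus_solution d a x0 x"
begin

section \<open>Switching times and the data of a single dwell interval\<close>

lemma nu_pos: "\<nu> > 0" and mu_pos: "\<mu> > 0" and nu_le: "\<nu> \<le> 1 / \<nu>"
  using nu mu mult_le_one[of \<nu> \<nu>] by (auto simp: field_simps)

lemma T_less: "T k < T (Suc k)"
  using dwell[of k] taud by linarith

lemma T_mono: "m \<le> n \<Longrightarrow> T m \<le> T n"
  using lift_Suc_mono_le[of T] T_less by (simp add: less_imp_le)

lemma T_ge: "real k * \<tau>d \<le> T k"
proof (induction k)
  case (Suc k)
  then show ?case using dwell[of k] by (simp add: algebra_simps)
qed (simp add: T0)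

lemma T_nonneg: "0 \<le> T k"
  using T_mono[of 0 k] T0 by simp

definition index :: "real \<Rightarrow> nat" where
  "index t = (LEAST k. t < T (Suc k))"

lemma index_eq: "t \<in> {T k..<T (Suc k)} \<Longrightarrow> index t = k"
  unfolding index_def
proof (rule Least_equality)
  fix j assume t: "t \<in> {T k..<T (Suc k)}" "t < T (Suc j)"
  show "k \<le> j"
  proof (rule ccontr)
    assume "\<not> k \<le> j"
    then have "T (Suc j) \<le> T k" by (intro T_mono) simp
    then show False using t by simp
  qed
qed simp

text \<open>The dwell time makes the switching times tend to infinity, so the least number in the
  definition of \<open>index\<close> exists.\<close>

lemma index_interval:
  assumes "t \<ge> 0"
  shows "t \<in> {T (index t)..<T (Suc (index t))}"
proof -
  obtain n where n: "t / \<tau>d < real n" using reals_Archimedean2 by blast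
  then have "t < real n * \<tau>d" using taud by (simp add: pos_divide_less_eq)
  also have "\<dots> \<le> T n" by (rule T_ge)
  also have "\<dots> \<le> T (Suc n)" by (rule T_mono) simp
  finally have up: "t < T (Suc (index t))" unfolding index_def by (rule LeastI)
  have "T (index t) \<le> t"
  proof (cases "index t")
    case (Suc m)
    then have "\<not> t < T (Suc m)" unfolding index_def by (intro not_less_Least) simp
    then show ?thesis using Suc by simp
  qed (use T0 assms in simp)
  with up show ?thesis by simp
qed

text \<open>Chosen from the kernel at the left endpoint, which belongs to the half-open dwell
  interval; it then represents the kernel at every time of that interval.\<close>

definition rep :: "nat \<Rightarrow> real \<times> real \<Rightarrow> real" where
  "rep k = (SOME \<beta>. \<forall>b'. (AE (i, j) in lebesgue_on (unit_I \<times> unit_I). a (T k) i j = b' i j) \<longrightarrow> represents \<beta> b')"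

lemma rep_represents:
  assumes "t \<in> {T k..<T (Suc k)}"
  shows "represents (rep k) (a t)"
proof -
  have Tk: "T k \<in> {T k..<T (Suc k)}" using T_less by simp
  have "\<forall>b'. (AE (i, j) in lebesgue_on (unit_I \<times> unit_I). a (T k) i j = b' i j) \<longrightarrow> represents (rep k) b'"
    unfolding rep_def by (rule someI_ex[OF kernel_on_I_represented[OF kernel[OF Tk]]])
  then show ?thesis using const[OF Tk assms] by blast
qed

lemma rep_unit_kernel: "unit_kernel leb_I (rep k)"
  using rep_represents[of "T k" k] T_less by (simp add: represents_def)

definition kern :: "real \<Rightarrow> real \<times> real \<Rightarrow> real" where
  "kern t = rep (index t)"

lemma kern_represents: "t \<ge> 0 \<Longrightarrow> represents (kern t) (a t)"
  unfolding kern_def by (rule rep_represents[OF index_interval])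

definition regular :: "real \<Rightarrow> bool" where
  "regular t \<longleftrightarrow> (\<exists>N C. strongly_connected_components (a t) N C \<and> canonical_vector (a t) N C (v t))"

text \<open>The truncation agrees with \<open>v t\<close> almost everywhere for each t \<ge> 0, and
  its bounds hold at every point, as the estimates for bounded weights require.\<close>

definition weight :: "real \<Rightarrow> real \<Rightarrow> real" where
  "weight t i = max \<nu> (min (1 / \<nu>) (v t i))"

definition gap_at :: "real \<Rightarrow> real" where
  "gap_at t = algebraic_connectivity d (a t) (v t)"

lemma weight_bounds: "\<nu> \<le> weight t i" "weight t i \<le> 1 / \<nu>" "0 \<le> weight t i" "\<bar>weight t i\<bar> \<le> 1 / \<nu>"
  using nu_le nu_pos by (auto simp: weight_def)

lemma regular_weight:
  assumes t: "t \<in> {T k..<T (Suc k)}" and reg: "regular t"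
  shows "weight t \<in> borel_measurable leb_I" "balanced leb_I (rep k) (weight t)"
    "(\<integral>i. weight t i \<partial>leb_I) = 1" "gap_at t = rayleigh_inf d (rep k) (weight t)"
    "spectral_gap leb_I (rep k) (weight t) (gap_at t)" "0 \<le> gap_at t"
proof -
  obtain N C where NC: "strongly_connected_components (a t) N C" "canonical_vector (a t) N C (v t)"
    using reg by (auto simp: regular_def)
  have t0: "t \<ge> 0" using T_nonneg[of k] t by simp
  have [measurable]: "v t \<in> borel_measurable leb_I" using NC(2) by (simp add: canonical_vector_def)
  show m: "weight t \<in> borel_measurable leb_I" unfolding weight_def[abs_def] by measurable
  have eq: "AE i in leb_I. weight t i = v t i"
    using vb[OF t0] by eventually_elim (simp add: weight_def)
  show bal: "balanced leb_I (rep k) (weight t)"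
    by (rule canonical_vector_balanced[OF rep_represents[OF t] NC(2) m eq weight_bounds(4)])
  show "(\<integral>i. weight t i \<partial>leb_I) = 1"
    by (rule canonical_vector_integral[OF NC m weight_bounds(3,2) eq])
  show g: "gap_at t = rayleigh_inf d (rep k) (weight t)"
    unfolding gap_at_def by (rule algebraic_connectivity_eq[OF rep_represents[OF t] m weight_bounds(4) eq])
  show "spectral_gap leb_I (rep k) (weight t) (gap_at t)" "0 \<le> gap_at t"
    unfolding g using rayleigh_inf_spectral_gap[OF rep_unit_kernel bal weight_bounds(3,2) d] .
qed

lemma AE_regular: "b \<ge> 0 \<Longrightarrow> A \<subseteq> {b..} \<Longrightarrow> A \<in> sets lebesgue \<Longrightarrow> AE t in lebesgue_on A. regular t"
  using canon unfolding regular_def[symmetric] by (rule AE_lebesgue_on_subset) auto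

text \<open>A dwell interval has positive length, so a property of almost every time occurs in
  it.\<close>

lemma ex_regular: "\<exists>t\<in>{T k..<T (Suc k)}. regular t"
proof (rule ccontr)
  assume no: "\<not> (\<exists>t\<in>{T k..<T (Suc k)}. regular t)"
  have "AE t in lebesgue_on {T k..<T (Suc k)}. regular t"
    by (rule AE_regular[OF T_nonneg[of k]]) auto
  moreover have "AE t in lebesgue_on {T k..<T (Suc k)}. t \<in> {T k..<T (Suc k)}" by (rule AE_I2) simp
  ultimately have "AE t in lebesgue_on {T k..<T (Suc k)}. False"
    by eventually_elim (use no in blast)
  then obtain N where "\<And>s. s \<in> space (lebesgue_on {T k..<T (Suc k)}) - N \<Longrightarrow> False"
    and N: "N \<in> null_sets (lebesgue_on {T k..<T (Suc k)})" by (rule AE_E3) blast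
  then have "{T k..<T (Suc k)} \<subseteq> N" by force
  then have "emeasure (lebesgue_on {T k..<T (Suc k)}) {T k..<T (Suc k)} \<le> emeasure (lebesgue_on {T k..<T (Suc k)}) N"
    by (rule emeasure_mono) (use N in auto)
  then show False using T_less[of k] unfolding null_setsD1[OF N] by (simp add: emeasure_restrict_space)
qed

text \<open>If some regular time of the interval has a positive gap, its weight is the only
  candidate and all regular times share its gap. Otherwise no gap exceeds 0 and any regular time
  serves. Either way one weight realises the largest gap for the whole interval.\<close>

lemma interval_weight:
  obtains w l where "w \<in> borel_measurable leb_I" "\<And>i. \<nu> \<le> w i" "\<And>i. w i \<le> 1 / \<nu>" "(\<integral>i. w i \<partial>leb_I) = 1"
    "0 \<le> l" "balanced leb_I (rep k) w" "spectral_gap leb_I (rep k) w l"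
    "\<And>t. t \<in> {T k..<T (Suc k)} \<Longrightarrow> regular t \<Longrightarrow> gap_at t \<le> l"
proof -
  let ?J = "{T k..<T (Suc k)}"
  have "\<exists>s\<in>?J. regular s \<and> (\<forall>t\<in>?J. regular t \<longrightarrow> gap_at t \<le> gap_at s)"
  proof (cases "\<exists>s\<in>?J. regular s \<and> gap_at s > 0")
    case True
    then obtain s where s: "s \<in> ?J" "regular s" "gap_at s > 0" by blast
    have "gap_at t \<le> gap_at s" if t: "t \<in> ?J" "regular t" for t
    proof -
      note rs = regular_weight[OF s(1,2)] and rt = regular_weight[OF t]
      have gap: "gap_at s * (l2norm leb_I y)\<^sup>2
          \<le> - (\<integral>i. weight s i * (consensus_field leb_I (rep k) y i * y i) \<partial>leb_I)"
        if "sq_integrable leb_I y" "(\<integral>i. y i \<partial>leb_I) = 0" for y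
        using rs(5) that unfolding spectral_gap_def by blast
      have "AE i in leb_I. weight t i = weight s i"
        by (rule unit.balanced_unique[OF rep_unit_kernel rs(2) rt(2) weight_bounds(1,2) nu_pos
              weight_bounds(4) rs(3) rt(3) gap s(3)])
      from rayleigh_inf_cong[OF rt(1) rs(1) this rep_unit_kernel] show ?thesis
        unfolding rt(4) rs(4) by simp
    qed
    then show ?thesis using s(1,2) by blast
  next
    case False
    obtain s where s: "s \<in> ?J" "regular s" using ex_regular by blast
    have "gap_at t \<le> gap_at s" if "t \<in> ?J" "regular t" for t
    proof -
      have "gap_at t \<le> 0" using False that not_le_imp_less by blast
      then show ?thesis using regular_weight(6)[OF s] by linarith
    qed
    then show ?thesis using s by blast
  qed
  then obtain s where s: "s \<in> ?J" "regular s" "\<And>t. t \<in> ?J \<Longrightarrow> regular t \<Longrightarrow> gap_at t \<le> gap_at s" by blast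
  note rs = regular_weight[OF s(1,2)]
  show ?thesis by (rule that[OF rs(1) weight_bounds(1,2) rs(3,6,2,5) s(3)])
qed

text \<open>Integrability comes from the averaged bound itself: the Bochner integral of a
  non-integrable function is 0, whereas here the integral is at least \<mu> \<tau> > 0.\<close>

lemma gap_integrable_window: "t \<ge> 0 \<Longrightarrow> gap_at integrable_on {t..t + \<tau>} \<and> integral {t..t + \<tau>} gap_at \<ge> \<mu> * \<tau>"
proof -
  assume t: "t \<ge> 0"
  have "\<mu> * \<tau> \<le> (LINT s|lebesgue_on {t..t + \<tau>}. gap_at s)"
    using conn[OF t] tau by (simp add: gap_at_def field_simps)
  moreover have "\<mu> * \<tau> > 0" using mu tau by simp
  ultimately have "integrable (lebesgue_on {t..t + \<tau>}) gap_at"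
    using not_integrable_integral_eq by fastforce
  then show ?thesis
    using \<open>\<mu> * \<tau> \<le> _\<close> lebesgue_integral_eq_integral[of "{t..t + \<tau>}" gap_at] integrable_on_lebesgue_on[of "{t..t + \<tau>}" gap_at]
    by simp
qed

text \<open>Consecutive windows are glued together, which also carries integrability over to bounded
  intervals.\<close>

lemma gap_integrable_multiple: "gap_at integrable_on {0..real n * \<tau>} \<and> integral {0..real n * \<tau>} gap_at \<ge> real n * \<mu> * \<tau>"
proof (induction n)
  case (Suc n)
  have le: "0 \<le> real n * \<tau>" "real n * \<tau> \<le> real n * \<tau> + \<tau>" using tau by auto
  note w = gap_integrable_window[OF le(1)]
  have "gap_at integrable_on {0..real n * \<tau> + \<tau>}"
    by (rule Henstock_Kurzweil_Integration.integrable_combine[OF le]) (use Suc w in auto)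
  moreover from Henstock_Kurzweil_Integration.integral_combine[OF le this]
  have "integral {0..real n * \<tau> + \<tau>} gap_at = integral {0..real n * \<tau>} gap_at + integral {real n * \<tau>..real n * \<tau> + \<tau>} gap_at"
    by simp
  ultimately show ?case using Suc w by (simp add: algebra_simps)
qed (use integrable_on_refl[of gap_at "0::real"] in simp)

lemma gap_integrable: "0 \<le> s \<Longrightarrow> gap_at integrable_on {s..t}"
proof -
  assume s: "0 \<le> s"
  obtain n where "t / \<tau> < real n" using reals_Archimedean2 by blast
  then have "t \<le> real n * \<tau>" using tau by (simp add: pos_divide_less_eq)
  then show ?thesis
    by (intro integrable_on_subinterval[OF conjunct1[OF gap_integrable_multiple[of n]]]) (use s in auto)
qed

lemma gap_nonneg: "0 \<le> s \<Longrightarrow> AE t in lebesgue_on {s..b}. 0 \<le> gap_at t"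
proof -
  assume s: "0 \<le> s"
  have "AE t in lebesgue_on {s..b}. regular t" by (rule AE_regular[OF s]) auto
  moreover have "AE t in lebesgue_on {s..b}. t \<in> {s..b}" by (rule AE_I2) simp
  ultimately show ?thesis
    by eventually_elim (use s regular_weight(6)[OF index_interval] in auto)
qed

text \<open>Each whole window before \<open>t\<close> contributes at least \<mu> \<tau> and the rest
  is nonnegative, so the incomplete window loses at most \<mu> \<tau>.\<close>

lemma gap_integral_ge:
  assumes "t \<ge> 0" shows "\<mu> * (t - \<tau>) \<le> integral {0..t} gap_at"
proof -
  define n where "n = nat \<lfloor>t / \<tau>\<rfloor>"
  have n: "real n \<le> t / \<tau>" "t / \<tau> < real n + 1"
    using assms tau by (auto simp: n_def)
  have nt: "real n * \<tau> \<le> t" "t < real n * \<tau> + \<tau>" using n tau by (auto simp: field_simps)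
  have n0: "0 \<le> real n * \<tau>" using tau by simp
  have "integral {0..t} gap_at = integral {0..real n * \<tau>} gap_at + integral {real n * \<tau>..t} gap_at"
    using Henstock_Kurzweil_Integration.integral_combine[OF n0 nt(1) gap_integrable] by simp
  moreover have "0 \<le> integral {real n * \<tau>..t} gap_at"
    by (rule integral_AE_nonneg[OF gap_integrable[OF n0] gap_nonneg[OF n0] nt(1)])
  moreover have "\<mu> * (t - \<tau>) \<le> \<mu> * (real n * \<tau>)" using nt mu by (intro mult_left_mono) auto
  ultimately show ?thesis using gap_integrable_multiple[of n] by (simp add: mult_ac)
qed

section \<open>Decay over successive dwell intervals\<close>

lemma interval_decay:
  assumes u: "l2_solution leb_I kern u" and t: "t \<in> {T k..T (Suc k)}"
  shows "(unit.deviation (u t))\<^sup>2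
    \<le> (1 / \<nu>\<^sup>2) * exp (- 2 * \<nu> * integral {T k..t} gap_at) * (unit.deviation (u (T k)))\<^sup>2"
proof -
  obtain w l where w: "w \<in> borel_measurable leb_I" "\<And>i. \<nu> \<le> w i" "\<And>i. w i \<le> 1 / \<nu>" "(\<integral>i. w i \<partial>leb_I) = 1"
    and l: "0 \<le> l" "balanced leb_I (rep k) w" "spectral_gap leb_I (rep k) w l"
    "\<And>t. t \<in> {T k..<T (Suc k)} \<Longrightarrow> regular t \<Longrightarrow> gap_at t \<le> l"
    by (rule interval_weight[of k], rule that)
  \<comment> \<open>The right endpoint already belongs to the next dwell interval, but a single time
    is null. The estimate thus reaches the switching time, where the next one starts.\<close>
  have "AE s in lebesgue. s \<noteq> T (Suc k)" by (rule AE_completion[OF AE_lborel_singleton])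
  then have "AE s in lebesgue. s \<in> {T k..t} \<longrightarrow> s \<noteq> T (Suc k)" by eventually_elim simp
  then have "AE s in lebesgue_on {T k..t}. s \<noteq> T (Suc k)" by (subst AE_restrict_space_iff) auto
  moreover have "AE s in lebesgue_on {T k..t}. s \<in> {T k..t}" by (rule AE_I2) simp
  ultimately have J: "AE s in lebesgue_on {T k..t}. s \<in> {T k..<T (Suc k)}"
    by eventually_elim (use t in auto)
  have "AE s in lebesgue_on {T k..t}. balanced leb_I (kern s) w \<and> spectral_gap leb_I (kern s) w l"
    using J by eventually_elim (use l in \<open>auto simp: kern_def index_eq\<close>)
  from unit.deviation_decay[OF u T_nonneg _ w(1-3) nu_pos w(4) l(1) this]
  have "(unit.deviation (u t))\<^sup>2 \<le> (1 / \<nu>\<^sup>2) * exp (- 2 * \<nu> * l * (t - T k)) * (unit.deviation (u (T k)))\<^sup>2"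
    using t by simp
  also have "\<dots> \<le> (1 / \<nu>\<^sup>2) * exp (- 2 * \<nu> * integral {T k..t} gap_at) * (unit.deviation (u (T k)))\<^sup>2"
  proof -
    \<comment> \<open>The gap at regular times is at most \<open>l\<close>, so decay with the
      constant rate is at least as strong as the bound with the integral, and only the latter is
      additive across switches.\<close>
    have "AE s in lebesgue_on {T k..t}. regular s" by (rule AE_regular[OF T_nonneg[of k]]) auto
    with J have "AE s in lebesgue_on {T k..t}. gap_at s \<le> l" by eventually_elim (rule l(4))
    then have "integral {T k..t} gap_at \<le> l * (t - T k)"
      by (rule integral_AE_le[OF gap_integrable[OF T_nonneg]]) (use t in simp)
    then have "2 * \<nu> * integral {T k..t} gap_at \<le> 2 * \<nu> * (l * (t - T k))"
      using nu_pos by (intro mult_left_mono) auto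
    then show ?thesis by (intro mult_right_mono mult_left_mono) auto
  qed
  finally show ?thesis .
qed

text \<open>There are \<open>k\<close> completed dwell intervals and one in progress, hence
  \<open>Suc k\<close> factors.\<close>

lemma iterated_decay:
  assumes u: "l2_solution leb_I kern u" and t: "t \<in> {T k..T (Suc k)}"
  shows "(unit.deviation (u t))\<^sup>2
    \<le> (1 / \<nu>\<^sup>2) ^ Suc k * exp (- 2 * \<nu> * integral {0..t} gap_at) * (unit.deviation (u 0))\<^sup>2"
  using t
proof (induction k arbitrary: t)
  case 0
  then show ?case using interval_decay[OF u, of t 0] T0 by simp
next
  case (Suc k)
  let ?S = "T (Suc k)"
  let ?e = "\<lambda>s t. exp (- 2 * \<nu> * integral {s..t} gap_at)"
  have "integral {0..t} gap_at = integral {0..?S} gap_at + integral {?S..t} gap_at"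
    using Henstock_Kurzweil_Integration.integral_combine[of 0 ?S t gap_at] gap_integrable[of 0 t] T_nonneg[of "Suc k"] Suc.prems
    by simp
  then have E: "?e 0 t = ?e ?S t * ?e 0 ?S" by (simp add: exp_add[symmetric] algebra_simps)
  have IH: "(unit.deviation (u ?S))\<^sup>2 \<le> (1 / \<nu>\<^sup>2) ^ Suc k * ?e 0 ?S * (unit.deviation (u 0))\<^sup>2"
    by (rule Suc.IH) (use T_less[of k] in simp)
  have "(unit.deviation (u t))\<^sup>2 \<le> (1 / \<nu>\<^sup>2) * ?e ?S t * (unit.deviation (u ?S))\<^sup>2"
    by (rule interval_decay[OF u Suc.prems])
  also have "\<dots> \<le> (1 / \<nu>\<^sup>2) * ?e ?S t * ((1 / \<nu>\<^sup>2) ^ Suc k * ?e 0 ?S * (unit.deviation (u 0))\<^sup>2)"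
    by (intro mult_left_mono IH) auto
  also have "\<dots> = (1 / \<nu>\<^sup>2) ^ Suc (Suc k) * ?e 0 t * (unit.deviation (u 0))\<^sup>2"
  proof -
    have "p * e * (q * f * z) = (p * q) * (e * f) * z" for p e q f z :: real by simp
    then show ?thesis unfolding E power_Suc[of _ "Suc k"] .
  qed
  finally show ?case .
qed

text \<open>Half the exponent of the squared deviation: decay 2 \<nu> \<mu> per unit of time against
  a cost of 2 ln (1 / \<nu>) per dwell time.\<close>

definition rho :: real where
  "rho = \<mu> * \<nu> - ln (1 / \<nu>) / \<tau>d"

lemma ln_nu_nonneg: "0 \<le> ln (1 / \<nu>)"
  using nu by (simp add: ln_div)

text \<open>The dwell-time hypothesis makes ln (1 / \<nu>) / \<tau>d smaller than \<mu> \<nu>^2 / 2,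
  which is at most \<mu> \<nu> / 2. The lower bound \<mu> \<nu> / 2 is the one that keeps \<tau>d
  out of the final constant.\<close>

lemma rho_ge: "\<mu> * \<nu>\<^sup>2 - 2 / \<tau>d * ln (1 / \<nu>) \<le> rho" "\<mu> * \<nu> / 2 \<le> rho" "rho > 0"
proof -
  have "\<mu> * \<nu>\<^sup>2 > 0" using nu mu by simp
  then have "2 * ln (1 / \<nu>) < \<tau>d * (\<mu> * \<nu>\<^sup>2)" using rate by (simp add: field_simps)
  then have L: "ln (1 / \<nu>) / \<tau>d < \<mu> * \<nu>\<^sup>2 / 2" using taud by (simp add: field_simps)
  have "\<nu>\<^sup>2 \<le> \<nu>" using nu by (simp add: power2_eq_square mult_left_le)
  then have sq: "\<mu> * \<nu>\<^sup>2 \<le> \<mu> * \<nu>" using mu by (intro mult_left_mono) auto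
  have nn: "0 \<le> ln (1 / \<nu>) / \<tau>d" using ln_nu_nonneg taud by simp
  have "2 / \<tau>d * ln (1 / \<nu>) = 2 * (ln (1 / \<nu>) / \<tau>d)" by simp
  then show "\<mu> * \<nu>\<^sup>2 - 2 / \<tau>d * ln (1 / \<nu>) \<le> rho" using sq nn unfolding rho_def by linarith
  show "\<mu> * \<nu> / 2 \<le> rho" using sq L unfolding rho_def by linarith
  moreover have "\<mu> * \<nu> > 0" using nu mu by simp
  ultimately show "rho > 0" by linarith
qed

text \<open>At most t / \<tau>d dwell intervals are completed, and the gap integral is at least
  \<mu> (t - \<tau>). The interval in progress leaves the factor 1 / \<nu>, the lost window the
  factor exp (\<nu> \<mu> \<tau>).\<close>

lemma deviation_exponential_decay:
  assumes u: "l2_solution leb_I kern u" and t: "t \<ge> 0"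
  shows "unit.deviation (u t) \<le> exp (\<nu> * \<mu> * \<tau>) / \<nu> * unit.deviation (u 0) * exp (- rho * t)"
proof (rule power2_le_imp_le)
  define k where "k = index t"
  have tk: "t \<in> {T k..T (Suc k)}" using index_interval[OF t] by (simp add: k_def)
  let ?L = "ln (1 / \<nu>)"
  have "real k * \<tau>d \<le> t" using T_ge[of k] tk by simp
  then have "real k \<le> t / \<tau>d" using taud by (simp add: pos_le_divide_eq)
  then have kL: "real k * ?L \<le> t / \<tau>d * ?L" using ln_nu_nonneg by (rule mult_right_mono)
  have "1 / \<nu> = exp ?L" using nu_pos by simp
  then have "(1 / \<nu>\<^sup>2) ^ Suc k = exp ?L ^ (2 * Suc k)"
    by (simp only: power_mult power_one_over[symmetric])
  also have "\<dots> = exp (2 * (real k + 1) * ?L)"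
    by (simp only: exp_of_nat_mult[symmetric]) (simp add: algebra_simps)
  finally have P: "(1 / \<nu>\<^sup>2) ^ Suc k = exp (2 * (real k + 1) * ?L)" .
  have "\<nu> * (\<mu> * (t - \<tau>)) \<le> \<nu> * integral {0..t} gap_at"
    using nu_pos gap_integral_ge[OF t] by (intro mult_left_mono) auto
  then have ex: "2 * (real k + 1) * ?L - 2 * \<nu> * integral {0..t} gap_at
      \<le> 2 * (\<nu> * \<mu> * \<tau> + ?L - rho * t)"
  proof -
    have "rho * t = \<nu> * \<mu> * t - t / \<tau>d * ?L" by (simp add: rho_def algebra_simps)
    moreover have "2 * (real k + 1) * ?L = 2 * (real k * ?L) + 2 * ?L" by (simp add: algebra_simps)
    moreover have "\<nu> * (\<mu> * (t - \<tau>)) = \<nu> * \<mu> * t - \<nu> * \<mu> * \<tau>" by (simp add: algebra_simps)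
    moreover have "2 * \<nu> * integral {0..t} gap_at = 2 * (\<nu> * integral {0..t} gap_at)" by simp
    ultimately show ?thesis using kL \<open>\<nu> * (\<mu> * (t - \<tau>)) \<le> _\<close> by argo
  qed
  have "(unit.deviation (u t))\<^sup>2 \<le> exp (2 * (real k + 1) * ?L) * exp (- 2 * \<nu> * integral {0..t} gap_at) * (unit.deviation (u 0))\<^sup>2"
    using iterated_decay[OF u tk] unfolding P .
  also have "\<dots> = exp (2 * (real k + 1) * ?L - 2 * \<nu> * integral {0..t} gap_at) * (unit.deviation (u 0))\<^sup>2"
    by (simp add: exp_add[symmetric])
  also have "\<dots> \<le> exp (2 * (\<nu> * \<mu> * \<tau> + ?L - rho * t)) * (unit.deviation (u 0))\<^sup>2"
    using ex by (intro mult_right_mono) auto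
  also have "exp (2 * (\<nu> * \<mu> * \<tau> + ?L - rho * t)) = (exp (\<nu> * \<mu> * \<tau>) / \<nu> * exp (- rho * t))\<^sup>2"
  proof -
    have "exp (\<nu> * \<mu> * \<tau> + ?L - rho * t) = exp (\<nu> * \<mu> * \<tau>) * exp ?L * exp (- rho * t)"
      by (simp add: exp_add[symmetric])
    also have "exp ?L = 1 / \<nu>" using nu_pos by simp
    finally show ?thesis unfolding exp_double by simp
  qed
  finally show "(unit.deviation (u t))\<^sup>2 \<le> (exp (\<nu> * \<mu> * \<tau>) / \<nu> * unit.deviation (u 0) * exp (- rho * t))\<^sup>2"
    by (simp only: power_mult_distrib mult_ac)
next
  show "0 \<le> exp (\<nu> * \<mu> * \<tau>) / \<nu> * unit.deviation (u 0) * exp (- rho * t)"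
    using nu_pos by simp
qed

end

subsection \<open>Separation from the closed convex hull\<close>

lemma continuous_on_sq_distance:
  fixes p :: point
  shows "continuous_on S (\<lambda>z :: point. \<Sum>k<d. (z k - p k)\<^sup>2)"
  by (intro continuous_intros continuous_on_product_then_coordinatewise[OF continuous_on_id])

text \<open>By Lindelof, the open sets avoided by almost all values of \<open>x0\<close> have a
  countable subfamily with the same union, which is therefore avoided too. Values outside this union
  are essential.\<close>

lemma AE_in_essential_range:
  assumes x0: "x0 \<in> L2_space d"
  shows "AE i in leb_I. x0 i \<in> essential_range d x0"
proof -
  define F where "F = {U :: point set. open U \<and> (AE i in leb_I. x0 i \<notin> U)}"
  obtain F' where F': "F' \<subseteq> F" "countable F'" "\<Union>F' = \<Union>F"
    using Lindelof[of F] by (auto simp: F_def)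
  have "AE i in leb_I. \<forall>U\<in>F'. x0 i \<notin> U"
    unfolding AE_ball_countable[OF F'(2)] using F'(1) by (auto simp: F_def)
  moreover have "AE i in leb_I. i \<in> space leb_I" by (rule AE_space)
  ultimately show ?thesis
  proof eventually_elim
    case (elim i)
    then have nF: "x0 i \<notin> \<Union>F" using F'(3) by blast
    have top: "x0 i \<in> topspace (Euclidean_space d)" using x0 elim by (simp add: L2_space_def)
    have "\<not> (AE j in leb_I. L2_set (\<lambda>k. x0 j k - x0 i k) {..<d} \<ge> r)" if r: "r > 0" for r
    proof
      assume ae: "AE j in leb_I. L2_set (\<lambda>k. x0 j k - x0 i k) {..<d} \<ge> r"
      \<comment> \<open>A ball in the first \<open>d\<close> coordinates; as a strict inequality on
        finitely many coordinates it is open in the product topology.\<close>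
      define U where "U = {w :: point. (\<Sum>k<d. (w k - x0 i k)\<^sup>2) < r\<^sup>2}"
      have "open U" unfolding U_def by (intro open_Collect_less continuous_on_sq_distance continuous_on_const)
      moreover have "AE j in leb_I. x0 j \<notin> U"
        using ae
      proof eventually_elim
        case (elim j)
        then have "r\<^sup>2 \<le> (L2_set (\<lambda>k. x0 j k - x0 i k) {..<d})\<^sup>2" using r by (intro power_mono) auto
        then show ?case by (simp add: U_def L2_set_def sum_nonneg)
      qed
      ultimately have "U \<in> F" by (simp add: F_def)
      moreover have "x0 i \<in> U" using r by (simp add: U_def)
      ultimately show False using nF by blast
    qed
    with top show ?case by (simp add: essential_range_def)
  qed
qed

lemma point_convex_hull_superset: "S \<subseteq> point_convex_hull S"
proof
  fix p assume "p \<in> S"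
  then show "p \<in> point_convex_hull S"
    unfolding point_convex_hull_def by (intro CollectI exI[of _ "{p}"] exI[of _ "\<lambda>_. 1"]) auto
qed

text \<open>Both families of coefficients are extended by 0 to the union of the two finite sets,
  where they can be combined.\<close>

lemma point_convex_hull_segment:
  assumes z: "z \<in> point_convex_hull S" and w: "w \<in> point_convex_hull S" and \<theta>: "0 \<le> \<theta>" "\<theta> \<le> 1"
  shows "(\<lambda>k. (1 - \<theta>) * z k + \<theta> * w k) \<in> point_convex_hull S"
proof -
  obtain F u where F: "finite F" "F \<subseteq> S" "\<forall>p\<in>F. 0 \<le> u p" "(\<Sum>p\<in>F. u p) = 1" "z = (\<lambda>k. \<Sum>p\<in>F. u p * p k)"
    using z unfolding point_convex_hull_def by blast
  obtain G v where G: "finite G" "G \<subseteq> S" "\<forall>p\<in>G. 0 \<le> v p" "(\<Sum>p\<in>G. v p) = 1" "w = (\<lambda>k. \<Sum>p\<in>G. v p * p k)"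
    using w unfolding point_convex_hull_def by blast
  define u' where "u' p = (if p \<in> F then u p else 0)" for p
  define v' where "v' p = (if p \<in> G then v p else 0)" for p
  have FG: "finite (F \<union> G)" using F G by simp
  have U: "(\<Sum>p\<in>F \<union> G. u' p * g p) = (\<Sum>p\<in>F. u p * g p)" for g
    by (rule sum.mono_neutral_cong_right[OF FG]) (auto simp: u'_def)
  have V: "(\<Sum>p\<in>F \<union> G. v' p * g p) = (\<Sum>p\<in>G. v p * g p)" for g
    by (rule sum.mono_neutral_cong_right[OF FG]) (auto simp: v'_def)
  define c where "c p = (1 - \<theta>) * u' p + \<theta> * v' p" for p
  have S: "(\<Sum>p\<in>F \<union> G. c p * g p) = (1 - \<theta>) * (\<Sum>p\<in>F. u p * g p) + \<theta> * (\<Sum>p\<in>G. v p * g p)" for g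
    by (simp add: c_def distrib_right sum.distrib mult.assoc sum_distrib_left[symmetric] U V)
  show ?thesis
    unfolding point_convex_hull_def
  proof (intro CollectI exI[of _ "F \<union> G"] exI[of _ c] conjI)
    show "\<forall>p\<in>F \<union> G. 0 \<le> c p" using F(3) G(3) \<theta> by (auto simp: c_def u'_def v'_def)
    show "sum c (F \<union> G) = 1" using S[of "\<lambda>_. 1"] F(4) G(4) by simp
    show "(\<lambda>k. (1 - \<theta>) * z k + \<theta> * w k) = (\<lambda>k. \<Sum>p\<in>F \<union> G. c p * p k)"
      by (simp add: S F(5) G(5))
  qed (use F G in auto)
qed

text \<open>Tychonoff's theorem: sequences carry the product topology.\<close>

lemma compact_box_point: "compact {z :: point. \<forall>k. z k \<in> {l k..r k}}"
proof -
  have "compactin (product_topology (\<lambda>k. euclidean) UNIV) (\<Pi>\<^sub>E k\<in>UNIV. {l k..r k :: real})"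
    by (subst compactin_PiE) auto
  moreover have "(\<Pi>\<^sub>E k\<in>UNIV. {l k..r k}) = {z. \<forall>k. z k \<in> {l k..r k}}" by (auto simp: PiE_UNIV_domain)
  ultimately show ?thesis by (simp add: euclidean_product_topology)
qed

text \<open>A point outside the closed hull is cut off by the hyperplane through its nearest point.\<close>

lemma in_closed_hull_rangeI:
  assumes x0: "x0 \<in> L2_space d" and p: "p \<in> topspace (Euclidean_space d)"
    and half: "\<And>\<xi> c. (AE i in leb_I. (\<Sum>k<d. \<xi> k * x0 i k) \<le> c) \<Longrightarrow> (\<Sum>k<d. \<xi> k * p k) \<le> c"
  shows "p \<in> closed_hull_range d x0"
proof -
  define H where "H = point_convex_hull (essential_range d x0)"
  have pz: "p k = 0" if "k \<ge> d" for k using p that by (simp add: topspace_Euclidean_space)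
  have HT: "H \<subseteq> topspace (Euclidean_space d)"
    unfolding H_def point_convex_hull_def essential_range_def topspace_Euclidean_space
    by (auto intro!: sum.neutral)
  have clT: "closure H \<subseteq> topspace (Euclidean_space d)"
    using HT closedin_Euclidean_space_iff[of d "topspace (Euclidean_space d)"] closedin_topspace
    by (intro closure_minimal) auto
  \<comment> \<open>The sequences vanishing from \<open>d\<close> on form a closed set, so the
    closure in Euclidean space is the closure among all sequences.\<close>
  have K: "closed_hull_range d x0 = closure H"
  proof -
    have "closed_hull_range d x0 = topspace (Euclidean_space d) \<inter> closure H"
      using HT unfolding closed_hull_range_def H_def[symmetric] topspace_Euclidean_space
      by (simp add: Euclidean_space_def closure_of_subtopology euclidean_product_topology Int_absorb2 Int_commute)
    then show ?thesis using clT by blast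
  qed
  have Kz: "z k = 0" if "z \<in> closure H" "k \<ge> d" for z k
    using clT that by (auto simp: topspace_Euclidean_space)
  have xE: "AE i in leb_I. x0 i \<in> H"
    using AE_in_essential_range[OF x0]
    by eventually_elim (use point_convex_hull_superset in \<open>auto simp: H_def\<close>)
  have "H \<noteq> {}"
  proof
    assume "H = {}"
    then have "AE i in leb_I. False" using xE by simp
    then show False using unit.AE_False by simp
  qed
  then obtain z0 where z0: "z0 \<in> H" by blast
  define q where "q z = (\<Sum>k<d. (z k - p k)\<^sup>2)" for z :: point
  have q0: "q z \<ge> 0" for z by (simp add: q_def sum_nonneg)
  \<comment> \<open>The closed hull may be unbounded, so the minimum is sought in the sublevel set
    of one of its points. That set lies in a box: bounded in the first \<open>d\<close> coordinates
    and zero in the others.\<close>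
  define Kc where "Kc = closure H \<inter> {z. q z \<le> q z0}"
  define R where "R = sqrt (q z0)"
  have "Kc \<subseteq> {z. \<forall>k. z k \<in> {p k - R..p k + R}}"
  proof (intro subsetI CollectI allI)
    fix z k assume z: "z \<in> Kc"
    show "z k \<in> {p k - R..p k + R}"
    proof (cases "k < d")
      case True
      have "(z k - p k)\<^sup>2 \<le> q z"
        unfolding q_def using True member_le_sum[of k "{..<d}" "\<lambda>k. (z k - p k)\<^sup>2"] by simp
      also have "\<dots> \<le> q z0" using z by (simp add: Kc_def)
      finally have "\<bar>z k - p k\<bar> \<le> R" unfolding R_def by (rule real_le_rsqrt[of "\<bar>_\<bar>", simplified])
      then show ?thesis by (auto simp: abs_le_iff)
    next
      case False
      then show ?thesis using pz[of k] Kz[of z k] z q0 by (simp add: Kc_def R_def)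
    qed
  qed
  moreover have "closed Kc"
    unfolding Kc_def q_def by (intro closed_Int closed_closure closed_Collect_le continuous_on_sq_distance continuous_on_const)
  ultimately have "compact Kc"
    using compact_Int_closed[OF compact_box_point[of "\<lambda>k. p k - R" "\<lambda>k. p k + R"], of Kc]
    by (simp only: Int_absorb1)
  moreover have "z0 \<in> Kc" using z0 closure_subset[of H] by (auto simp: Kc_def)
  ultimately obtain s where s: "s \<in> Kc" "\<And>z. z \<in> Kc \<Longrightarrow> q s \<le> q z"
    using continuous_attains_inf[of Kc q] continuous_on_sq_distance[where S = Kc and d = d and p = p] unfolding q_def by blast
  have smin: "q s \<le> q z" if "z \<in> closure H" for z
  proof (cases "q z \<le> q z0")
    case False
    then show ?thesis using s(1) by (simp add: Kc_def)
  qed (use that s(2) in \<open>simp add: Kc_def\<close>)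
  have sK: "s \<in> closure H" using s(1) by (simp add: Kc_def)
  have sep: "(\<Sum>k<d. (p k - s k) * z k) \<le> (\<Sum>k<d. (p k - s k) * s k)" if z: "z \<in> H" for z
  proof -
    define A where "A = (\<Sum>k<d. (z k - s k) * (s k - p k))"
    define B where "B = (\<Sum>k<d. (z k - s k)\<^sup>2)"
    have B0: "B \<ge> 0" by (simp add: B_def sum_nonneg)
    \<comment> \<open>First variation of the squared distance along the segment from the nearest
      point \<open>s\<close> to \<open>z\<close>. As \<open>s\<close> lies only in the closure, the
      whole closure is moved by \<open>f\<close>, which preserves it by convexity and
      continuity.\<close>
    have var: "0 \<le> 2 * A + \<theta> * B" if \<theta>: "0 < \<theta>" "\<theta> \<le> 1" for \<theta>
    proof -
      define f where "f y = (\<lambda>k. (1 - \<theta>) * y k + \<theta> * z k)" for y :: point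
      have "f ` closure H \<subseteq> closure H"
      proof (rule image_closure_subset)
        show "continuous_on (closure H) f"
          unfolding f_def
          by (intro continuous_on_coordinatewise_then_product continuous_intros
              continuous_on_product_then_coordinatewise[OF continuous_on_id])
        show "f ` H \<subseteq> closure H"
          using point_convex_hull_segment[OF _ z[unfolded H_def]] \<theta> closure_subset[of H]
          by (auto simp: f_def H_def)
      qed simp
      then have "q s \<le> q (f s)" using sK by (intro smin) blast
      also have "q (f s) = (\<Sum>k<d. (s k - p k)\<^sup>2 + (2 * \<theta>) * ((z k - s k) * (s k - p k)) + \<theta>\<^sup>2 * (z k - s k)\<^sup>2)"
        unfolding q_def f_def by (rule sum.cong) (auto simp: power2_eq_square algebra_simps)
      also have "\<dots> = q s + (2 * \<theta>) * A + \<theta>\<^sup>2 * B"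
        by (simp add: sum.distrib sum_distrib_left[symmetric] A_def B_def q_def)
      finally have "0 \<le> \<theta> * (2 * A + \<theta> * B)" by (simp add: power2_eq_square algebra_simps)
      then show ?thesis using \<theta> by (simp add: zero_le_mult_iff)
    qed
    have "A \<ge> 0"
    proof (rule ccontr)
      assume "\<not> A \<ge> 0"
      \<comment> \<open>With this choice \<theta> B is at most - A, which leaves 2 A + \<theta> B
        \<le> A < 0.\<close>
      define \<theta> where "\<theta> = min 1 (- A / (B + 1))"
      have \<theta>: "0 < \<theta>" "\<theta> \<le> 1" using \<open>\<not> A \<ge> 0\<close> B0 by (auto simp: \<theta>_def divide_neg_pos)
      have "\<theta> * B \<le> (- A / (B + 1)) * B" using B0 by (intro mult_right_mono) (auto simp: \<theta>_def)
      also have "\<dots> \<le> - A" using \<open>\<not> A \<ge> 0\<close> B0 by (simp add: field_simps)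
      finally show False using var[OF \<theta>] \<open>\<not> A \<ge> 0\<close> by simp
    qed
    moreover have "A = (\<Sum>k<d. (p k - s k) * s k) - (\<Sum>k<d. (p k - s k) * z k)"
      unfolding A_def sum_subtractf[symmetric] by (rule sum.cong) (auto simp: algebra_simps)
    ultimately show ?thesis by simp
  qed
  \<comment> \<open>The half-space with normal p - s contains almost all values of \<open>x0\<close>
    and hence \<open>p\<close>, so the squared distance from \<open>p\<close> to \<open>s\<close> is
    at most 0.\<close>
  have "AE i in leb_I. (\<Sum>k<d. (p k - s k) * x0 i k) \<le> (\<Sum>k<d. (p k - s k) * s k)"
    using xE by eventually_elim (rule sep)
  then have "(\<Sum>k<d. (p k - s k) * p k) \<le> (\<Sum>k<d. (p k - s k) * s k)" by (rule half)
  moreover have "(\<Sum>k<d. (p k - s k) * p k) - (\<Sum>k<d. (p k - s k) * s k) = (\<Sum>k<d. (p k - s k)\<^sup>2)"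
    unfolding sum_subtractf[symmetric] by (rule sum.cong) (auto simp: power2_eq_square algebra_simps)
  ultimately have "(\<Sum>k<d. (p k - s k)\<^sup>2) = 0"
    using sum_nonneg[of "{..<d}" "\<lambda>k. (p k - s k)\<^sup>2"] by simp
  then have "p k = s k" if "k < d" for k
    using that by (subst (asm) sum_nonneg_eq_0_iff) auto
  moreover have "p k = s k" if "k \<ge> d" for k using pz[OF that] Kz[OF sK that] by simp
  ultimately have "p = s" by (metis ext not_le)
  then show ?thesis using sK K by simp
qed

subsection \<open>The limit\<close>

context switched_consensus
begin

lemma sol_L2: "t \<ge> 0 \<Longrightarrow> x t \<in> L2_space d"
  and sol_init: "AE i in leb_I. x 0 i = x0 i"
  using sol by (auto simp: consensus_solution_def)

text \<open>Arbitrary coefficients are needed because the maximum principle is applied to the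
  functional of every half-space. Lipschitz bound and derivative carry over since the functional is
  bounded by the sum of all |\<xi> k| times the vector norm.\<close>

lemma l2_solution_functional: "l2_solution leb_I kern (\<lambda>t i. \<Sum>k<d. \<xi> k * x t i k)"
  unfolding l2_solution_def
proof (intro conjI allI impI)
  define X where "X = (\<Sum>k<d. \<bar>\<xi> k\<bar>)"
  have X0: "X \<ge> 0" by (simp add: X_def)
  have comb: "l2norm leb_I (\<lambda>i. \<Sum>k<d. \<xi> k * y i k) \<le> X * L2_norm d y"
    if y: "\<And>k. k < d \<Longrightarrow> sq_integrable leb_I (\<lambda>i. y i k)" for y
  proof -
    have "l2norm leb_I (\<lambda>i. \<Sum>k<d. \<xi> k * y i k) \<le> (\<Sum>k<d. \<bar>\<xi> k\<bar> * l2norm leb_I (\<lambda>i. y i k))"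
      using l2norm_linear_combination_le[of "{..<d}" leb_I "\<lambda>k i. y i k" \<xi>] y by simp
    also have "\<dots> \<le> (\<Sum>k<d. \<bar>\<xi> k\<bar> * L2_norm d y)"
      by (intro sum_mono mult_left_mono l2norm_coordinate_le y) auto
    finally show ?thesis by (simp add: X_def sum_distrib_right)
  qed
  have sq: "sq_integrable leb_I (\<lambda>i. x t i k)" if "t \<ge> 0" "k < d" for t k
    by (rule sq_integrable_coordinate[OF sol_L2[OF that(1)] that(2)])
  show "sq_integrable leb_I (\<lambda>i. \<Sum>k<d. \<xi> k * x t i k)" if "t \<ge> 0" for t
    using l2norm_linear_combination_le[of "{..<d}" leb_I "\<lambda>k i. x t i k" \<xi>] sq[OF that] by simp
  show "unit_kernel leb_I (kern t)" for t
    unfolding kern_def by (rule rep_unit_kernel)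
  show "\<exists>K. \<forall>s\<in>{0..R}. \<forall>t\<in>{0..R}.
      l2norm leb_I (\<lambda>i. (\<Sum>k<d. \<xi> k * x t i k) - (\<Sum>k<d. \<xi> k * x s i k)) \<le> K * \<bar>t - s\<bar>" if R: "R \<ge> 0" for R
  proof -
    obtain K where K: "\<And>s t. s \<in> {0..R} \<Longrightarrow> t \<in> {0..R} \<Longrightarrow> L2_norm d (\<lambda>i k. x t i k - x s i k) \<le> K * \<bar>t - s\<bar>"
      using sol R unfolding consensus_solution_def by meson
    have "l2norm leb_I (\<lambda>i. (\<Sum>k<d. \<xi> k * x t i k) - (\<Sum>k<d. \<xi> k * x s i k)) \<le> (X * K) * \<bar>t - s\<bar>"
      if st: "s \<in> {0..R}" "t \<in> {0..R}" for s t
    proof -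
      have "l2norm leb_I (\<lambda>i. \<Sum>k<d. \<xi> k * (x t i k - x s i k)) \<le> X * L2_norm d (\<lambda>i k. x t i k - x s i k)"
        by (rule comb) (use st in \<open>auto intro!: sq_integrable_diff sq\<close>)
      also have "\<dots> \<le> X * (K * \<bar>t - s\<bar>)" by (intro mult_left_mono K st X0)
      finally show ?thesis by (simp add: sum_subtractf right_diff_distrib mult.assoc)
    qed
    then show ?thesis by blast
  qed
  have "AE t in lebesgue_on {0..}. ((\<lambda>h. L2_norm d (\<lambda>i k. (x (t + h) i k - x t i k) / h
      - (LINT j|leb_I. a t i j * (x t j k - x t i k)))) \<longlongrightarrow> 0) (at 0)"
    using sol by (simp add: consensus_solution_def)
  moreover have "AE t in lebesgue_on {0..}. (t::real) \<in> {0..}" by (rule AE_I2) simp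
  ultimately show "AE t in lebesgue_on {0..}. ((\<lambda>h. l2norm leb_I (\<lambda>i. ((\<Sum>k<d. \<xi> k * x (t + h) i k) - (\<Sum>k<d. \<xi> k * x t i k)) / h
      - consensus_field leb_I (kern t) (\<lambda>i. \<Sum>k<d. \<xi> k * x t i k) i)) \<longlongrightarrow> 0) (at_right 0)"
  proof eventually_elim
    case (elim t)
    then have t: "t \<ge> 0" by simp
    have \<beta>: "unit_kernel leb_I (kern t)" unfolding kern_def by (rule rep_unit_kernel)
    \<comment> \<open>\<open>y\<close> is the error for the given kernel, \<open>z\<close> the one
      for its product-measurable representative. They agree almost everywhere, and square
      integrability passes from \<open>z\<close> to \<open>y\<close>.\<close>
    define y where "y h i k = (x (t + h) i k - x t i k) / h - (LINT j|leb_I. a t i j * (x t j k - x t i k))" for h i k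
    define z where "z h i k = (x (t + h) i k - x t i k) / h - consensus_field leb_I (kern t) (\<lambda>i. x t i k) i" for h i k
    have lim: "((\<lambda>h. L2_norm d (y h)) \<longlongrightarrow> 0) (at_right 0)"
      using elim(1) unfolding y_def[abs_def] by (rule tendsto_mono[rotated]) (simp add: at_le)
    have zsq: "sq_integrable leb_I (\<lambda>i. z h i k)" if "h > 0" "k < d" for h k
    proof -
      have "sq_integrable leb_I (\<lambda>i. (1 / h) * (x (t + h) i k - x t i k) - consensus_field leb_I (kern t) (\<lambda>i. x t i k) i)"
        using that t by (intro sq_integrable_diff sq_integrable_cmult sq unit.sq_integrable_consensus_field[OF \<beta>]) auto
      then show ?thesis by (simp add: z_def)
    qed
    have zy: "AE i in leb_I. \<forall>k\<in>{..<d}. z h i k = y h i k" for h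
    proof (rule AE_finite_allI)
      fix k assume k: "k \<in> {..<d}"
      have "(\<lambda>i. x t i k) \<in> borel_measurable leb_I" using sq[OF t] k by (simp add: sq_integrable_def)
      from represents_graph_laplacian[where y = "x t", OF kern_represents[OF t] this]
      show "AE i in leb_I. z h i k = y h i k"
      proof eventually_elim
        case (elim i)
        have "(LINT j|leb_I. a t i j * (x t j k - x t i k)) = (LINT j|leb_I. - (a t i j * (x t i k - x t j k)))"
          by (rule Bochner_Integration.integral_cong) (auto simp: algebra_simps)
        then show ?case using elim by (simp add: z_def y_def graph_laplacian_def)
      qed
    qed simp
    have ysq: "sq_integrable leb_I (\<lambda>i. y h i k)" if "h > 0" "k < d" for h k
    proof (rule sq_integrable_bound[OF zsq[OF that]])
      have eq: "AE i in leb_I. z h i k = y h i k" using zy[of h] by eventually_elim (use that in auto)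
      show "(\<lambda>i. y h i k) \<in> borel_measurable leb_I"
        by (rule borel_measurable_leb_I_cong_AE[OF sq_integrableD[OF zsq[OF that]] eq])
      show "AE i in leb_I. \<bar>y h i k\<bar> \<le> \<bar>z h i k\<bar>" using eq by eventually_elim simp
    qed
    have le: "l2norm leb_I (\<lambda>i. ((\<Sum>k<d. \<xi> k * x (t + h) i k) - (\<Sum>k<d. \<xi> k * x t i k)) / h
      - consensus_field leb_I (kern t) (\<lambda>i. \<Sum>k<d. \<xi> k * x t i k) i) \<le> X * L2_norm d (y h)" if h: "h > 0" for h
    proof -
      have zc: "sq_integrable leb_I (\<lambda>i. \<Sum>k<d. \<xi> k * z h i k)"
        using l2norm_linear_combination_le[of "{..<d}" leb_I "\<lambda>k i. z h i k" \<xi>] zsq[OF h] by simp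
      have yc: "sq_integrable leb_I (\<lambda>i. \<Sum>k<d. \<xi> k * y h i k)"
        using l2norm_linear_combination_le[of "{..<d}" leb_I "\<lambda>k i. y h i k" \<xi>] ysq[OF h] by simp
      have "((\<Sum>k<d. \<xi> k * x (t + h) i k) - (\<Sum>k<d. \<xi> k * x t i k)) / h
          - consensus_field leb_I (kern t) (\<lambda>i. \<Sum>k<d. \<xi> k * x t i k) i = (\<Sum>k<d. \<xi> k * z h i k)"
        if "i \<in> space leb_I" for i
      proof -
        have "consensus_field leb_I (kern t) (\<lambda>i. \<Sum>k<d. \<xi> k * x t i k) i
            = (\<Sum>k<d. \<xi> k * consensus_field leb_I (kern t) (\<lambda>i. x t i k) i)"
          by (rule consensus_field_linear_combination[OF \<beta> sq[OF t] that])
        then show ?thesis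
          by (simp add: z_def right_diff_distrib sum_subtractf sum_divide_distrib diff_divide_distrib)
      qed
      then have "l2norm leb_I (\<lambda>i. ((\<Sum>k<d. \<xi> k * x (t + h) i k) - (\<Sum>k<d. \<xi> k * x t i k)) / h
          - consensus_field leb_I (kern t) (\<lambda>i. \<Sum>k<d. \<xi> k * x t i k) i) = l2norm leb_I (\<lambda>i. \<Sum>k<d. \<xi> k * z h i k)"
        unfolding l2norm_def by (intro arg_cong[of _ _ sqrt] Bochner_Integration.integral_cong) auto
      also have "\<dots> = l2norm leb_I (\<lambda>i. \<Sum>k<d. \<xi> k * y h i k)"
        by (rule l2norm_cong_AE[OF sq_integrableD[OF zc] sq_integrableD[OF yc]]) (use zy[of h] in \<open>eventually_elim, simp\<close>)
      also have "\<dots> \<le> X * L2_norm d (y h)" by (rule comb) (rule ysq[OF h])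
      finally show ?thesis .
    qed
    have "\<forall>\<^sub>F h::real in at_right 0. h > 0" by (rule eventually_at_right_less)
    then have "\<forall>\<^sub>F h in at_right 0. norm (l2norm leb_I (\<lambda>i. ((\<Sum>k<d. \<xi> k * x (t + h) i k) - (\<Sum>k<d. \<xi> k * x t i k)) / h
      - consensus_field leb_I (kern t) (\<lambda>i. \<Sum>k<d. \<xi> k * x t i k) i)) \<le> norm (L2_norm d (y h)) * X"
    proof eventually_elim
      case (elim h)
      have "L2_norm d (y h) \<ge> 0" by (simp add: L2_norm_def)
      then show ?case using le[OF elim] by (simp add: mult.commute)
    qed
    then show ?case by (rule tendsto_0_le[OF lim])
  qed
qed

lemma l2_solution_coordinate:
  assumes "k < d" shows "l2_solution leb_I kern (\<lambda>t i. x t i k)"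
proof -
  have "(\<Sum>l<d. (if l = k then 1 else 0) * x t i l) = x t i k" for t i
    using assms by (simp add: if_distrib[of "\<lambda>c. c * _"] cong: if_cong)
  then show ?thesis using l2_solution_functional[of "\<lambda>l. if l = k then 1 else 0"] by simp
qed

text \<open>All coordinates share the same constant \<open>A\<close>, so adding their squares
  introduces no dependence on \<open>d\<close>.\<close>

lemma consensus_convergence:
  assumes x0: "x0 \<in> L2_space d"
  shows "\<exists>xinf\<in>closed_hull_range d x0. \<forall>t\<ge>0. L2_norm d (\<lambda>i k. x t i k - xinf k)
    \<le> exp (\<nu> * \<mu> * \<tau>) / \<nu> * (1 + 4 / (\<mu> * \<nu>)) * L2_norm d (\<lambda>i k. x 0 i k - mean x0 k) * exp (- rho * t)"
proof -
  define D where "D k = unit.deviation (\<lambda>i. x 0 i k)" for k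
  define B where "B k = exp (\<nu> * \<mu> * \<tau>) / \<nu> * D k" for k
  have sq: "sq_integrable leb_I (\<lambda>i. x t i k)" if "t \<ge> 0" "k < d" for t k
    by (rule sq_integrable_coordinate[OF sol_L2[OF that(1)] that(2)])
  have dev: "unit.deviation (\<lambda>i. x t i k) \<le> B k * exp (- rho * t)" if "k < d" "t \<ge> 0" for t k
    using deviation_exponential_decay[OF l2_solution_coordinate[OF that(1)] that(2)] by (simp add: B_def D_def)
  have "\<forall>k. \<exists>m. k < d \<longrightarrow> (\<forall>t\<ge>0. \<bar>(\<integral>i. x t i k \<partial>leb_I) - m\<bar> \<le> 2 * B k / rho * exp (- rho * t))"
  proof
    fix k
    show "\<exists>m. k < d \<longrightarrow> (\<forall>t\<ge>0. \<bar>(\<integral>i. x t i k \<partial>leb_I) - m\<bar> \<le> 2 * B k / rho * exp (- rho * t))"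
    proof (cases "k < d")
      case True
      from unit.mean_converges[OF l2_solution_coordinate[OF True] dev[OF True] rho_ge(3)] show ?thesis by blast
    qed auto
  qed
  then obtain m where m: "\<And>k t. k < d \<Longrightarrow> t \<ge> 0 \<Longrightarrow>
      \<bar>(\<integral>i. x t i k \<partial>leb_I) - m k\<bar> \<le> 2 * B k / rho * exp (- rho * t)" by metis
  \<comment> \<open>Coordinates from \<open>d\<close> on are 0 by the encoding of Euclidean
    points.\<close>
  define xinf where "xinf k = (if k < d then m k else 0)" for k
  define A where "A = exp (\<nu> * \<mu> * \<tau>) / \<nu> * (1 + 4 / (\<mu> * \<nu>))"
  have A0: "A \<ge> 0" using nu_pos mu_pos by (simp add: A_def)
  have coord: "l2norm leb_I (\<lambda>i. x t i k - xinf k) \<le> A * D k * exp (- rho * t)" if k: "k < d" and t: "t \<ge> 0" for t k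
  proof -
    have dv: "sq_integrable leb_I (\<lambda>i. x t i k - (\<integral>j. x t j k \<partial>leb_I))"
      by (rule sq_integrable_diff[OF sq[OF t k] unit.sq_integrable_const])
    have "l2norm leb_I (\<lambda>i. x t i k - xinf k)
        \<le> unit.deviation (\<lambda>i. x t i k) + \<bar>(\<integral>j. x t j k \<partial>leb_I) - m k\<bar>"
      using l2norm_triangle[OF dv unit.sq_integrable_const[of "(\<integral>j. x t j k \<partial>leb_I) - m k"]] k
      by (simp add: unit.l2norm_const xinf_def)
    also have "\<dots> \<le> B k * exp (- rho * t) + 2 * B k / rho * exp (- rho * t)"
      by (intro add_mono dev m k t)
    also have "\<dots> = (1 + 2 / rho) * (B k * exp (- rho * t))" by (simp add: algebra_simps)
    \<comment> \<open>The lower bound \<mu> \<nu> / 2 of \<open>rho\<close> removes the dwell time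
      from the constant.\<close>
    also have "\<dots> \<le> (1 + 4 / (\<mu> * \<nu>)) * (B k * exp (- rho * t))"
    proof (intro mult_right_mono add_left_mono)
      have "2 / rho \<le> 2 / (\<mu> * \<nu> / 2)"
        using rho_ge(2,3) nu_pos mu_pos by (intro divide_left_mono) auto
      then show "2 / rho \<le> 4 / (\<mu> * \<nu>)" by simp
      show "0 \<le> B k * exp (- rho * t)" using nu_pos by (simp add: B_def D_def)
    qed
    finally show ?thesis by (simp add: A_def B_def mult_ac)
  qed
  have mean0: "mean x0 k = (\<integral>i. x 0 i k \<partial>leb_I)" if "k < d" for k
    unfolding mean_def
    by (rule integral_leb_I_cong_AE[symmetric])
      (use sq[of 0 k] that sol_init in \<open>auto simp: sq_integrable_def elim!: AE_mp\<close>)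
  have rate: "L2_norm d (\<lambda>i k. x t i k - xinf k) \<le> A * L2_norm d (\<lambda>i k. x 0 i k - mean x0 k) * exp (- rho * t)"
    if t: "t \<ge> 0" for t
  proof (rule power2_le_imp_le)
    have "(L2_norm d (\<lambda>i k. x t i k - xinf k))\<^sup>2 = (\<Sum>k<d. (l2norm leb_I (\<lambda>i. x t i k - xinf k))\<^sup>2)"
      by (rule L2_norm_power2) (intro sq_integrable_diff sq[OF t] unit.sq_integrable_const)
    also have "\<dots> \<le> (\<Sum>k<d. (A * exp (- rho * t))\<^sup>2 * (D k)\<^sup>2)"
    proof (rule sum_mono)
      fix k assume "k \<in> {..<d}"
      then have "l2norm leb_I (\<lambda>i. x t i k - xinf k) \<le> A * exp (- rho * t) * D k"
        using coord[of k t] t by (simp add: mult_ac)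
      then show "(l2norm leb_I (\<lambda>i. x t i k - xinf k))\<^sup>2 \<le> (A * exp (- rho * t))\<^sup>2 * (D k)\<^sup>2"
        unfolding power_mult_distrib[symmetric] by (rule power_mono) simp
    qed
    also have "\<dots> = (A * exp (- rho * t))\<^sup>2 * (\<Sum>k<d. (D k)\<^sup>2)" by (simp add: sum_distrib_left)
    also have "(\<Sum>k<d. (D k)\<^sup>2) = (L2_norm d (\<lambda>i k. x 0 i k - mean x0 k))\<^sup>2"
    proof -
      have "(L2_norm d (\<lambda>i k. x 0 i k - mean x0 k))\<^sup>2 = (\<Sum>k<d. (l2norm leb_I (\<lambda>i. x 0 i k - mean x0 k))\<^sup>2)"
        by (rule L2_norm_power2) (intro sq_integrable_diff sq[of 0] unit.sq_integrable_const order_refl)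
      also have "\<dots> = (\<Sum>k<d. (D k)\<^sup>2)" by (intro sum.cong) (auto simp: D_def mean0)
      finally show ?thesis by simp
    qed
    finally show "(L2_norm d (\<lambda>i k. x t i k - xinf k))\<^sup>2
        \<le> (A * L2_norm d (\<lambda>i k. x 0 i k - mean x0 k) * exp (- rho * t))\<^sup>2"
      by (simp only: power_mult_distrib mult_ac)
  next
    show "0 \<le> A * L2_norm d (\<lambda>i k. x 0 i k - mean x0 k) * exp (- rho * t)"
      using A0 by (simp add: L2_norm_def)
  qed
  have "xinf \<in> closed_hull_range d x0"
  proof (rule in_closed_hull_rangeI[OF x0])
    show "xinf \<in> topspace (Euclidean_space d)" by (simp add: topspace_Euclidean_space xinf_def)
    fix \<xi> c assume "AE i in leb_I. (\<Sum>k<d. \<xi> k * x0 i k) \<le> c"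
    with sol_init have init: "AE i in leb_I. (\<Sum>k<d. \<xi> k * x 0 i k) \<le> c" by eventually_elim simp
    \<comment> \<open>The maximum principle keeps the functional at most \<open>c\<close> almost
      everywhere, hence also its mean, and the inequality survives the limit of the means.\<close>
    have le: "(\<Sum>k<d. \<xi> k * (\<integral>i. x t i k \<partial>leb_I)) \<le> c" if t: "t \<ge> 0" for t
    proof -
      have I: "integrable leb_I (\<lambda>i. x t i k)" if "k < d" for k
        by (rule unit.sq_integrable_integrable[OF sq[OF t that]])
      have "(\<Sum>k<d. \<xi> k * (\<integral>i. x t i k \<partial>leb_I)) = (\<integral>i. (\<Sum>k<d. \<xi> k * x t i k) \<partial>leb_I)"
        using I by (subst Bochner_Integration.integral_sum) auto
      also have "\<dots> \<le> (\<integral>i. c \<partial>leb_I)"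
        using unit.maximum_principle[OF l2_solution_functional init t] I
        by (intro integral_mono_AE) auto
      finally show ?thesis using unit.prob_space by simp
    qed
    have "((\<lambda>t. \<integral>i. x t i k \<partial>leb_I) \<longlongrightarrow> m k) at_top" if k: "k < d" for k
    proof -
      have "filterlim (\<lambda>t. rho * t) at_top at_top"
        by (rule filterlim_tendsto_pos_mult_at_top[OF tendsto_const rho_ge(3) filterlim_ident])
      then have "filterlim (\<lambda>t. - rho * t) at_bot at_top" by (simp add: filterlim_uminus_at_bot)
      then have "((\<lambda>t. 2 * B k / rho * exp (- rho * t)) \<longlongrightarrow> 2 * B k / rho * 0) at_top"
        by (intro tendsto_mult tendsto_const filterlim_compose[OF exp_at_bot])
      then have "((\<lambda>t. 2 * B k / rho * exp (- rho * t)) \<longlongrightarrow> 0) at_top" by simp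
      moreover have "\<forall>\<^sub>F t in at_top. norm ((\<integral>i. x t i k \<partial>leb_I) - m k) \<le> norm (2 * B k / rho * exp (- rho * t)) * 1"
        using eventually_ge_at_top[of 0]
      proof eventually_elim
        case (elim t)
        show ?case
          unfolding real_norm_def mult_1_right by (rule order_trans[OF m[OF k elim] abs_ge_self])
      qed
      ultimately have "((\<lambda>t. (\<integral>i. x t i k \<partial>leb_I) - m k) \<longlongrightarrow> 0) at_top" by (rule tendsto_0_le)
      then show ?thesis by (simp add: LIM_zero_iff)
    qed
    then have "((\<lambda>t. \<Sum>k<d. \<xi> k * (\<integral>i. x t i k \<partial>leb_I)) \<longlongrightarrow> (\<Sum>k<d. \<xi> k * m k)) at_top"
      by (intro tendsto_sum tendsto_mult tendsto_const) auto
    moreover have "\<forall>\<^sub>F t in at_top. (\<Sum>k<d. \<xi> k * (\<integral>i. x t i k \<partial>leb_I)) \<le> c"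
      using eventually_ge_at_top[of 0] by eventually_elim (rule le)
    ultimately have "(\<Sum>k<d. \<xi> k * m k) \<le> c" by (intro tendsto_upperbound) auto
    then show "(\<Sum>k<d. \<xi> k * xinf k) \<le> c" by (simp add: xinf_def)
  qed
  then show ?thesis using rate unfolding A_def by blast
qed

end

theorem theorem4p13:
  fixes \<tau> \<mu> \<nu> :: real
  assumes "\<tau> > 0" and "\<mu> \<in> {0<..1}" and "\<nu> \<in> {0<..1}"
  shows "\<exists>\<alpha>>0. \<forall>(d::nat) (x0 :: real \<Rightarrow> point) (a :: real \<Rightarrow> kernel) (\<tau>d::real) (T :: nat \<Rightarrow> real)
      (v :: real \<Rightarrow> real \<Rightarrow> real) (x :: real \<Rightarrow> real \<Rightarrow> point).
    d \<ge> 1 \<longrightarrow>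
    x0 \<in> L2_space d \<longrightarrow>
    (\<lambda>(t, i, j). a t i j) \<in> borel_measurable (lebesgue_on ({0..} \<times> unit_I \<times> unit_I)) \<longrightarrow>
    (\<forall>t\<ge>0. \<forall>i\<in>unit_I. \<forall>j\<in>unit_I. 0 \<le> a t i j \<and> a t i j \<le> 1) \<longrightarrow>
    \<tau>d > 0 \<longrightarrow>
    strict_mono T \<longrightarrow> T 0 = 0 \<longrightarrow> (\<forall>k. T (Suc k) - T k \<ge> \<tau>d) \<longrightarrow>
    (\<forall>k. (\<forall>t\<in>{T k..<T (Suc k)}. kernel_on_I (a t)) \<and>
         (\<forall>s\<in>{T k..<T (Suc k)}. \<forall>t\<in>{T k..<T (Suc k)}.
            AE (i, j) in lebesgue_on (unit_I \<times> unit_I). a s i j = a t i j)) \<longrightarrow>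
    (AE t in lebesgue_on {0..}. \<exists>N C.
       strongly_connected_components (a t) N C \<and> canonical_vector (a t) N C (v t)) \<longrightarrow>
    2 / (\<mu> * \<nu>\<^sup>2) * ln (1 / \<nu>) < \<tau>d \<longrightarrow>
    (\<forall>t\<ge>0. (1 / \<tau>) * (LINT s|lebesgue_on {t..t + \<tau>}. algebraic_connectivity d (a s) (v s)) \<ge> \<mu>) \<longrightarrow>
    (\<forall>t\<ge>0. AE i in lebesgue_on unit_I. \<nu> \<le> v t i \<and> v t i \<le> 1 / \<nu>) \<longrightarrow>
    consensus_solution d a x0 x \<longrightarrow>
    (\<exists>xinf \<in> closed_hull_range d x0. \<forall>t\<ge>0.
       L2_norm d (\<lambda>i k. x t i k - xinf k)
         \<le> \<alpha> * L2_norm d (\<lambda>i k. x 0 i k - mean x0 k)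
             * exp (- (\<mu> * \<nu>\<^sup>2 - 2 / \<tau>d * ln (1 / \<nu>)) * t))"
proof (intro exI[of _ "exp (\<nu> * \<mu> * \<tau>) / \<nu> * (1 + 4 / (\<mu> * \<nu>))"] conjI allI impI)
  have pos: "\<nu> > 0" "\<mu> > 0" using assms by auto
  \<comment> \<open>The witness involves \<tau>, \<mu> and \<nu> only and is fixed before the
    dimension and all other data.\<close>
  show "exp (\<nu> * \<mu> * \<tau>) / \<nu> * (1 + 4 / (\<mu> * \<nu>)) > 0"
    using pos by (intro mult_pos_pos divide_pos_pos add_pos_pos) auto
  fix d x0 a \<tau>d T v x
  assume d: "d \<ge> (1::nat)" and x0: "x0 \<in> L2_space d"
    and "\<tau>d > 0" "T 0 = 0" "\<forall>k. T (Suc k) - T k \<ge> \<tau>d"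
    and "\<forall>k. (\<forall>t\<in>{T k..<T (Suc k)}. kernel_on_I (a t)) \<and>
         (\<forall>s\<in>{T k..<T (Suc k)}. \<forall>t\<in>{T k..<T (Suc k)}.
            AE (i, j) in lebesgue_on (unit_I \<times> unit_I). a s i j = a t i j)"
    and "AE t in lebesgue_on {0..}. \<exists>N C.
       strongly_connected_components (a t) N C \<and> canonical_vector (a t) N C (v t)"
    and "2 / (\<mu> * \<nu>\<^sup>2) * ln (1 / \<nu>) < \<tau>d"
    and "\<forall>t\<ge>0. (1 / \<tau>) * (LINT s|lebesgue_on {t..t + \<tau>}. algebraic_connectivity d (a s) (v s)) \<ge> \<mu>"
    and "\<forall>t\<ge>0. AE i in lebesgue_on unit_I. \<nu> \<le> v t i \<and> v t i \<le> 1 / \<nu>"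
    and "consensus_solution d a x0 x"
  then interpret switched_consensus \<tau> \<mu> \<nu> \<tau>d d x0 a T v x
    using assms by unfold_locales auto
  obtain xinf where xinf: "xinf \<in> closed_hull_range d x0"
    and le: "\<And>t. t \<ge> 0 \<Longrightarrow> L2_norm d (\<lambda>i k. x t i k - xinf k)
      \<le> exp (\<nu> * \<mu> * \<tau>) / \<nu> * (1 + 4 / (\<mu> * \<nu>)) * L2_norm d (\<lambda>i k. x 0 i k - mean x0 k) * exp (- rho * t)"
    using consensus_convergence[OF x0] by blast
  show "\<exists>xinf\<in>closed_hull_range d x0. \<forall>t\<ge>0. L2_norm d (\<lambda>i k. x t i k - xinf k)
      \<le> exp (\<nu> * \<mu> * \<tau>) / \<nu> * (1 + 4 / (\<mu> * \<nu>)) * L2_norm d (\<lambda>i k. x 0 i k - mean x0 k)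
        * exp (- (\<mu> * \<nu>\<^sup>2 - 2 / \<tau>d * ln (1 / \<nu>)) * t)"
  proof (intro bexI[OF _ xinf] allI impI)
    fix t :: real assume t: "t \<ge> 0"
    \<comment> \<open>\<open>rho\<close> is at least the claimed exponent and \<open>t\<close> is
      nonnegative, so the decay already proved implies the claimed one.\<close>
    have "- rho * t \<le> - (\<mu> * \<nu>\<^sup>2 - 2 / \<tau>d * ln (1 / \<nu>)) * t"
      using rho_ge(1) t by (intro mult_right_mono) auto
    then show "L2_norm d (\<lambda>i k. x t i k - xinf k)
      \<le> exp (\<nu> * \<mu> * \<tau>) / \<nu> * (1 + 4 / (\<mu> * \<nu>)) * L2_norm d (\<lambda>i k. x 0 i k - mean x0 k)
        * exp (- (\<mu> * \<nu>\<^sup>2 - 2 / \<tau>d * ln (1 / \<nu>)) * t)"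
      using pos by (intro order_trans[OF le[OF t]] mult_left_mono mult_nonneg_nonneg)
        (auto simp: L2_norm_def intro!: add_nonneg_nonneg divide_nonneg_nonneg)
  qed
qed

end
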